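(* Let $\sum_{i=1}^n \frac{\partial \phi}{\partial u_i}\, du_i^2=\sum_{i=1}^n h_i^2\, du_i^2$ be a flat Egoroff metric on $\Omega$ with rotation coefficient matrix $\beta=(\beta_{ij})$, let $h=(h_1,\dots,h_n)^t$, and set $$\theta_\lambda=\begin{pmatrix} \mathrm{i}\lambda\delta+[\delta,\beta] & \delta h\\ 0&0\end{pmatrix}.$$ Then: (1) $\theta_\lambda$ is flat for all $\lambda\in\mathbb{C}$; (2) there is a unique $F(u,\lambda)=\begin{pmatrix} E(u,\lambda)& X(u,\lambda)\\ 0&1\end{pmatrix}$ solving $F^{-1}dF=\theta_\lambda$, $F(0,\lambda)=\mathrm{I}$, and $F$ is holomorphic in $\lambda\in\mathbb{C}$; (3) $E$ is the frame for $w_\lambda=\mathrm{i}\lambda\delta+[\delta,\beta]$; (4) for $\lambda\in\mathbb{R}$, $X_\lambda=X(\cdot,\lambda)$ is a flat Lagrangian immersion in $\mathbb{C}^n$ with first and second fundamental forms $$\mathrm{I}=\sum_{i=1}^n\frac{\partial\phi}{\partial u_i}\,du_i^2,\qquad \mathrm{II}_\lambda=\lambda\sum_{i=1}^n du_i^2\otimes J\Big(\frac{\partial X_\lambda}{\partial u_i}\Big),$$ and $X(\cdot,0)$ takes values in $\mathbb{R}^n\subset\mathbb{C}^n$ and is an Egoroff net on $\mathbb{R}^n$.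
   Context: $\Omega\subset\mathbb{R}^n$ is a connected, simply connected open neighbourhood of $0$ with coordinates $u=(u_1,\dots,u_n)$; all data are smooth. $\delta=\mathrm{diag}(du_1,\dots,du_n)$ and $[\delta,\beta]=\delta\beta-\beta\delta$. A matrix-valued 1-form $\theta$ is flat if $d\theta+\theta\wedge\theta=0$. A flat Egoroff metric on $\Omega$ is a flat (zero curvature) Riemannian metric $\sum_i h_i^2\,du_i^2$, with $h_i$ real-valued and nowhere zero, for which there is a potential function $\phi$ with $\partial\phi/\partial u_i=h_i^2$ for all $i$. Its rotation coefficient matrix is $\beta=(\beta_{ij})$ with $\beta_{ij}=(h_i)_{u_j}/h_j$ for $i\ne j$ and $\beta_{ii}=0$ (symmetric because of the Egoroff condition). The frame of $w_\lambda=\mathrm{i}\lambda\delta+[\delta,\beta]$ is the unique $E(u,\lambda)\in GL(n,\mathbb{C})$ with $E^{-1}dE=w_\lambda$, $E(0,\lambda)=\mathrm{I}$. $\mathbb{C}^n=\mathbb{R}^{2n}$ carries $\langle Z_1,Z_2\rangle=\mathrm{Re}(\bar Z_1^tZ_2)$, $\omega(Z_1,Z_2)=\mathrm{Im}(\bar Z_1^tZ_2)$, and $J$ is multiplication by $\mathrm{i}$. An immersion of an $n$-manifold in $\mathbb{C}^n$ is Lagrangian if $\omega$ pulls back to $0$; it is flat if its induced metric is flat. A net function is a local diffeomorphism $x(u)$ into $\mathbb{R}^n$; it is an Egoroff net if its parameter lines are mutually orthogonal and there is $\phi(u)$ with $\partial\phi/\partial u_i=\|\partial x/\partial u_i\|^2$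 for all $i$. *)

theory Defs
  imports "HOL-Analysis.Analysis"
begin

section \<open>Smooth maps on open sets\<close>

fun Ck_on :: "nat \<Rightarrow> 'a::euclidean_space set \<Rightarrow> ('a \<Rightarrow> 'b::real_normed_vector) \<Rightarrow> bool" where
  "Ck_on 0 S f \<longleftrightarrow> continuous_on S f"
| "Ck_on (Suc k) S f \<longleftrightarrow>
     (\<forall>u\<in>S. f differentiable (at u)) \<and> (\<forall>v. Ck_on k S (\<lambda>u. frechet_derivative f (at u) v))"

text \<open>Only meant for open \<open>S\<close>.\<close>
definition smooth_on :: "'a::euclidean_space set \<Rightarrow> ('a \<Rightarrow> 'b::real_normed_vector) \<Rightarrow> bool" where
  "smooth_on S f \<longleftrightarrow> (\<forall>k. Ck_on k S f)"

definition partial :: "'n::finite \<Rightarrow> (real^'n \<Rightarrow> 'b::real_normed_vector) \<Rightarrow> real^'n \<Rightarrow> 'b" where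
  "partial i f u = frechet_derivative f (at u) (axis i 1)"

section \<open>Riemannian metrics in coordinates\<close>

text \<open>A metric on an open subset of \<open>real^'n\<close> is given by its Gram matrix \<open>g u\<close> in the coordinate frame.\<close>

definition riemannian_metric_on :: "(real^'n::finite) set \<Rightarrow> (real^'n \<Rightarrow> real^'n^'n) \<Rightarrow> bool" where
  "riemannian_metric_on \<Omega> g \<longleftrightarrow>
     smooth_on \<Omega> g \<and> (\<forall>u\<in>\<Omega>. transpose (g u) = g u \<and> (\<forall>v. v \<noteq> 0 \<longrightarrow> v \<bullet> (g u *v v) > 0))"

text \<open>\<open>christoffel g k i j\<close> is $\Gamma^k_{ij}$.\<close>
definition christoffel ::
  "(real^'n::finite \<Rightarrow> real^'n^'n) \<Rightarrow> 'n \<Rightarrow> 'n \<Rightarrow> 'n \<Rightarrow> real^'n \<Rightarrow> real" where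
  "christoffel g k i j u = (1/2) * (\<Sum>l\<in>UNIV. matrix_inv (g u) $ k $ l *
     (partial i (\<lambda>p. g p $ j $ l) u + partial j (\<lambda>p. g p $ i $ l) u - partial l (\<lambda>p. g p $ i $ j) u))"

text \<open>\<open>riemann_curvature g l k i j\<close> is the \<open>l\<close>-th component of
  $R(\partial_i,\partial_j)\partial_k =
    \nabla_{\partial_i}\nabla_{\partial_j}\partial_k - \nabla_{\partial_j}\nabla_{\partial_i}\partial_k$.\<close>
definition riemann_curvature ::
  "(real^'n::finite \<Rightarrow> real^'n^'n) \<Rightarrow> 'n \<Rightarrow> 'n \<Rightarrow> 'n \<Rightarrow> 'n \<Rightarrow> real^'n \<Rightarrow> real" where
  "riemann_curvature g l k i j u =
     partial i (christoffel g l j k) u - partial j (christoffel g l i k) u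
     + (\<Sum>m\<in>UNIV. christoffel g l i m u * christoffel g m j k u
                - christoffel g l j m u * christoffel g m i k u)"

definition flat_metric_on :: "(real^'n::finite) set \<Rightarrow> (real^'n \<Rightarrow> real^'n^'n) \<Rightarrow> bool" where
  "flat_metric_on \<Omega> g \<longleftrightarrow> riemannian_metric_on \<Omega> g \<and>
     (\<forall>u\<in>\<Omega>. \<forall>l k i j. riemann_curvature g l k i j u = 0)"

definition diag_metric :: "(real^'n::finite \<Rightarrow> real^'n) \<Rightarrow> real^'n \<Rightarrow> real^'n^'n" where
  "diag_metric h u = (\<chi> i j. if i = j then (h u $ i)\<^sup>2 else 0)"

definition flat_egoroff_metric_on ::
  "(real^'n::finite) set \<Rightarrow> (real^'n \<Rightarrow> real) \<Rightarrow> (real^'n \<Rightarrow> real^'n) \<Rightarrow> bool" where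
  "flat_egoroff_metric_on \<Omega> \<phi> h \<longleftrightarrow>
     smooth_on \<Omega> \<phi> \<and> smooth_on \<Omega> h \<and>
     (\<forall>u\<in>\<Omega>. \<forall>i. h u $ i \<noteq> 0 \<and> partial i \<phi> u = (h u $ i)\<^sup>2) \<and>
     flat_metric_on \<Omega> (diag_metric h)"

definition rotation_coeff :: "(real^'n::finite \<Rightarrow> real^'n) \<Rightarrow> real^'n \<Rightarrow> real^'n^'n" where
  "rotation_coeff h u = (\<chi> i j. if i = j then 0 else partial j (\<lambda>p. h p $ i) u / h u $ j)"

section \<open>Matrix-valued 1-forms\<close>

text \<open>A matrix-valued 1-form is a function \<open>\<theta>\<close> with \<open>\<theta> u v\<close> the value at the point \<open>u\<close> on the
  tangent vector \<open>v\<close> (linear in \<open>v\<close>). On the constant vector fields \<open>v\<close>, \<open>w\<close> (which commute),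
  $d\theta(v,w) = D_v(\theta(w)) - D_w(\theta(v))$ and
  $(\theta\wedge\theta)(v,w) = \theta(v)\theta(w) - \theta(w)\theta(v)$.\<close>

definition ext_deriv ::
  "(real^'n::finite \<Rightarrow> real^'n \<Rightarrow> complex^'m::finite^'m) \<Rightarrow> real^'n \<Rightarrow> real^'n \<Rightarrow> real^'n \<Rightarrow> complex^'m^'m" where
  "ext_deriv \<theta> u v w =
     frechet_derivative (\<lambda>p. \<theta> p w) (at u) v - frechet_derivative (\<lambda>p. \<theta> p v) (at u) w"

definition wedge_self ::
  "(real^'n::finite \<Rightarrow> real^'n \<Rightarrow> complex^'m::finite^'m) \<Rightarrow> real^'n \<Rightarrow> real^'n \<Rightarrow> real^'n \<Rightarrow> complex^'m^'m" where
  "wedge_self \<theta> u v w = \<theta> u v ** \<theta> u w - \<theta> u w ** \<theta> u v"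

definition flat_form_on ::
  "(real^'n::finite) set \<Rightarrow> (real^'n \<Rightarrow> real^'n \<Rightarrow> complex^'m::finite^'m) \<Rightarrow> bool" where
  "flat_form_on \<Omega> \<theta> \<longleftrightarrow> (\<forall>u\<in>\<Omega>. \<forall>v w. ext_deriv \<theta> u v w + wedge_self \<theta> u v w = 0)"

text \<open>$F^{-1}dF = \theta$ with $F(0) = \mathrm{I}$.\<close>
definition frame_solution_on ::
  "(real^'n::finite) set \<Rightarrow> (real^'n \<Rightarrow> real^'n \<Rightarrow> complex^'m::finite^'m) \<Rightarrow> (real^'n \<Rightarrow> complex^'m^'m) \<Rightarrow> bool" where
  "frame_solution_on \<Omega> \<theta> F \<longleftrightarrow>
     (\<forall>u\<in>\<Omega>. F differentiable (at u) \<and> invertible (F u) \<and>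
        (\<forall>v. matrix_inv (F u) ** frechet_derivative F (at u) v = \<theta> u v)) \<and>
     F 0 = mat 1"

text \<open>\<open>F\<close> is the unique solution; functions are compared on \<open>\<Omega>\<close> only, as values outside \<open>\<Omega>\<close> are
  irrelevant.\<close>
definition is_frame_on ::
  "(real^'n::finite) set \<Rightarrow> (real^'n \<Rightarrow> real^'n \<Rightarrow> complex^'m::finite^'m) \<Rightarrow> (real^'n \<Rightarrow> complex^'m^'m) \<Rightarrow> bool" where
  "is_frame_on \<Omega> \<theta> F \<longleftrightarrow>
     smooth_on \<Omega> F \<and> frame_solution_on \<Omega> \<theta> F \<and>
     (\<forall>G. frame_solution_on \<Omega> \<theta> G \<longrightarrow> (\<forall>u\<in>\<Omega>. G u = F u))"

definition complex_vec :: "real^'n::finite \<Rightarrow> complex^'n" where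
  "complex_vec x = (\<chi> i. complex_of_real (x $ i))"

definition complex_mat :: "real^'n::finite^'n \<Rightarrow> complex^'n^'n" where
  "complex_mat A = (\<chi> i j. complex_of_real (A $ i $ j))"

text \<open>The form $\delta = \mathrm{diag}(du_1,\dots,du_n)$ evaluated on a tangent vector.\<close>
definition delta :: "real^'n::finite \<Rightarrow> complex^'n^'n" where
  "delta v = (\<chi> i j. if i = j then complex_of_real (v $ i) else 0)"

definition w_form ::
  "(real^'n::finite \<Rightarrow> real^'n^'n) \<Rightarrow> complex \<Rightarrow> real^'n \<Rightarrow> real^'n \<Rightarrow> complex^'n^'n" where
  "w_form \<beta> lam u v = (\<chi> i j. \<i> * lam * delta v $ i $ j)
     + (delta v ** complex_mat (\<beta> u) - complex_mat (\<beta> u) ** delta v)"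

text \<open>The $(n+1)\times(n+1)$ matrix with blocks $A, b$ over $c, d$; the index \<open>None\<close> is the last one.\<close>
definition block_mat ::
  "complex^'n::finite^'n \<Rightarrow> complex^'n \<Rightarrow> complex^'n \<Rightarrow> complex \<Rightarrow> complex^('n option)^('n option)" where
  "block_mat A b c d = (\<chi> i j.
     case i of Some k \<Rightarrow> (case j of Some l \<Rightarrow> A $ k $ l | None \<Rightarrow> b $ k)
             | None \<Rightarrow> (case j of Some l \<Rightarrow> c $ l | None \<Rightarrow> d))"

definition theta_form ::
  "(real^'n::finite \<Rightarrow> real^'n) \<Rightarrow> complex \<Rightarrow> real^'n \<Rightarrow> real^'n \<Rightarrow> complex^('n option)^('n option)" where
  "theta_form h lam u v =
     block_mat (w_form (rotation_coeff h) lam u v) (delta v *v complex_vec (h u)) 0 0"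

section \<open>Immersions into complex n-space\<close>

definition hermitian :: "complex^'n::finite \<Rightarrow> complex^'n \<Rightarrow> complex" where
  "hermitian Z W = (\<Sum>i\<in>UNIV. cnj (Z $ i) * W $ i)"

lemma inner_eq_Re_hermitian: "Z \<bullet> W = Re (hermitian Z W)"
  by (simp add: hermitian_def inner_vec_def inner_complex_def)

definition omega :: "complex^'n::finite \<Rightarrow> complex^'n \<Rightarrow> real" where
  "omega Z W = Im (hermitian Z W)"

definition J_mult :: "complex^'n::finite \<Rightarrow> complex^'n" where
  "J_mult Z = \<i> *s Z"

definition immersion_on :: "(real^'n::finite) set \<Rightarrow> (real^'n \<Rightarrow> 'b::real_normed_vector) \<Rightarrow> bool" where
  "immersion_on \<Omega> X \<longleftrightarrow> smooth_on \<Omega> X \<and> (\<forall>u\<in>\<Omega>. inj (frechet_derivative X (at u)))"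

definition lagrangian_immersion_on :: "(real^'n::finite) set \<Rightarrow> (real^'n \<Rightarrow> complex^'n) \<Rightarrow> bool" where
  "lagrangian_immersion_on \<Omega> X \<longleftrightarrow> immersion_on \<Omega> X \<and>
     (\<forall>u\<in>\<Omega>. \<forall>v w. omega (frechet_derivative X (at u) v) (frechet_derivative X (at u) w) = 0)"

definition first_ff :: "(real^'n::finite \<Rightarrow> 'b::real_inner) \<Rightarrow> real^'n \<Rightarrow> real^'n \<Rightarrow> real^'n \<Rightarrow> real" where
  "first_ff X u v w = frechet_derivative X (at u) v \<bullet> frechet_derivative X (at u) w"

definition induced_metric :: "(real^'n::finite \<Rightarrow> 'b::real_inner) \<Rightarrow> real^'n \<Rightarrow> real^'n^'n" where
  "induced_metric X u = (\<chi> i j. first_ff X u (axis i 1) (axis j 1))"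

text \<open>The component of \<open>z\<close> orthogonal to the subspace \<open>T\<close>.\<close>
definition normal_part :: "'b::euclidean_space set \<Rightarrow> 'b \<Rightarrow> 'b" where
  "normal_part T z = (THE N. z - N \<in> T \<and> (\<forall>t\<in>T. orthogonal N t))"

text \<open>The normal-bundle-valued second fundamental form: normal component of the second derivative.\<close>
definition second_ff :: "(real^'n::finite \<Rightarrow> 'b::euclidean_space) \<Rightarrow> real^'n \<Rightarrow> real^'n \<Rightarrow> real^'n \<Rightarrow> 'b" where
  "second_ff X u v w = normal_part (range (frechet_derivative X (at u)))
     (frechet_derivative (\<lambda>p. frechet_derivative X (at p) w) (at u) v)"

section \<open>Egoroff nets\<close>

definition local_diffeo_on :: "(real^'n::finite) set \<Rightarrow> (real^'n \<Rightarrow> real^'n) \<Rightarrow> bool" where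
  "local_diffeo_on \<Omega> x \<longleftrightarrow>
     (\<forall>u\<in>\<Omega>. \<exists>U V y. open U \<and> u \<in> U \<and> U \<subseteq> \<Omega> \<and> open V \<and>
        homeomorphism U V x y \<and> smooth_on U x \<and> smooth_on V y)"

definition egoroff_net_on :: "(real^'n::finite) set \<Rightarrow> (real^'n \<Rightarrow> real^'n) \<Rightarrow> bool" where
  "egoroff_net_on \<Omega> x \<longleftrightarrow> local_diffeo_on \<Omega> x \<and>
     (\<forall>u\<in>\<Omega>. \<forall>i j. i \<noteq> j \<longrightarrow> orthogonal (partial i x u) (partial j x u)) \<and>
     (\<exists>\<phi>. smooth_on \<Omega> \<phi> \<and> (\<forall>u\<in>\<Omega>. \<forall>i. partial i \<phi> u = (norm (partial i x u))\<^sup>2))"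

end

theory Submission
  imports Defs
begin

text \<open>Why \<open>\<theta>\<^sub>\<lambda>\<close> is flat. Write \<open>W = [\<delta>, \<beta>]\<close>, let \<open>H = diag(h)\<close> and let \<open>\<Gamma>\<close> be the matrix of Christoffel symbols of
\<open>\<Sum>\<^sub>i h\<^sub>i\<^sup>2 du\<^sub>i\<^sup>2\<close>. The Egoroff condition makes \<open>\<beta>\<close> symmetric, and then
\<open>\<Gamma> = H\<^sup>-\<^sup>1 W H + H\<^sup>-\<^sup>1 dH\<close> (\<open>christoffel_gauge\<close>): \<open>W\<close> is the Levi-Civita connection in the orthonormal frame
\<open>h\<^sub>i\<^sup>-\<^sup>1 \<partial>\<^sub>i\<close>. Curvature is conjugated by a change of frame, so a flat metric gives \<open>dW + W \<and> W = 0\<close>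
(\<open>structure_equation\<close>). The terms with \<open>\<lambda>\<close> cancel because diagonal matrices commute, and the last column of
the flatness equation is the law \<open>\<partial>\<^sub>j h\<^sub>i = \<beta>\<^sub>i\<^sub>j h\<^sub>j\<close> (\<open>theta_form_flat\<close>).

Why the frame exists. A flat connection has a parallel section through every vector near every point: transport
the vector along rays; flatness says that the first-order guess for the transport along a neighbouring ray is
correct up to second order, which yields the derivative in all directions without any theorem on the dependence of
solutions on parameters (\<open>parallel_exists_ball\<close>). Parallel sections form a locally constant sheaf, and on a
simply connected set such a sheaf has global sections (\<open>global_section\<close>): sections are continued along paths, and a
homotopy is lifted square by square. Uniqueness is an open and closed condition (\<open>parallel_unique\<close>), and most
algebraic properties of the frame follow from it: two expressions that solve the same equation and agree at \<open>0\<close> are equal.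

Why the frame is holomorphic. \<open>\<theta>\<^sub>\<lambda>\<close> is affine in \<open>\<lambda>\<close>, so the difference quotients of \<open>F\<close> in \<open>\<lambda>\<close> solve a linear
equation whose coefficients converge. By a Gronwall estimate, their convergence passes from a point to a
neighbourhood, and it is trivial at \<open>0\<close> (\<open>affine_family_holomorphic\<close>).

Why \<open>X\<^sub>\<lambda>\<close> has the stated geometry. For real \<open>\<lambda>\<close> the form \<open>w\<^sub>\<lambda>\<close> is skew-Hermitian, so \<open>E\<close> is unitary, and
\<open>dX = E \<delta> h\<close>. Hermitian products of tangent vectors are therefore the real numbers \<open>\<Sum>\<^sub>i h\<^sub>i\<^sup>2 v\<^sub>i w\<^sub>i\<close>: the imaginary part
gives the Lagrangian condition and the real part the first fundamental form. In the second derivative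
\<open>E (w\<^sub>\<lambda> \<delta> h + \<delta> dh)\<close> the only term that is not \<open>E\<close> applied to a real vector, hence not tangent, is the one with
\<open>\<i> \<lambda> \<delta> \<delta> h\<close>, which is normal. At \<open>\<lambda> = 0\<close> everything is real, and the orthogonality of the partial derivatives makes
\<open>X\<^sub>0\<close> a local diffeomorphism with an explicit inverse Jacobian.\<close>

section \<open>Linear differential equations with small coefficients\<close>

text \<open>With coefficient at most \<open>1/2\<close> on an interval of length \<open>1\<close>, the mean value inequality bounds the maximum of \<open>y\<close> by
half of itself plus the data, so no exponential is needed. Every use below first shrinks a ball to make the
coefficient small.\<close>

lemma gronwall_unit_interval:
  fixes y :: "real \<Rightarrow> 'a::real_normed_vector"
  assumes y: "\<And>t. t \<in> {0..1} \<Longrightarrow> (y has_vector_derivative y' t) (at t within {0..1})"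
    and b: "\<And>t. t \<in> {0..1} \<Longrightarrow> norm (y' t) \<le> norm (y t) / 2 + e"
    and t: "t \<in> {0..1}"
  shows "norm (y t) \<le> 2 * (norm (y 0) + e)"
proof -
  have "continuous_on {0..1} y"
    using y has_vector_derivative_continuous continuous_on_eq_continuous_within by blast
  then have "continuous_on {0..1} (\<lambda>t. norm (y t))"
    by (intro continuous_intros)
  then obtain s where s: "s \<in> {0..1}" "\<And>t. t \<in> {0..1} \<Longrightarrow> norm (y t) \<le> norm (y s)"
    using continuous_attains_sup[of "{0..1::real}" "\<lambda>t. norm (y t)"] by auto
  have e: "0 \<le> norm (y s) / 2 + e"
    using b[OF s(1)] norm_ge_zero[of "y' s"] by linarith
  have "norm (y s - y 0) \<le> (norm (y s) / 2 + e) * norm (s - 0)"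
  proof (rule differentiable_bound[of "{0..1}" y "\<lambda>t h. h *\<^sub>R y' t"])
    show "onorm (\<lambda>h. h *\<^sub>R y' t) \<le> norm (y s) / 2 + e" if "t \<in> {0..1}" for t
    proof (rule onorm_le)
      show "norm (h *\<^sub>R y' t) \<le> (norm (y s) / 2 + e) * norm h" for h
        using b[OF that] s(2)[OF that] by (simp add: mult.commute mult_left_mono)
    qed
  qed (use y s in \<open>auto simp: has_vector_derivative_def\<close>)
  also have "\<dots> \<le> norm (y s) / 2 + e"
    using s e by (auto intro: mult_left_le)
  finally have "norm (y s) \<le> 2 * (norm (y 0) + e)"
    using norm_triangle_sub[of "y s" "y 0"] by (simp add: field_simps)
  then show ?thesis using s(2)[OF t] by linarith
qed

text \<open>Picard iteration, written as the series of its increments \<open>z k\<close>: each integration gains a factor \<open>1/2\<close>, so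
the series of the derivatives converges uniformly.\<close>

lemma linear_ode_unit_interval:
  fixes A :: "real \<Rightarrow> 'a::banach \<Rightarrow>\<^sub>L 'a"
  assumes A: "continuous_on {0..1} A" and small: "\<And>t. t \<in> {0..1} \<Longrightarrow> norm (A t) \<le> 1/2"
  obtains y where "y 0 = m"
    "\<And>t. t \<in> {0..1} \<Longrightarrow> (y has_vector_derivative A t (y t)) (at t within {0..1})"
proof -
  define z where "z = rec_nat (\<lambda>t. m) (\<lambda>k zk t. integral {0..t} (\<lambda>s. A s (zk s)))"
  have z0: "z 0 = (\<lambda>t. m)" and zS: "\<And>k. z (Suc k) = (\<lambda>t. integral {0..t} (\<lambda>s. A s (z k s)))"
    by (simp_all add: z_def)
  have step: "((\<lambda>t. integral {0..t} (\<lambda>s. A s (f s))) has_vector_derivative A t (f t)) (at t within {0..1})"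
    if "continuous_on {0..1} f" "t \<in> {0..1}" for f t
    by (rule integral_has_vector_derivative) (use that A in \<open>auto intro!: continuous_intros\<close>)
  have zc: "continuous_on {0..1} (z k)" for k
  proof (induction k)
    case (Suc k)
    then show ?case
      unfolding zS using step has_vector_derivative_continuous continuous_on_eq_continuous_within
      by blast
  qed (simp add: z0)
  have Az: "norm (A t (z k t)) \<le> norm m * (1/2) ^ Suc k"
    if "norm (z k t) \<le> norm m * (1/2)^k" "t \<in> {0..1}" for k t
  proof -
    have "norm (A t (z k t)) \<le> norm (A t) * norm (z k t)" by (rule norm_blinfun)
    also have "\<dots> \<le> 1/2 * (norm m * (1/2)^k)"
      using small[OF that(2)] that by (intro mult_mono) auto
    finally show ?thesis by simp
  qed
  have bound: "t \<in> {0..1} \<Longrightarrow> norm (z k t) \<le> norm m * (1/2)^k" for k t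
  proof (induction k arbitrary: t)
    case (Suc k)
    have "norm (integral {0..t} (\<lambda>s. A s (z k s))) \<le> (norm m * (1/2)^Suc k) * (t - 0)"
    proof (rule integral_bound)
      show "continuous_on {0..t} (\<lambda>s. A s (z k s))"
        using Suc.prems by (intro continuous_intros continuous_on_subset[OF A] continuous_on_subset[OF zc]) auto
    qed (use Suc Az in auto)
    also have "\<dots> \<le> norm m * (1/2)^Suc k"
      using Suc.prems by (intro mult_left_le) auto
    finally show ?case by (simp add: zS)
  qed (simp add: z0)
  define y where "y = (\<lambda>t. \<Sum>k. z k t)"
  \<comment> \<open>The derivative of the increment with index \<open>Suc k\<close> involves the increment with index \<open>k\<close>.\<close>
  define f' where "f' = (\<lambda>n t (h::real). case n of 0 \<Rightarrow> 0 | Suc k \<Rightarrow> h *\<^sub>R A t (z k t))"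
  have der: "(z n has_derivative f' n t) (at t within {0..1})" if "t \<in> {0..1}" for n t
  proof (cases n)
    case 0
    then show ?thesis by (simp add: z0 f'_def)
  next
    case (Suc k)
    then show ?thesis
      using step[OF zc that] by (simp add: zS f'_def has_vector_derivative_def)
  qed
  have ul: "uniform_limit {0..1} (\<lambda>n t. \<Sum>i<n. z i t) y sequentially"
    unfolding y_def
    by (rule Weierstrass_m_test[of _ _ "\<lambda>k. norm m * (1/2)^k"]) (use bound in \<open>auto intro: summable_mult\<close>)
  have sums: "(\<lambda>n. z n t) sums y t" if "t \<in> {0..1}" for t
    using tendsto_uniform_limitI[OF ul that] by (simp add: sums_def)
  have "\<exists>g. \<forall>t\<in>{0..1}. (\<lambda>n. z n t) sums (g t) \<and>
      (g has_derivative (\<lambda>h. h *\<^sub>R A t (y t))) (at t within {0..1})"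
  proof (rule has_derivative_series[OF _ der])
    fix e :: real assume "e > 0"
    have ev: "\<forall>\<^sub>F n in sequentially. \<forall>t\<in>{0..1}. norm ((\<Sum>i<n. z i t) - y t) < e"
      using uniform_limitD[OF ul \<open>e > 0\<close>] by (simp add: dist_norm)
    then have "\<forall>\<^sub>F n in sequentially. \<forall>t\<in>{0..1}. norm ((\<Sum>i<n - 1. z i t) - y t) < e"
      unfolding eventually_sequentially by (metis Suc_le_D Suc_le_mono diff_Suc_1)
    moreover have "\<forall>\<^sub>F n::nat in sequentially. n > 0"
      by (rule eventually_gt_at_top)
    ultimately show "\<forall>\<^sub>F n in sequentially. \<forall>t\<in>{0..1}. \<forall>h.
        norm ((\<Sum>i<n. f' i t h) - h *\<^sub>R A t (y t)) \<le> e * norm h"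
    proof eventually_elim
      case (elim n)
      then obtain k where k: "n = Suc k" using gr0_conv_Suc by blast
      show ?case
      proof (intro ballI allI)
        fix t h assume t: "t \<in> {0..1::real}"
        have "(\<Sum>i<n. f' i t h) = h *\<^sub>R A t (\<Sum>i<k. z i t)"
          unfolding k by (subst sum.lessThan_Suc_shift)
            (simp add: f'_def blinfun.sum_right scaleR_sum_right)
        then have "(\<Sum>i<n. f' i t h) - h *\<^sub>R A t (y t) = h *\<^sub>R A t ((\<Sum>i<k. z i t) - y t)"
          by (simp add: blinfun.diff_right scaleR_diff_right)
        moreover have "norm (A t ((\<Sum>i<k. z i t) - y t)) \<le> e"
        proof -
          have "norm (A t ((\<Sum>i<k. z i t) - y t)) \<le> norm (A t) * norm ((\<Sum>i<k. z i t) - y t)"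
            by (rule norm_blinfun)
          also have "\<dots> \<le> 1 * e"
            using small[OF t] elim(1) t k \<open>e > 0\<close> by (intro mult_mono) (auto simp: less_imp_le)
          finally show ?thesis by simp
        qed
        ultimately show "norm ((\<Sum>i<n. f' i t h) - h *\<^sub>R A t (y t)) \<le> e * norm h"
          by (simp add: mult.commute[of e] mult_left_mono)
      qed
    qed
  next
    show "(\<lambda>n. z n 0) sums y 0" by (rule sums) auto
  qed auto
  then obtain g where g: "\<And>t. t\<in>{0..1} \<Longrightarrow> (\<lambda>n. z n t) sums (g t)"
    "\<And>t. t\<in>{0..1} \<Longrightarrow> (g has_derivative (\<lambda>h. h *\<^sub>R A t (y t))) (at t within {0..1})"
    by blast
  have gy: "g t = y t" if "t \<in> {0..1}" for t using g(1)[OF that] sums[OF that] sums_unique2 by blast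
  show thesis
  proof
    show "g 0 = m"
    proof -
      have "z n 0 = (if n = 0 then m else 0)" for n by (cases n) (auto simp: z0 zS)
      moreover have "(\<lambda>n. if n = 0 then m else 0) sums m"
        using sums_single[of 0 "\<lambda>_. m"] by simp
      ultimately have "(\<lambda>n. z n 0) sums m" by simp
      then show ?thesis using g(1)[of 0] sums_unique2 by auto
    qed
    show "(g has_vector_derivative A t (g t)) (at t within {0..1})" if "t \<in> {0..1}" for t
      using g(2)[OF that] gy[OF that] by (simp add: has_vector_derivative_def)
  qed
qed

section \<open>Parallel sections of a flat connection\<close>

text \<open>A connection on the trivial bundle with fibre \<open>'a\<close>: the section \<open>s\<close> is parallel if \<open>ds = \<omega> s\<close>. The sign is chosen so
that \<open>dF = F \<theta>\<close> is the case where \<open>\<omega>\<close> is right multiplication by \<open>\<theta>\<close>.\<close>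

definition parallel_on ::
  "('e::real_normed_vector \<Rightarrow> 'e \<Rightarrow>\<^sub>L ('a::real_normed_vector \<Rightarrow>\<^sub>L 'a)) \<Rightarrow> 'e set \<Rightarrow> ('e \<Rightarrow> 'a) \<Rightarrow> bool" where
  "parallel_on \<omega> U s \<longleftrightarrow> (\<forall>u\<in>U. (s has_derivative (\<lambda>v. \<omega> u v (s u))) (at u))"

lemma parallel_along_segment:
  assumes s: "parallel_on \<omega> U s" and seg: "\<And>t. t \<in> {0..1} \<Longrightarrow> p + t *\<^sub>R z \<in> U" and t: "t \<in> {0..1}"
  shows "((\<lambda>t. s (p + t *\<^sub>R z)) has_vector_derivative \<omega> (p + t *\<^sub>R z) z (s (p + t *\<^sub>R z))) (at t within {0..1})"
proof -
  have "((\<lambda>t. p + t *\<^sub>R z) has_vector_derivative z) (at t within {0..1})"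
    by (auto intro!: derivative_eq_intros)
  moreover have "(s has_derivative (\<lambda>v. \<omega> (p + t *\<^sub>R z) v (s (p + t *\<^sub>R z)))) (at (p + t *\<^sub>R z))"
    using s seg[OF t] by (simp add: parallel_on_def)
  ultimately show ?thesis
    using vector_derivative_diff_chain_within[of "\<lambda>t. p + t *\<^sub>R z" z t "{0..1}" s] has_derivative_at_withinI
    unfolding o_def by blast
qed

lemma parallel_zero_ball:
  assumes s: "parallel_on \<omega> (ball p R) s" and small: "\<And>u. u \<in> ball p R \<Longrightarrow> norm (\<omega> u) * R \<le> 1/2"
    and "s p = 0" and x: "x \<in> ball p R"
  shows "s x = 0"
proof -
  define z where "z = x - p"
  have z: "norm z < R" using x by (simp add: z_def dist_norm norm_minus_commute)
  have inb: "p + t *\<^sub>R z \<in> ball p R" if "t \<in> {0..1}" for t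
  proof -
    have "norm (t *\<^sub>R z) \<le> norm z" using that by (auto intro: mult_left_le_one_le)
    then show ?thesis using z by (simp add: dist_norm)
  qed
  have "norm (s (p + 1 *\<^sub>R z)) \<le> 2 * (norm (s (p + 0 *\<^sub>R z)) + 0)"
  proof (rule gronwall_unit_interval[OF parallel_along_segment[OF s inb]])
    fix t :: real assume t: "t \<in> {0..1}"
    let ?c = "p + t *\<^sub>R z"
    have "norm (\<omega> ?c z (s ?c)) \<le> norm (\<omega> ?c z) * norm (s ?c)" by (rule norm_blinfun)
    also have "\<dots> \<le> (norm (\<omega> ?c) * norm z) * norm (s ?c)" by (intro mult_right_mono norm_blinfun) auto
    also have "\<dots> \<le> 1/2 * norm (s ?c)"
      using small[OF inb[OF t]] z by (intro mult_right_mono order_trans[OF mult_left_mono[of "norm z" R]]) auto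
    finally show "norm (\<omega> ?c z (s ?c)) \<le> norm (s ?c) / 2 + 0" by simp
  qed auto
  then show ?thesis using \<open>s p = 0\<close> by (simp add: z_def)
qed

text \<open>On such a ball the connection is too weak for transport along a segment to exceed the bounds that the two lemmas on
the unit interval ask for.\<close>

lemma small_ball:
  fixes \<omega> :: "'e::real_normed_vector \<Rightarrow> 'b::real_normed_vector"
  assumes "open U" "p \<in> U" "continuous_on U \<omega>"
  obtains R where "R > 0" "ball p R \<subseteq> U" "\<And>u. u \<in> ball p R \<Longrightarrow> norm (\<omega> u) * R \<le> 1/2"
proof -
  obtain r where r: "r > 0" "ball p r \<subseteq> U" using assms openE by blast
  have "isCont \<omega> p" using assms continuous_on_eq_continuous_at by blast
  then obtain d where d: "d > 0" "\<And>u. dist u p < d \<Longrightarrow> dist (\<omega> u) (\<omega> p) < 1"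
    unfolding continuous_at_eps_delta using zero_less_one by blast
  define R where "R = min (min r d) (1 / (2 * (norm (\<omega> p) + 1)))"
  have np: "norm (\<omega> p) + 1 > 0" by (smt (verit) norm_ge_zero)
  show thesis
  proof
    show "R > 0" using r d np by (simp add: R_def)
    show "ball p R \<subseteq> U" using r by (auto simp: R_def)
    fix u assume u: "u \<in> ball p R"
    then have "dist (\<omega> u) (\<omega> p) < 1" by (intro d) (auto simp: R_def dist_commute)
    then have "norm (\<omega> u) \<le> norm (\<omega> p) + 1"
      using norm_triangle_sub[of "\<omega> u" "\<omega> p"] by (simp add: dist_norm)
    moreover have "R \<le> 1 / (2 * (norm (\<omega> p) + 1))" by (simp add: R_def)
    ultimately have "norm (\<omega> u) * R \<le> (norm (\<omega> p) + 1) * (1 / (2 * (norm (\<omega> p) + 1)))"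
      using \<open>R > 0\<close> np by (intro mult_mono) auto
    also have "\<dots> = 1/2" using np by (simp add: field_simps)
    finally show "norm (\<omega> u) * R \<le> 1/2" .
  qed
qed

lemma parallel_on_subset: "parallel_on \<omega> U s \<Longrightarrow> V \<subseteq> U \<Longrightarrow> parallel_on \<omega> V s"
  by (auto simp: parallel_on_def)

lemma parallel_on_diff: "parallel_on \<omega> U s \<Longrightarrow> parallel_on \<omega> U t \<Longrightarrow> parallel_on \<omega> U (\<lambda>u. s u - t u)"
  unfolding parallel_on_def by (auto intro!: derivative_eq_intros simp: blinfun.diff_right)

text \<open>The zero set of the difference is closed, and it is open because a parallel section that vanishes at the centre of a
small ball vanishes along every ray.\<close>

lemma parallel_unique:
  assumes U: "open U" "connected U" and \<omega>: "continuous_on U \<omega>"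
    and s: "parallel_on \<omega> U s" and t: "parallel_on \<omega> U t"
    and x: "x \<in> U" "s x = t x" and u: "u \<in> U"
  shows "s u = t u"
proof -
  define Z where "Z = {u \<in> U. s u - t u = 0}"
  have d: "parallel_on \<omega> U (\<lambda>u. s u - t u)" using s t by (rule parallel_on_diff)
  then have "continuous_on U (\<lambda>u. s u - t u)"
    unfolding parallel_on_def
    by (meson U(1) continuous_on_eq_continuous_at has_derivative_continuous)
  then have "closedin (top_of_set U) Z"
    unfolding Z_def by (rule continuous_closedin_preimage_constant)
  moreover have "open Z"
    unfolding open_contains_ball
  proof
    fix p assume "p \<in> Z"
    then have p: "p \<in> U" "s p - t p = 0" by (auto simp: Z_def)
    obtain R where R: "R > 0" "ball p R \<subseteq> U" "\<And>u. u \<in> ball p R \<Longrightarrow> norm (\<omega> u) * R \<le> 1/2"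
      using small_ball[OF U(1) p(1) \<omega>] by blast
    have "ball p R \<subseteq> Z"
      using parallel_zero_ball[OF parallel_on_subset[OF d R(2)] R(3) p(2)] R(2) by (auto simp: Z_def)
    then show "\<exists>e>0. ball p e \<subseteq> Z" using R by blast
  qed
  moreover have "Z \<subseteq> U" by (auto simp: Z_def)
  ultimately have "Z = U"
    using U x unfolding connected_clopen
    by (metis (mono_tags, lifting) Z_def diff_self empty_iff mem_Collect_eq open_openin openin_open_eq)
  then show ?thesis using u by (auto simp: Z_def)
qed


text \<open>Let \<open>y x\<close> be the transport of \<open>m\<close> along the ray \<open>c x t = p + t (x - p)\<close>, and \<open>s x = y x 1\<close>. If the claim
\<open>ds = \<omega> s\<close> holds, then \<open>T t = y x t + t \<omega>(w) (y x t)\<close> approximates the transport \<open>y (x + w) t\<close> along the ray to \<open>x + w\<close> to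
first order in \<open>w\<close>. Conversely, insert \<open>T\<close> into the equation along that ray: the terms of first order in
\<open>w\<close> are \<open>t\<close> times the curvature in the directions \<open>x - p\<close> and \<open>w\<close>, so by flatness the defect is \<open>o(w)\<close>, and the
Gronwall estimate carries this over to \<open>T 1 - y (x + w) 1\<close>. The hypothesis \<open>flat\<close> says that the covariant derivatives
commute.\<close>

lemma parallel_exists_ball:
  fixes \<omega> :: "'e::euclidean_space \<Rightarrow> 'e \<Rightarrow>\<^sub>L ('a::banach \<Rightarrow>\<^sub>L 'a)"
  assumes der: "\<And>u. u \<in> ball p R \<Longrightarrow> (\<omega> has_derivative blinfun_apply (\<omega>' u)) (at u)"
    and cont: "continuous_on (ball p R) \<omega>'"
    and flat: "\<And>u v w. u \<in> ball p R \<Longrightarrow>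
      \<omega>' u v w + (\<omega> u w o\<^sub>L \<omega> u v) = \<omega>' u w v + (\<omega> u v o\<^sub>L \<omega> u w)"
    and small: "\<And>u. u \<in> ball p R \<Longrightarrow> norm (\<omega> u) * R \<le> 1/2"
    and "R > 0"
  obtains s where "s p = m" "parallel_on \<omega> (ball p R) s"
proof -
  define c where "c = (\<lambda>x t. p + t *\<^sub>R (x - p))"
  have cball: "c x t \<in> ball p R" if "x \<in> ball p R" "t \<in> {0..1}" for x t
  proof -
    have "norm (t *\<^sub>R (x - p)) \<le> norm (x - p)" using that by (auto intro: mult_left_le_one_le)
    then show ?thesis using that by (simp add: c_def dist_norm norm_minus_commute)
  qed
  have contw: "continuous_on (ball p R) \<omega>"
    using der by (meson continuous_at_imp_continuous_on has_derivative_continuous)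
  define A where "A = (\<lambda>x t. \<omega> (c x t) (x - p))"
  have Asmall: "norm (A x t) \<le> 1/2" if "x \<in> ball p R" "t \<in> {0..1}" for x t
  proof -
    have "norm (A x t) \<le> norm (\<omega> (c x t)) * norm (x - p)" unfolding A_def by (rule norm_blinfun)
    also have "\<dots> \<le> norm (\<omega> (c x t)) * R"
      using that by (intro mult_left_mono) (auto simp: dist_norm norm_minus_commute)
    also have "\<dots> \<le> 1/2" using small[OF cball[OF that]] .
    finally show ?thesis .
  qed
  have "\<exists>y. y 0 = m \<and> (\<forall>t\<in>{0..1}. (y has_vector_derivative A x t (y t)) (at t within {0..1}))"
    if x: "x \<in> ball p R" for x
  proof -
    have "continuous_on {0..1} (c x)"
      unfolding c_def by (intro continuous_intros)
    then have "continuous_on {0..1} (A x)"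
      unfolding A_def using cball[OF x]
      by (intro continuous_intros continuous_on_compose2[OF contw]) auto
    then show ?thesis
      using linear_ode_unit_interval[of "A x", where m = m] Asmall[OF x] by blast
  qed
  then obtain y where y0: "\<And>x. x \<in> ball p R \<Longrightarrow> y x 0 = m"
    and y: "\<And>x t. x \<in> ball p R \<Longrightarrow> t \<in> {0..1} \<Longrightarrow>
      (y x has_vector_derivative A x t (y x t)) (at t within {0..1})"
    by metis
  have ybound: "norm (y x t) \<le> 2 * norm m" if "x \<in> ball p R" "t \<in> {0..1}" for x t
  proof -
    have "norm (y x t) \<le> 2 * (norm (y x 0) + 0)"
    proof (rule gronwall_unit_interval[OF y[OF that(1)] _ that(2)])
      fix t :: real assume t: "t \<in> {0..1}"
      have "norm (A x t (y x t)) \<le> norm (A x t) * norm (y x t)" by (rule norm_blinfun)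
      also have "\<dots> \<le> 1/2 * norm (y x t)" using Asmall[OF that(1) t] by (intro mult_right_mono) auto
      finally show "norm (A x t (y x t)) \<le> norm (y x t) / 2 + 0" by simp
    qed
    then show ?thesis using y0[OF that(1)] by simp
  qed
  define s where "s = (\<lambda>x. y x 1)"
  have pin: "p \<in> ball p R" using \<open>R > 0\<close> by simp
  have "s p = m"
  proof -
    have "norm (y p 1 - m) \<le> 2 * (norm (y p 0 - m) + 0)"
      by (rule gronwall_unit_interval[of "\<lambda>t. y p t - m" "\<lambda>t. 0"])
        (use y[OF pin] in \<open>auto intro!: derivative_eq_intros simp: A_def\<close>)
    then show ?thesis using y0[OF pin] by (simp add: s_def)
  qed
  moreover have "parallel_on \<omega> (ball p R) s"
    unfolding parallel_on_def has_derivative_at_alt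
  proof (intro ballI conjI allI impI)
    fix x assume x: "x \<in> ball p R"
    show "bounded_linear (\<lambda>v. \<omega> x v (s x))"
      by (intro bounded_linear_intros)
    fix e :: real assume "e > 0"
    define z where "z = x - p"
    define R' where "R' = (norm z + R) / 2"
    have z: "norm z < R" using x by (simp add: z_def dist_norm norm_minus_commute)
    have R': "norm z < R'" "R' < R" using z by (auto simp: R'_def)
    have sub: "cball p R' \<subseteq> ball p R" using R' by auto
    \<comment> \<open>On the compact ball around \<open>p\<close> of radius \<open>R' < R\<close>, which contains the rays to \<open>x + w\<close> for small \<open>w\<close>, \<open>C\<close> bounds \<open>\<omega>'\<close>, \<open>M\<close> bounds \<open>\<omega>\<close> and \<open>Y\<close> bounds the transported vectors; the defect of \<open>T\<close> is at most \<open>|w| (K |w| + L \<eta>)\<close>, where \<open>\<eta>\<close> bounds the oscillation of \<open>\<omega>'\<close> over distance \<open>|w|\<close>.\<close>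
    have "compact (\<omega>' ` cball p R')"
      by (intro compact_continuous_image continuous_on_subset[OF cont sub]) auto
    then obtain C where C0: "C > 0" and C: "\<And>u. u \<in> cball p R' \<Longrightarrow> norm (\<omega>' u) \<le> C"
      using compact_imp_bounded bounded_pos by (metis imageI)
    define M where "M = 1 / (2 * R)"
    have M0: "M > 0" using \<open>R > 0\<close> by (simp add: M_def)
    have M: "norm (\<omega> u) \<le> M" if "u \<in> ball p R" for u
      using small[OF that] \<open>R > 0\<close> by (simp add: M_def field_simps)
    define Y where "Y = 2 * norm m + 1"
    have Y0: "Y > 0" by (simp add: Y_def add_nonneg_pos)
    define K where "K = (C + M * M + C * R * M) * Y"
    have K0: "K > 0" using C0 M0 Y0 \<open>R > 0\<close> by (simp add: K_def add_pos_pos)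
    define L where "L = R * (1 + M * R) * Y"
    have L0: "L > 0" using M0 Y0 \<open>R > 0\<close> by (simp add: L_def add_pos_pos)
    define \<eta> where "\<eta> = e / (4 * L)"
    have \<eta>0: "\<eta> > 0" using L0 \<open>e > 0\<close> by (simp add: \<eta>_def)
    have "uniformly_continuous_on (cball p R') \<omega>'"
      by (intro compact_uniformly_continuous continuous_on_subset[OF cont sub]) auto
    then obtain d where d: "d > 0"
      "\<And>u u'. u \<in> cball p R' \<Longrightarrow> u' \<in> cball p R' \<Longrightarrow> dist u' u < d \<Longrightarrow> dist (\<omega>' u') (\<omega>' u) < \<eta>"
      unfolding uniformly_continuous_on_def using \<eta>0 by metis
    define D where "D = min (min d (R' - norm z)) (min R (e / (4 * K)))"
    have D0: "D > 0" using d R' \<open>R > 0\<close> K0 \<open>e > 0\<close> by (simp add: D_def)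
    have main: "norm (s (x + w) - s x - \<omega> x w (s x)) \<le> e * norm w" if w: "norm w < D" for w
    proof -
      have w': "norm w < d" "norm w < R' - norm z" "norm w < R" "norm w * (4 * K) < e"
        using w K0 by (auto simp: D_def pos_less_divide_eq)
      have zw: "norm (z + w) \<le> R'" using w'(2) norm_triangle_ineq[of z w] by linarith
      have xw: "x + w \<in> ball p R"
        using zw R' by (simp add: dist_norm z_def norm_minus_commute algebra_simps)
      have zwR: "norm (z + w) \<le> R" using zw R' by simp
      define a where "a = y x"
      define T where "T = (\<lambda>t. a t + t *\<^sub>R \<omega> (c x t) w (a t))"
      define T' where "T' = (\<lambda>t. \<omega> (c x t) z (a t) + (\<omega> (c x t) w (a t) +
        t *\<^sub>R (\<omega>' (c x t) z w (a t) + \<omega> (c x t) w (\<omega> (c x t) z (a t)))))"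
      have T: "(T has_vector_derivative T' t) (at t within {0..1})" if t: "t \<in> {0..1}" for t
      proof -
        have cd: "((c x) has_vector_derivative z) (at t within {0..1})"
          unfolding c_def z_def by (auto intro!: derivative_eq_intros)
        have "(\<omega> has_derivative blinfun_apply (\<omega>' (c x t))) (at (c x t) within c x ` {0..1})"
          using der[OF cball[OF x t]] by (rule has_derivative_at_withinI)
        from vector_derivative_diff_chain_within[OF cd this]
        have 1: "((\<lambda>t. \<omega> (c x t)) has_vector_derivative \<omega>' (c x t) z) (at t within {0..1})"
          by (simp add: o_def)
        have 2: "((\<lambda>t. \<omega> (c x t) w) has_vector_derivative \<omega>' (c x t) z w) (at t within {0..1})"
          using bounded_linear.has_vector_derivative[OF _ 1, of "\<lambda>f. blinfun_apply f w"]
          by (simp add: bounded_linear_intros)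
        have 3: "(a has_vector_derivative \<omega> (c x t) z (a t)) (at t within {0..1})"
          using y[OF x t] by (simp add: a_def A_def z_def)
        have 4: "((\<lambda>t. \<omega> (c x t) w (a t)) has_vector_derivative
            \<omega> (c x t) w (\<omega> (c x t) z (a t)) + \<omega>' (c x t) z w (a t)) (at t within {0..1})"
          using bounded_bilinear.has_vector_derivative[OF bounded_bilinear_blinfun_apply 2 3] by simp
        have 5: "((\<lambda>t. t *\<^sub>R \<omega> (c x t) w (a t)) has_vector_derivative
            t *\<^sub>R (\<omega> (c x t) w (\<omega> (c x t) z (a t)) + \<omega>' (c x t) z w (a t)) + 1 *\<^sub>R \<omega> (c x t) w (a t))
            (at t within {0..1})"
          by (intro bounded_bilinear.has_vector_derivative[OF bounded_bilinear_scaleR] 4 has_vector_derivative_id)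
        show ?thesis
          unfolding T_def T'_def
          by (rule has_vector_derivative_eq_rhs[OF has_vector_derivative_add[OF 3 5]])
            (simp add: algebra_simps)
      qed
      define b where "b = y (x + w)"
      have cw: "c (x + w) t = c x t + t *\<^sub>R w" for t by (simp add: c_def algebra_simps)
      have xwz: "x + w - p = z + w" by (simp add: z_def)
      have b: "(b has_vector_derivative \<omega> (c x t + t *\<^sub>R w) (z + w) (b t)) (at t within {0..1})"
        if "t \<in> {0..1}" for t
        using y[OF xw that] by (simp add: b_def A_def cw xwz)
      have "norm (T 1 - b 1) \<le> 2 * (norm (T 0 - b 0) + e / 2 * norm w)"
      proof (rule gronwall_unit_interval[OF has_vector_derivative_diff[OF T b]])
        fix t :: real assume t: "t \<in> {0..1}"
        define u where "u = c x t"
        \<comment> \<open>The Taylor remainder of \<open>\<omega>\<close>.\<close>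
        define r where "r = \<omega> (u + t *\<^sub>R w) - \<omega> u - \<omega>' u (t *\<^sub>R w)"
        have u: "u \<in> cball p R'"
        proof -
          have "norm (t *\<^sub>R z) \<le> norm z" using t by (auto intro: mult_left_le_one_le)
          then show ?thesis using R' by (simp add: u_def c_def dist_norm z_def)
        qed
        have uw: "u + \<tau> *\<^sub>R (t *\<^sub>R w) \<in> cball p R' \<inter> cball u (norm w)" if "\<tau> \<in> {0..1}" for \<tau>
        proof -
          have \<tau>t: "norm ((\<tau> * t) *\<^sub>R w) \<le> norm w" using that t
            by (auto intro!: mult_left_le_one_le mult_le_one)
          have "norm (t *\<^sub>R z) \<le> norm z" using t by (auto intro: mult_left_le_one_le)
          then have "norm (t *\<^sub>R z + (\<tau> * t) *\<^sub>R w) \<le> R'"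
            using \<tau>t w'(2) norm_triangle_ineq[of "t *\<^sub>R z" "(\<tau> * t) *\<^sub>R w"] by linarith
          moreover have "dist p (u + \<tau> *\<^sub>R (t *\<^sub>R w)) = norm (t *\<^sub>R z + (\<tau> * t) *\<^sub>R w)"
            by (subst dist_commute) (simp add: dist_norm u_def c_def z_def algebra_simps)
          ultimately show ?thesis using \<tau>t by (simp add: dist_norm)
        qed
        have r: "norm r \<le> norm w * \<eta>"
        proof -
          have "norm (\<omega> (u + t *\<^sub>R w) - \<omega> u - \<omega>' u ((u + t *\<^sub>R w) - u)) \<le> norm ((u + t *\<^sub>R w) - u) * \<eta>"
          proof (rule differentiable_bound_linearization[where S = "cball p R' \<inter> cball u (norm w)"])
            show "u + \<tau> *\<^sub>R (u + t *\<^sub>R w - u) \<in> cball p R' \<inter> cball u (norm w)"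
              if "\<tau> \<in> {0..1}" for \<tau> using uw[OF that] by simp
            show "(\<omega> has_derivative blinfun_apply (\<omega>' q)) (at q within cball p R' \<inter> cball u (norm w))"
              if "q \<in> cball p R' \<inter> cball u (norm w)" for q
            proof -
              have "q \<in> ball p R" using that sub by blast
              then show ?thesis by (rule has_derivative_at_withinI[OF der])
            qed
            show "u \<in> cball p R' \<inter> cball u (norm w)" using u by simp
            show "onorm (blinfun_apply (\<omega>' q) - blinfun_apply (\<omega>' u)) \<le> \<eta>"
              if "q \<in> cball p R' \<inter> cball u (norm w)" for q
            proof -
              have "dist (\<omega>' q) (\<omega>' u) < \<eta>"
                using that u w'(1) by (intro d(2)) (auto simp: dist_commute)
              moreover have "onorm (\<lambda>x. \<omega>' q x - \<omega>' u x) = norm (\<omega>' q - \<omega>' u)"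
                by (simp add: norm_blinfun.rep_eq minus_blinfun.rep_eq)
              ultimately show ?thesis
                by (simp add: dist_norm fun_diff_def)
            qed
          qed
          also have "\<dots> \<le> norm w * \<eta>"
            using t \<eta>0 by (auto intro!: mult_right_mono mult_left_le_one_le)
          finally show ?thesis by (simp add: r_def)
        qed
        have Mu: "norm (\<omega> u) \<le> M" and Cu: "norm (\<omega>' u) \<le> C"
          using M[of u] C[of u] u sub by blast+
        have at: "norm (a t) \<le> Y"
          using ybound[OF x t] by (simp add: a_def Y_def)
        \<comment> \<open>The defect of \<open>T\<close>: what is left after the first-order terms have cancelled by flatness.\<close>
        define q where "q = t *\<^sub>R (\<omega>' u w w (a t)) + r (z + w) (T t)
            + t *\<^sub>R \<omega> u w (\<omega> u w (a t)) + (t * t) *\<^sub>R \<omega>' u w (z + w) (\<omega> u w (a t))"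
        have eq: "T' t - \<omega> (u + t *\<^sub>R w) (z + w) (b t) = \<omega> (u + t *\<^sub>R w) (z + w) (T t - b t) - q"
        proof -
          have fl: "\<omega>' u z w (a t) + \<omega> u w (\<omega> u z (a t)) = \<omega>' u w z (a t) + \<omega> u z (\<omega> u w (a t))"
          proof -
            have "blinfun_apply (\<omega>' u z w + (\<omega> u w o\<^sub>L \<omega> u z)) (a t) = blinfun_apply (\<omega>' u w z + (\<omega> u z o\<^sub>L \<omega> u w)) (a t)"
              using flat[of u z w] u sub by (metis subsetD)
            then show ?thesis by (simp add: blinfun.add_left)
          qed
          have om: "\<omega> (u + t *\<^sub>R w) = \<omega> u + t *\<^sub>R \<omega>' u w + r"
            by (simp add: r_def blinfun.scaleR_right)
          have "\<omega> (u + t *\<^sub>R w) (z + w) (T t) = \<omega> u z (a t) + \<omega> u w (a t)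
              + t *\<^sub>R (\<omega>' u w z (a t) + \<omega> u z (\<omega> u w (a t))) + q"
            unfolding om q_def
            by (simp add: T_def u_def[symmetric] blinfun.add_left blinfun.add_right blinfun.scaleR_left
                blinfun.scaleR_right scaleR_add_right)
          then have "T' t = \<omega> (u + t *\<^sub>R w) (z + w) (T t) - q"
            unfolding T'_def u_def[symmetric] fl by (simp add: algebra_simps)
          then show ?thesis by (simp add: blinfun.diff_right)
        qed
        have n1: "norm (\<omega> (u + t *\<^sub>R w) (z + w) (T t - b t)) \<le> norm (T t - b t) / 2"
        proof -
          have "norm (\<omega> (u + t *\<^sub>R w) (z + w)) \<le> 1/2"
            using Asmall[OF xw t] by (simp add: A_def cw xwz u_def)
          then have "norm (\<omega> (u + t *\<^sub>R w) (z + w) (T t - b t)) \<le> 1/2 * norm (T t - b t)"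
            by (rule order_trans[OF norm_blinfun mult_right_mono[OF _ norm_ge_zero]])
          then show ?thesis by simp
        qed
        have n2: "norm q \<le> e / 2 * norm w"
        proof -
          have b2: "norm (f v k) \<le> F * V * N"
            if "norm f \<le> F" "norm v \<le> V" "norm k \<le> N" for f :: "'e \<Rightarrow>\<^sub>L ('a \<Rightarrow>\<^sub>L 'a)" and v k F V N
          proof -
            have F: "0 \<le> F" using that(1) norm_ge_zero[of f] by linarith
            have V: "0 \<le> V" using that(2) norm_ge_zero[of v] by linarith
            have "norm (f v k) \<le> norm (f v) * norm k" by (rule norm_blinfun)
            also have "\<dots> \<le> (norm f * norm v) * norm k" by (intro mult_right_mono norm_blinfun) auto
            also have "\<dots> \<le> F * V * N" using that F V by (intro mult_mono) auto
            finally show ?thesis .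
          qed
          have ww: "norm (\<omega>' u w) \<le> C * norm w"
            using order_trans[OF norm_blinfun mult_right_mono[OF Cu norm_ge_zero]] .
          have wa: "norm (\<omega> u w (a t)) \<le> M * norm w * Y" by (intro b2 Mu at order_refl)
          have tt: "\<bar>t\<bar> \<le> 1" "\<bar>t * t\<bar> \<le> 1" using t by (auto intro: mult_le_one)
          have sc: "norm (\<tau> *\<^sub>R k) \<le> norm k" if "\<bar>\<tau>\<bar> \<le> 1" for \<tau> and k :: 'a
            using that by (auto intro: mult_left_le_one_le)
          have "norm (T t) \<le> Y + M * R * Y"
          proof -
            have "norm (T t) \<le> norm (a t) + norm (t *\<^sub>R \<omega> u w (a t))"
              unfolding T_def u_def by (rule norm_triangle_ineq)
            also have "norm (t *\<^sub>R \<omega> u w (a t)) \<le> norm (\<omega> u w (a t))" using sc tt by blast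
            also have "\<dots> \<le> M * norm w * Y" by (rule wa)
            also have "\<dots> \<le> M * R * Y"
              using w'(3) M0 Y0 by (intro mult_right_mono mult_left_mono) auto
            finally show ?thesis using at by simp
          qed
          then have q2: "norm (r (z + w) (T t)) \<le> (norm w * \<eta>) * R * (Y + M * R * Y)"
            by (intro b2 r zwR)
          have q1: "norm (t *\<^sub>R (\<omega>' u w w (a t))) \<le> (C * norm w) * norm w * Y"
            by (rule order_trans[OF sc[OF tt(1)]]) (intro b2 ww at order_refl)
          have q3: "norm (t *\<^sub>R \<omega> u w (\<omega> u w (a t))) \<le> M * norm w * (M * norm w * Y)"
            by (rule order_trans[OF sc[OF tt(1)]]) (intro b2 Mu wa order_refl)
          have q4: "norm ((t * t) *\<^sub>R \<omega>' u w (z + w) (\<omega> u w (a t))) \<le> (C * norm w) * R * (M * norm w * Y)"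
            by (rule order_trans[OF sc[OF tt(2)]]) (intro b2 ww wa zwR)
          have "norm q \<le> (C * norm w) * norm w * Y + (norm w * \<eta>) * R * (Y + M * R * Y)
              + M * norm w * (M * norm w * Y) + (C * norm w) * R * (M * norm w * Y)"
            unfolding q_def by (intro norm_triangle_mono q1 q2 q3 q4)
          also have "\<dots> = norm w * (norm w * K + \<eta> * L)"
            by (simp add: K_def L_def algebra_simps)
          also have "\<dots> \<le> norm w * (e / 4 + e / 4)"
          proof -
            have "norm w * K \<le> e / 4" using w'(4) by simp
            moreover have "\<eta> * L = e / 4" using L0 by (simp add: \<eta>_def)
            ultimately show ?thesis by (intro mult_left_mono add_mono) auto
          qed
          finally show ?thesis by (simp add: mult.commute)
        qed
        show "norm (T' t - \<omega> (c x t + t *\<^sub>R w) (z + w) (b t)) \<le> norm (T t - b t) / 2 + e / 2 * norm w"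
          unfolding u_def[symmetric] eq by (rule order_trans[OF norm_triangle_ineq4 add_mono[OF n1 n2]])
      qed auto
      moreover have "T 0 - b 0 = 0"
        using y0[OF x] y0[OF xw] by (simp add: T_def a_def b_def)
      moreover have "T 1 - b 1 = - (s (x + w) - s x - \<omega> x w (s x))"
        by (simp add: T_def a_def b_def s_def c_def)
      ultimately show ?thesis by (simp add: norm_minus_commute)
    qed
    show "\<exists>d>0. \<forall>x'. norm (x' - x) < d \<longrightarrow>
        norm (s x' - s x - \<omega> x (x' - x) (s x)) \<le> e * norm (x' - x)"
      using D0 main by (intro exI[of _ D]) (metis add.commute diff_add_cancel)
  qed
  ultimately show thesis using that by blast
qed

section \<open>Global sections of locally constant sheaves\<close>

text \<open>If one half of a cut is degenerate, the cut runs along a face of the box and can be disregarded.\<close>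

lemma interior_halfspace_cbox:
  fixes a b :: "'d::euclidean_space"
  assumes "box a b \<noteq> {}"
  shows "interior (cbox a b \<inter> {x. x \<bullet> i \<le> c}) = {} \<Longrightarrow> cbox a b \<inter> {x. x \<bullet> i \<ge> c} = cbox a b"
    and "interior (cbox a b \<inter> {x. x \<bullet> i \<ge> c}) = {} \<Longrightarrow> cbox a b \<inter> {x. x \<bullet> i \<le> c} = cbox a b"
proof -
  have cl: "cbox a b = closure (box a b)" using assms by (simp add: closure_box)
  {
    assume e: "interior (cbox a b \<inter> {x. x \<bullet> i \<le> c}) = {}"
    have "open (box a b \<inter> {x. x \<bullet> i < c})"
      by (intro open_Int open_box open_halfspace_component_lt)
    then have "box a b \<inter> {x. x \<bullet> i < c} = {}"
      using e interior_maximal[of "box a b \<inter> {x. x \<bullet> i < c}" "cbox a b \<inter> {x. x \<bullet> i \<le> c}"]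
        box_subset_cbox[of a b] by fastforce
    then have "box a b \<subseteq> {x. x \<bullet> i \<ge> c}" by force
    then have "cbox a b \<subseteq> {x. x \<bullet> i \<ge> c}"
      unfolding cl by (intro closure_minimal closed_halfspace_component_ge)
    then show "cbox a b \<inter> {x. x \<bullet> i \<ge> c} = cbox a b" by blast
  }
  {
    assume e: "interior (cbox a b \<inter> {x. x \<bullet> i \<ge> c}) = {}"
    have "open (box a b \<inter> {x. x \<bullet> i > c})"
      by (intro open_Int open_box open_halfspace_component_gt)
    then have "box a b \<inter> {x. x \<bullet> i > c} = {}"
      using e interior_maximal[of "box a b \<inter> {x. x \<bullet> i > c}" "cbox a b \<inter> {x. x \<bullet> i \<ge> c}"]
        box_subset_cbox[of a b] by fastforce
    then have "box a b \<subseteq> {x. x \<bullet> i \<le> c}" by force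
    then have "cbox a b \<subseteq> {x. x \<bullet> i \<le> c}"
      unfolding cl by (intro closure_minimal closed_halfspace_component_le)
    then show "cbox a b \<inter> {x. x \<bullet> i \<le> c} = cbox a b" by blast
  }
qed

text \<open>A sheaf of functions with values in \<open>'b\<close> that is determined on each ball by its value at one point, and in which
every value at every point of a sufficiently small ball is attained. Only its sections over balls matter.\<close>

locale locally_constant_sheaf =
  fixes \<Omega> :: "'e::euclidean_space set" and sec :: "'e set \<Rightarrow> ('e \<Rightarrow> 'b) \<Rightarrow> bool"
  assumes open_base: "open \<Omega>"
    and restrict: "\<lbrakk>sec U s; V \<subseteq> U\<rbrakk> \<Longrightarrow> sec V s"
    and unique: "\<lbrakk>sec (ball p r) s; sec (ball p r) s'; ball p r \<subseteq> \<Omega>; x \<in> ball p r; s x = s' x; y \<in> ball p r\<rbrakk>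
      \<Longrightarrow> s y = s' y"
    and local_sections: "p \<in> \<Omega> \<Longrightarrow> \<exists>r>0. ball p r \<subseteq> \<Omega> \<and> (\<forall>x\<in>ball p r. \<forall>m. \<exists>s. sec (ball p r) s \<and> s x = m)"
begin

text \<open>A map \<open>g\<close> lifts \<open>k\<close> if near each point it is the composition of \<open>k\<close> with a section. This is continuation of sections along
\<open>k\<close>, where \<open>k\<close> may be a path or a homotopy of paths.\<close>

definition lift_at :: "('d::euclidean_space \<Rightarrow> 'e) \<Rightarrow> 'd set \<Rightarrow> ('d \<Rightarrow> 'b) \<Rightarrow> 'd \<Rightarrow> bool" where
  "lift_at k Q g q \<longleftrightarrow> (\<exists>r s N. r > 0 \<and> ball (k q) r \<subseteq> \<Omega> \<and> sec (ball (k q) r) s \<and> open N \<and> q \<in> N \<and>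
     (\<forall>q'\<in>Q \<inter> N. k q' \<in> ball (k q) r \<and> g q' = s (k q')))"

definition lift :: "('d::euclidean_space \<Rightarrow> 'e) \<Rightarrow> 'd set \<Rightarrow> ('d \<Rightarrow> 'b) \<Rightarrow> bool" where
  "lift k Q g \<longleftrightarrow> (\<forall>q\<in>Q. lift_at k Q g q)"

lemma lift_atI:
  assumes "r > 0" "ball c r \<subseteq> \<Omega>" "sec (ball c r) s" "open N" "q \<in> N"
    "\<And>q'. q' \<in> Q \<Longrightarrow> q' \<in> N \<Longrightarrow> k q' \<in> ball c r" "\<And>q'. q' \<in> Q \<Longrightarrow> q' \<in> N \<Longrightarrow> g q' = s (k q')"
    "k q = c"
  shows "lift_at k Q g q"
  unfolding lift_at_def using assms by (intro exI[of _ r] exI[of _ s] exI[of _ N] conjI ballI) blast+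

lemma liftE:
  assumes "lift k Q g" "q \<in> Q"
  obtains r s N where "r > 0" "ball (k q) r \<subseteq> \<Omega>" "sec (ball (k q) r) s" "open N" "q \<in> N"
    "\<And>q'. q' \<in> Q \<Longrightarrow> q' \<in> N \<Longrightarrow> k q' \<in> ball (k q) r" "\<And>q'. q' \<in> Q \<Longrightarrow> q' \<in> N \<Longrightarrow> g q' = s (k q')"
  using assms unfolding lift_def lift_at_def by (metis IntI)

lemma lift_subset:
  assumes g: "lift k Q g" and "Q' \<subseteq> Q"
  shows "lift k Q' g"
  unfolding lift_def
proof
  fix q assume "q \<in> Q'"
  then have "q \<in> Q" using assms by blast
  from liftE[OF g this] obtain r s N where
    *: "r > 0" "ball (k q) r \<subseteq> \<Omega>" "sec (ball (k q) r) s" "open N" "q \<in> N"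
    and **: "\<And>q'. q' \<in> Q \<Longrightarrow> q' \<in> N \<Longrightarrow> k q' \<in> ball (k q) r" "\<And>q'. q' \<in> Q \<Longrightarrow> q' \<in> N \<Longrightarrow> g q' = s (k q')"
    by blast
  show "lift_at k Q' g q"
    by (rule lift_atI[OF *]) (use ** \<open>Q' \<subseteq> Q\<close> in blast)+
qed

lemma lift_compose:
  assumes g: "lift k Q g" and f: "continuous_on Q' f" "f ` Q' \<subseteq> Q"
  shows "lift (\<lambda>t. k (f t)) Q' (\<lambda>t. g (f t))"
  unfolding lift_def
proof
  fix q assume q: "q \<in> Q'"
  then have "f q \<in> Q" using f by auto
  from liftE[OF g this]
  obtain r s N where *: "r > 0" "ball (k (f q)) r \<subseteq> \<Omega>" "sec (ball (k (f q)) r) s"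
    and N: "open N" "f q \<in> N"
    and **: "\<And>q'. q' \<in> Q \<Longrightarrow> q' \<in> N \<Longrightarrow> k q' \<in> ball (k (f q)) r" "\<And>q'. q' \<in> Q \<Longrightarrow> q' \<in> N \<Longrightarrow> g q' = s (k q')"
    by blast
  obtain M where M: "open M" "M \<inter> Q' = f -` N \<inter> Q'"
    using f(1)[unfolded continuous_on_open_invariant, rule_format, OF N(1)] by blast
  have qM: "q \<in> M" using M N q by blast
  have MN: "f q' \<in> N" "f q' \<in> Q" if "q' \<in> Q'" "q' \<in> M" for q'
    using that M f(2) by auto
  show "lift_at (\<lambda>t. k (f t)) Q' (\<lambda>t. g (f t)) q"
    by (rule lift_atI[OF * M(1) qM]) (use ** MN in blast)+
qed

lemma lift_cong:
  assumes g: "lift k Q g" and k: "\<And>q. q \<in> Q \<Longrightarrow> k q = k' q"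
  shows "lift k' Q g"
  using g unfolding lift_def lift_at_def by (smt (verit) IntD1 k)

text \<open>Whether two lifts agree is locally constant, because two sections over a ball agree everywhere or nowhere.\<close>

lemma lift_unique:
  assumes Q: "connected Q" and g: "lift k Q g" and g': "lift k Q g'"
    and q0: "q0 \<in> Q" "g q0 = g' q0" and q: "q \<in> Q"
  shows "g q = g' q"
proof -
  have loc: "\<exists>N. open N \<and> q \<in> N \<and> (\<forall>q'\<in>Q \<inter> N. (g q' = g' q') = (g q = g' q))" if q: "q \<in> Q" for q
  proof -
    obtain r s N where 1: "r > 0" "ball (k q) r \<subseteq> \<Omega>" "sec (ball (k q) r) s" "open N" "q \<in> N"
      "\<And>q'. q' \<in> Q \<Longrightarrow> q' \<in> N \<Longrightarrow> k q' \<in> ball (k q) r" "\<And>q'. q' \<in> Q \<Longrightarrow> q' \<in> N \<Longrightarrow> g q' = s (k q')"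
      using liftE[OF g q] by metis
    obtain r' s' N' where 2: "r' > 0" "ball (k q) r' \<subseteq> \<Omega>" "sec (ball (k q) r') s'" "open N'" "q \<in> N'"
      "\<And>q'. q' \<in> Q \<Longrightarrow> q' \<in> N' \<Longrightarrow> k q' \<in> ball (k q) r'" "\<And>q'. q' \<in> Q \<Longrightarrow> q' \<in> N' \<Longrightarrow> g' q' = s' (k q')"
      using liftE[OF g' q] by metis
    let ?B = "ball (k q) (min r r')"
    have B: "sec ?B s" "sec ?B s'" "?B \<subseteq> \<Omega>"
      by (rule restrict[OF 1(3)] restrict[OF 2(3)]; simp add: subset_ball)+ (use 1(2) in auto)
    have "(g q' = g' q') = (g q = g' q)" if q': "q' \<in> Q \<inter> (N \<inter> N')" for q'
    proof -
      have "k q' \<in> ?B" "k q \<in> ?B" using q' 1(1,6) 2(1,6) by auto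
      then have "s (k q') = s' (k q') \<longleftrightarrow> s (k q) = s' (k q)"
        using unique[OF B] by blast
      then show ?thesis using 1(5,7) 2(5,7) q q' by auto
    qed
    then show ?thesis using 1 2 by (intro exI[of _ "N \<inter> N'"]) auto
  qed
  have op: "openin (top_of_set Q) {q \<in> Q. (g q = g' q) = b}" for b
    unfolding openin_subopen[of _ "{q \<in> Q. (g q = g' q) = b}"]
  proof
    fix q assume q: "q \<in> {q \<in> Q. (g q = g' q) = b}"
    then obtain N where N: "open N" "q \<in> N" "\<forall>q'\<in>Q \<inter> N. (g q' = g' q') = (g q = g' q)"
      using loc by blast
    have "openin (top_of_set Q) (Q \<inter> N)" using N by (simp add: openin_open_Int)
    moreover have "q \<in> Q \<inter> N" "Q \<inter> N \<subseteq> {q \<in> Q. (g q = g' q) = b}" using N q by auto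
    ultimately show "\<exists>T. openin (top_of_set Q) T \<and> q \<in> T \<and> T \<subseteq> {q \<in> Q. (g q = g' q) = b}"
      by blast
  qed
  from op[of True] op[of False]
  have 1: "openin (top_of_set Q) {q \<in> Q. g q = g' q}" and 2: "openin (top_of_set Q) {q \<in> Q. g q \<noteq> g' q}"
    by auto
  have "Q - {q \<in> Q. g q = g' q} = {q \<in> Q. g q \<noteq> g' q}" by auto
  then have "closedin (top_of_set Q) {q \<in> Q. g q = g' q}"
    using 2 by (auto simp: closedin_def)
  then have "{q \<in> Q. g q = g' q} = Q"
    using 1 Q q0 unfolding connected_clopen by blast
  then show ?thesis using q by blast
qed

text \<open>The initial value may be prescribed at any point; this is what makes the property local and stable under gluing.\<close>

definition liftable :: "('d::euclidean_space \<Rightarrow> 'e) \<Rightarrow> 'd set \<Rightarrow> bool" where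
  "liftable k Q \<longleftrightarrow> (\<forall>q\<in>Q. \<forall>m. \<exists>g. lift k Q g \<and> g q = m)"

lemma liftable_subset:
  assumes "liftable k Q" "Q' \<subseteq> Q" shows "liftable k Q'"
  using assms lift_subset unfolding liftable_def by (meson subsetD)

text \<open>At a common point the two local sections agree on the smaller of their balls, so the one with the larger ball serves both
pieces.\<close>

lemma lift_glue:
  assumes cl: "closed Q1" "closed Q2" and g1: "lift k Q1 g1" and g2: "lift k Q2 g2"
    and eq: "\<And>q. q \<in> Q1 \<inter> Q2 \<Longrightarrow> g1 q = g2 q"
  shows "lift k (Q1 \<union> Q2) (\<lambda>q. if q \<in> Q1 then g1 q else g2 q)" (is "lift _ _ ?g")
  unfolding lift_def
proof
  fix q assume q: "q \<in> Q1 \<union> Q2"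
  have g': "?g q' = g1 q'" if "q' \<in> Q1" for q' using that by simp
  have g'': "?g q' = g2 q'" if "q' \<in> Q2" for q' using that eq by auto
  consider "q \<in> Q1 - Q2" | "q \<in> Q2 - Q1" | "q \<in> Q1" "q \<in> Q2" using q by blast
  then show "lift_at k (Q1 \<union> Q2) ?g q"
  proof cases
    case 1
    then have "q \<in> Q1" by simp
    from liftE[OF g1 this] obtain r s N where *: "r > 0" "ball (k q) r \<subseteq> \<Omega>" "sec (ball (k q) r) s"
      and N: "open N" "q \<in> N"
      and **: "\<And>q'. q' \<in> Q1 \<Longrightarrow> q' \<in> N \<Longrightarrow> k q' \<in> ball (k q) r" "\<And>q'. q' \<in> Q1 \<Longrightarrow> q' \<in> N \<Longrightarrow> g1 q' = s (k q')"
      by blast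
    show ?thesis
    proof (rule lift_atI[OF *])
      show "open (N - Q2)" using N cl by blast
      show "q \<in> N - Q2" using N 1 by blast
      fix q' assume "q' \<in> Q1 \<union> Q2" "q' \<in> N - Q2"
      then have q': "q' \<in> Q1" "q' \<in> N" by auto
      show "k q' \<in> ball (k q) r" using **(1)[OF q'] .
      show "?g q' = s (k q')" using **(2)[OF q'] g'[OF q'(1)] by simp
    qed (rule refl)
  next
    case 2
    then have "q \<in> Q2" by simp
    from liftE[OF g2 this] obtain r s N where *: "r > 0" "ball (k q) r \<subseteq> \<Omega>" "sec (ball (k q) r) s"
      and N: "open N" "q \<in> N"
      and **: "\<And>q'. q' \<in> Q2 \<Longrightarrow> q' \<in> N \<Longrightarrow> k q' \<in> ball (k q) r" "\<And>q'. q' \<in> Q2 \<Longrightarrow> q' \<in> N \<Longrightarrow> g2 q' = s (k q')"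
      by blast
    show ?thesis
    proof (rule lift_atI[OF *])
      show "open (N - Q1)" using N cl by blast
      show "q \<in> N - Q1" using N 2 by blast
      fix q' assume "q' \<in> Q1 \<union> Q2" "q' \<in> N - Q1"
      then have q': "q' \<in> Q2" "q' \<in> N" by auto
      show "k q' \<in> ball (k q) r" using **(1)[OF q'] .
      show "?g q' = s (k q')" using **(2)[OF q'] g''[OF q'(1)] by simp
    qed (rule refl)
  next
    case 3
    from liftE[OF g1 3(1)] obtain r s N where 1: "r > 0" "ball (k q) r \<subseteq> \<Omega>" "sec (ball (k q) r) s"
      and N: "open N" "q \<in> N"
      and k1: "\<And>q'. q' \<in> Q1 \<Longrightarrow> q' \<in> N \<Longrightarrow> k q' \<in> ball (k q) r"
      and s1: "\<And>q'. q' \<in> Q1 \<Longrightarrow> q' \<in> N \<Longrightarrow> g1 q' = s (k q')"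
      by blast
    from liftE[OF g2 3(2)] obtain r' s' N' where 2: "r' > 0" "ball (k q) r' \<subseteq> \<Omega>" "sec (ball (k q) r') s'"
      and N': "open N'" "q \<in> N'"
      and k2: "\<And>q'. q' \<in> Q2 \<Longrightarrow> q' \<in> N' \<Longrightarrow> k q' \<in> ball (k q) r'"
      and s2: "\<And>q'. q' \<in> Q2 \<Longrightarrow> q' \<in> N' \<Longrightarrow> g2 q' = s' (k q')"
      by blast
    have sq: "s (k q) = s' (k q)" using s1[OF 3(1) N(2)] s2[OF 3(2) N'(2)] eq 3 by simp
    have ss: "s y = s' y" if "y \<in> ball (k q) r" "y \<in> ball (k q) r'" for y
    proof (rule unique[OF restrict[OF 1(3)] restrict[OF 2(3)] _ _ sq])
      show "ball (k q) (min r r') \<subseteq> ball (k q) r" "ball (k q) (min r r') \<subseteq> ball (k q) r'"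
        "ball (k q) (min r r') \<subseteq> \<Omega>"
        using 1(2) by auto
      show "k q \<in> ball (k q) (min r r')" "y \<in> ball (k q) (min r r')" using 1 2 that by auto
    qed
    have oNN: "open (N \<inter> N')" and qNN: "q \<in> N \<inter> N'" using N N' by auto
    show ?thesis
    proof (cases "r \<le> r'")
      case True
      have "k q' \<in> ball (k q) r' \<and> ?g q' = s' (k q')" if "q' \<in> Q1 \<union> Q2" "q' \<in> N \<inter> N'" for q'
      proof (cases "q' \<in> Q1")
        case q': True
        have "k q' \<in> ball (k q) r" using k1 q' that by blast
        moreover from this have "k q' \<in> ball (k q) r'" using True by auto
        ultimately show ?thesis using ss s1[OF q'] g'[OF q'] that by auto
      next
        case False
        then have q': "q' \<in> Q2" using that by auto
        show ?thesis using k2[OF q'] s2[OF q'] g''[OF q'] that by auto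
      qed
      then show ?thesis by (intro lift_atI[OF 2 oNN qNN]) blast+
    next
      case False
      have "k q' \<in> ball (k q) r \<and> ?g q' = s (k q')" if "q' \<in> Q1 \<union> Q2" "q' \<in> N \<inter> N'" for q'
      proof (cases "q' \<in> Q2")
        case q': True
        have "k q' \<in> ball (k q) r'" using k2 q' that by blast
        moreover from this have "k q' \<in> ball (k q) r" using False by auto
        ultimately show ?thesis using ss s2[OF q'] g''[OF q'] that by auto
      next
        case False
        then have q': "q' \<in> Q1" using that by auto
        show ?thesis using k1[OF q'] s1[OF q'] g'[OF q'] that by auto
      qed
      then show ?thesis by (intro lift_atI[OF 1 oNN qNN]) blast+
    qed
  qed
qed

lemma lift_section:
  assumes s: "sec (ball p r) s" "ball p r \<subseteq> \<Omega>" and k: "continuous_on Q k" "k ` Q \<subseteq> ball p r"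
  shows "lift k Q (\<lambda>t. s (k t))"
  unfolding lift_def
proof
  fix q assume q: "q \<in> Q"
  then have "k q \<in> ball p r" using k by auto
  then obtain e where e: "e > 0" "ball (k q) e \<subseteq> ball p r"
    using open_ball openE by blast
  obtain N where N: "open N" "N \<inter> Q = k -` ball (k q) e \<inter> Q"
    using k(1)[unfolded continuous_on_open_invariant, rule_format, OF open_ball[of "k q" e]] by auto
  have "q \<in> N" using N q e by auto
  moreover have "ball (k q) e \<subseteq> \<Omega>" using e s by blast
  ultimately show "lift_at k Q (\<lambda>t. s (k t)) q"
    using N e by (intro lift_atI[OF e(1) _ restrict[OF s(1) e(2)] N(1)]) auto
qed

text \<open>Connectedness of the common part ensures that two lifts which agree at one of its points agree on all of it.\<close>

lemma liftable_glue:
  assumes "closed Q1" "closed Q2" "connected (Q1 \<inter> Q2)" "Q1 \<inter> Q2 \<noteq> {}"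
    and 1: "liftable k Q1" and 2: "liftable k Q2"
  shows "liftable k (Q1 \<union> Q2)"
proof -
  have half: "\<exists>g. lift k (P \<union> P') g \<and> g q = m"
    if P: "closed P" "closed P'" "connected (P \<inter> P')" "P \<inter> P' \<noteq> {}" "liftable k P" "liftable k P'" "q \<in> P"
    for P P' q m
  proof -
    obtain g where g: "lift k P g" "g q = m" using P unfolding liftable_def by blast
    obtain x where x: "x \<in> P" "x \<in> P'" using P by blast
    obtain g' where g': "lift k P' g'" "g' x = g x" using P x unfolding liftable_def by blast
    have "g y = g' y" if "y \<in> P \<inter> P'" for y
      by (rule lift_unique[OF P(3) lift_subset[OF g(1)] lift_subset[OF g'(1)], of x])
        (use x g' that in auto)
    from lift_glue[OF P(1,2) g(1) g'(1) this] show ?thesis using g(2) P(7) by force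
  qed
  show ?thesis
    unfolding liftable_def
  proof (intro ballI allI)
    fix q m assume "q \<in> Q1 \<union> Q2"
    then consider "q \<in> Q1" | "q \<in> Q2" by blast
    then show "\<exists>g. lift k (Q1 \<union> Q2) g \<and> g q = m"
    proof cases
      case 1
      then show ?thesis using half[OF assms] by blast
    next
      case 2
      then show ?thesis using half[of Q2 Q1 q m] assms by (auto simp: Int_commute Un_commute)
    qed
  qed
qed

text \<open>Liftability of a box is equivalent to liftability of both halves of any cut, hence of all members of any division.
Boxes without interior have to count as liftable to make this an additive property of boxes.\<close>

lemma operative_liftable:
  "operative conj True (\<lambda>Q. interior Q = {} \<or> liftable k (Q::'d::euclidean_space set))"
proof -
  interpret comm_monoid conj True by standard auto
  let ?P = "\<lambda>Q. interior Q = {} \<or> liftable k (Q::'d set)"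
  show ?thesis
  proof
    show "?P (cbox a b) = True" if "box a b = {}" for a b
      using that by simp
    fix a b i :: 'd and c :: real
    assume "i \<in> Basis"
    let ?C = "cbox a b" and ?C1 = "cbox a b \<inter> {x. x \<bullet> i \<le> c}" and ?C2 = "cbox a b \<inter> {x. x \<bullet> i \<ge> c}"
    show "?P ?C = (?P ?C1 \<and> ?P ?C2)"
    proof
      assume "?P ?C"
      then show "?P ?C1 \<and> ?P ?C2"
        using interior_mono[of ?C1 ?C] interior_mono[of ?C2 ?C] liftable_subset[of k ?C] by auto
    next
      assume P: "?P ?C1 \<and> ?P ?C2"
      show "?P ?C"
      proof (cases "box a b = {}")
        case False
        have un: "?C1 \<union> ?C2 = ?C" by auto
        have conv: "convex (?C1 \<inter> ?C2)"
          using convex_halfspace_le[of i c] convex_halfspace_ge[of c i]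
          by (auto intro!: convex_Int simp: inner_commute)
        have cl: "closed ?C1" "closed ?C2"
          by (intro closed_Int closed_cbox closed_halfspace_component_le closed_halfspace_component_ge)+
        show ?thesis
        proof (cases "interior ?C1 = {} \<or> interior ?C2 = {} \<or> ?C1 \<inter> ?C2 = {}")
          case True
          then have "?C1 = ?C \<or> ?C2 = ?C"
          proof (elim disjE)
            assume "?C1 \<inter> ?C2 = {}"
            then have "?C1 = {} \<or> ?C2 = {}"
              using connected_closedD[OF convex_connected[OF convex_box(1)[of a b]], of ?C1 ?C2] cl un by blast
            then show ?thesis using un by auto
          qed (use interior_halfspace_cbox[OF False, where i = i and c = c] in auto)
          then show ?thesis using P by metis
        next
          case False
          then show ?thesis
            using liftable_glue[OF cl convex_connected[OF conv]] P un by auto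
        qed
      qed simp
    qed
  qed
qed

text \<open>Liftability holds on small pieces, and by Cousin's lemma the box has a division into pieces that are small with
respect to any gauge.\<close>

lemma liftable_cbox:
  fixes k :: "'d::euclidean_space \<Rightarrow> 'e"
  assumes k: "continuous_on (cbox a b) k" "k ` cbox a b \<subseteq> \<Omega>" and ne: "box a b \<noteq> {}"
  shows "liftable k (cbox a b)"
proof -
  have "\<exists>d>0. liftable k (cbox a b \<inter> ball q d)" if q: "q \<in> cbox a b" for q
  proof -
    obtain r where r: "r > 0" "ball (k q) r \<subseteq> \<Omega>"
      "\<forall>x\<in>ball (k q) r. \<forall>m. \<exists>s. sec (ball (k q) r) s \<and> s x = m"
      using local_sections[of "k q"] k(2) q by blast
    obtain d where d: "d > 0" "\<And>q'. q' \<in> cbox a b \<Longrightarrow> dist q' q < d \<Longrightarrow> dist (k q') (k q) < r"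
      using k(1) q r(1) unfolding continuous_on_iff by metis
    have im: "k ` (cbox a b \<inter> ball q d) \<subseteq> ball (k q) r"
      using d by (auto simp: dist_commute)
    have "\<exists>g. lift k (cbox a b \<inter> ball q d) g \<and> g x = m" if x: "x \<in> cbox a b \<inter> ball q d" for x m
    proof -
      obtain s where s: "sec (ball (k q) r) s" "s (k x) = m" using r(3) im x by blast
      have "lift k (cbox a b \<inter> ball q d) (\<lambda>t. s (k t))"
        by (rule lift_section[OF s(1) r(2) continuous_on_subset[OF k(1)] im]) auto
      then show ?thesis using s(2) by auto
    qed
    then show ?thesis using d(1) unfolding liftable_def by blast
  qed
  then obtain d where d: "\<And>q. q \<in> cbox a b \<Longrightarrow> d q > 0 \<and> liftable k (cbox a b \<inter> ball q (d q))"
    by metis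
  define \<gamma> where "\<gamma> = (\<lambda>q. ball q (if q \<in> cbox a b then d q else 1))"
  have "gauge \<gamma>" unfolding \<gamma>_def by (rule gauge_ball_dependent) (use d in auto)
  then obtain p where p: "p tagged_division_of (cbox a b)" "\<gamma> fine p"
    using fine_division_exists by blast
  interpret operative conj True "\<lambda>Q. interior Q = {} \<or> liftable k (Q::'d set)"
    by (rule operative_liftable)
  have "\<forall>Q\<in>snd ` p. interior Q = {} \<or> liftable k Q"
  proof
    fix Q assume "Q \<in> snd ` p"
    then obtain x where xQ: "(x, Q) \<in> p" by force
    then have "x \<in> cbox a b" "Q \<subseteq> cbox a b" "Q \<subseteq> \<gamma> x"
      using p tagged_division_ofD(2,3)[OF p(1) xQ] by (auto simp: fine_def)
    then have "Q \<subseteq> cbox a b \<inter> ball x (d x)" by (simp add: \<gamma>_def)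
    then show "interior Q = {} \<or> liftable k Q" using d[OF \<open>x \<in> cbox a b\<close>] liftable_subset by blast
  qed
  then have "interior (cbox a b) = {} \<or> liftable k (cbox a b)"
    using division[OF division_of_tagged_division[OF p(1)]] unfolding comm_monoid_set_F_and by blast
  then show ?thesis using ne by simp
qed

text \<open>Lift the homotopy to the square. On the two sides where the homotopy is constant the lift is constant, and on the other two
sides it is the lift of one of the paths.\<close>

lemma lift_homotopic_paths:
  assumes pq: "homotopic_paths \<Omega> p q" and gp: "lift p {0..1} gp" and gq: "lift q {0..1} gq"
    and start: "gp 0 = gq 0"
  shows "gp 1 = gq 1"
proof -
  from pq[unfolded homotopic_paths] obtain h where
    h1: "continuous_on ({0..1} \<times> {0..1}) h" "h \<in> ({0..1} \<times> {0..1}) \<rightarrow> \<Omega>"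
    and h2: "\<forall>x\<in>{0..1}. h (0, x) = p x" "\<forall>x\<in>{0..1}. h (1, x) = q x"
    and h3: "\<forall>t\<in>{0..1::real}. pathstart (h \<circ> Pair t) = pathstart p \<and> pathfinish (h \<circ> Pair t) = pathfinish p"
    by (elim exE conjE)
  have h4: "h (t, 0) = p 0" "h (t, 1) = p 1" if "t \<in> {0..1}" for t
    using h3 that by (auto simp: pathstart_def pathfinish_def)
  note h = h1 h2 h4
  have sq: "{0..1} \<times> {0..1} = cbox (0, 0) (1::real, 1::real)"
    by (simp add: cbox_Pair_eq)
  have "liftable h (cbox (0, 0) (1::real, 1::real))"
    by (rule liftable_cbox) (use h sq in \<open>auto simp: box_ne_empty Basis_prod_def\<close>)
  then obtain G where G: "lift h ({0..1} \<times> {0..1}) G" "G (0, 0) = gp 0"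
    unfolding liftable_def sq[symmetric] by force
  have edge: "lift (\<lambda>t. h (f t)) {0..1} (\<lambda>t. G (f t))" if "continuous_on {0..1} f" "f ` {0..1} \<subseteq> {0..1} \<times> {0..1}"
    for f :: "real \<Rightarrow> real \<times> real"
    using lift_compose[OF G(1) that] .
  have conn: "connected {0..1::real}" by simp
  have const: "G (1, j) = G (0, j)" if j: "j = 0 \<or> j = 1" for j
  proof -
    have "lift (\<lambda>t. h (t, j)) {0..1} (\<lambda>t. G (t, j))"
      by (rule edge) (use j in \<open>auto intro!: continuous_intros\<close>)
    then have 1: "lift (\<lambda>_. h (0, j)) {0..1} (\<lambda>t. G (t, j))"
      by (rule lift_cong) (use h j in auto)
    have "h (0, j) \<in> \<Omega>" using h(2) j by auto
    then obtain r s where r: "r > 0" "ball (h (0, j)) r \<subseteq> \<Omega>" "sec (ball (h (0, j)) r) s" "s (h (0, j)) = G (0, j)"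
      using local_sections[of "h (0, j)"] by (meson centre_in_ball)
    have 2: "lift (\<lambda>_::real. h (0, j)) {0..1} (\<lambda>_. s (h (0, j)))"
      by (rule lift_section[OF r(3,2)]) (use r in auto)
    have "G (1, j) = s (h (0, j))"
      by (rule lift_unique[OF conn 1 2, of 0]) (use r in auto)
    then show ?thesis using r by simp
  qed
  have L: "lift p {0..1} (\<lambda>t. G (0, t))"
    by (rule lift_cong[OF edge]) (use h in \<open>auto intro!: continuous_intros\<close>)
  have R: "lift q {0..1} (\<lambda>t. G (1, t))"
    by (rule lift_cong[OF edge]) (use h in \<open>auto intro!: continuous_intros\<close>)
  have "gp 1 = G (0, 1)" by (rule lift_unique[OF conn gp L, of 0]) (use G in auto)
  moreover have "gq 1 = G (1, 1)"
    by (rule lift_unique[OF conn gq R, of 0]) (use G start const in auto)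
  ultimately show ?thesis using const by simp
qed

text \<open>The monodromy theorem. The value at \<open>u\<close> is the endpoint of the lift of any path from \<open>a\<close> to \<open>u\<close>; appending a segment to the path
shows that near each point this is a section.\<close>

theorem global_section:
  assumes sc: "simply_connected \<Omega>" and a: "a \<in> \<Omega>"
  obtains F where "F a = m" "\<And>p. p \<in> \<Omega> \<Longrightarrow> \<exists>r s. r > 0 \<and> ball p r \<subseteq> \<Omega> \<and> sec (ball p r) s \<and> (\<forall>x\<in>ball p r. F x = s x)"
proof -
  define Q where "Q = (\<lambda>u g \<gamma>. path \<gamma> \<and> path_image \<gamma> \<subseteq> \<Omega> \<and> pathstart \<gamma> = a \<and> pathfinish \<gamma> = u \<and>
      lift \<gamma> {0..1} g \<and> g 0 = m)"
  have same: "g 1 = g' 1" if "Q u g \<gamma>" "Q u g' \<gamma>'" for u g g' \<gamma> \<gamma>'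
  proof -
    have "homotopic_paths \<Omega> \<gamma> \<gamma>'"
      using sc that unfolding simply_connected_eq_homotopic_paths Q_def by auto
    then show ?thesis
      by (rule lift_homotopic_paths) (use that in \<open>auto simp: Q_def\<close>)
  qed
  have path_lift: "\<exists>g. lift \<gamma> {0..1} g \<and> g 0 = m" if "path \<gamma>" "path_image \<gamma> \<subseteq> \<Omega>" for \<gamma> :: "real \<Rightarrow> 'e" and m
  proof -
    have "liftable \<gamma> (cbox 0 1)"
      by (rule liftable_cbox) (use that in \<open>auto simp: path_def path_image_def\<close>)
    then show ?thesis unfolding liftable_def by (auto simp: cbox_interval)
  qed
  have exQ: "\<exists>g \<gamma>. Q u g \<gamma>" if u: "u \<in> \<Omega>" for u
  proof -
    obtain \<gamma> where \<gamma>: "path \<gamma>" "path_image \<gamma> \<subseteq> \<Omega>" "pathstart \<gamma> = a" "pathfinish \<gamma> = u"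
      using simply_connected_imp_path_connected[OF sc, unfolded path_connected_def, rule_format, OF a u]
      by blast
    obtain g where "lift \<gamma> {0..1} g" "g 0 = m" using path_lift[OF \<gamma>(1,2)] by metis
    then have "Q u g \<gamma>" using \<gamma> by (simp add: Q_def)
    then show ?thesis by blast
  qed
  define F where "F = (\<lambda>u. SOME v. \<exists>g \<gamma>. Q u g \<gamma> \<and> g 1 = v)"
  have F: "F u = g 1" if "Q u g \<gamma>" for u g \<gamma>
    unfolding F_def by (rule some_equality) (use that same in blast)+
  show thesis
  proof
    show "F a = m"
    proof -
      obtain g where g: "lift (linepath a a) {0..1} g" "g 0 = m"
        using path_lift[of "linepath a a" m] a by auto
      obtain r s where r: "r > 0" "ball a r \<subseteq> \<Omega>" "sec (ball a r) s" "s a = m"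
        using local_sections[OF a] by (meson centre_in_ball)
      have s: "lift (linepath a a) {0..1} (\<lambda>t. s (linepath a a t))"
        by (rule lift_section[OF r(3,2)]) (use r in \<open>auto simp: linepath_refl\<close>)
      have "Q a (\<lambda>t. s (linepath a a t)) (linepath a a)"
        using s a r by (simp add: Q_def linepath_0')
      then show ?thesis using F r by (simp add: linepath_1')
    qed
    fix p assume p: "p \<in> \<Omega>"
    obtain g \<gamma> where Qp: "Q p g \<gamma>" using exQ[OF p] by blast
    obtain r s where r: "r > 0" "ball p r \<subseteq> \<Omega>" "sec (ball p r) s" "s p = g 1"
      using local_sections[OF p] by (meson centre_in_ball)
    have "F x = s x" if x: "x \<in> ball p r" for x
    proof -
      have lp: "closed_segment p x \<subseteq> ball p r"
        using x r by (intro closed_segment_subset) auto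
      let ?\<gamma> = "\<gamma> +++ linepath p x"
      have g\<gamma>: "path ?\<gamma>" "path_image ?\<gamma> \<subseteq> \<Omega>" "pathstart ?\<gamma> = a" "pathfinish ?\<gamma> = x"
        using Qp lp r(2) by (auto simp: Q_def path_image_join)
      then obtain g' where g': "lift ?\<gamma> {0..1} g'" "g' 0 = m" using path_lift by blast
      have conn: "connected {0..1::real}" by simp
      \<comment> \<open>The first half of the lift of the joined path lifts the path to \<open>p\<close>, and the second half lifts the segment from \<open>p\<close> to \<open>x\<close>.\<close>
      have "lift (\<lambda>t. ?\<gamma> (t / 2)) {0..1} (\<lambda>t. g' (t / 2))"
        by (rule lift_compose[OF g'(1)]) (auto intro!: continuous_intros)
      then have "lift \<gamma> {0..1} (\<lambda>t. g' (t / 2))"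
        by (rule lift_cong) (auto simp: joinpaths_def)
      then have half: "g' (1 / 2) = g 1"
        by (rule lift_unique[OF conn, of _ _ _ 0]) (use Qp g' in \<open>auto simp: Q_def\<close>)
      have "lift (\<lambda>t. ?\<gamma> ((t + 1) / 2)) {0..1} (\<lambda>t. g' ((t + 1) / 2))"
        by (rule lift_compose[OF g'(1)]) (auto intro!: continuous_intros)
      then have 2: "lift (linepath p x) {0..1} (\<lambda>t. g' ((t + 1) / 2))"
      proof (rule lift_cong)
        show "?\<gamma> ((t + 1) / 2) = linepath p x t" if "t \<in> {0..1}" for t
        proof (cases "t = 0")
          case True
          then show ?thesis using Qp by (simp add: joinpaths_def Q_def pathfinish_def linepath_def)
        next
          case False
          have "2 * ((t + 1) / 2) - 1 = t" by (simp add: field_simps)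
          then show ?thesis using that False by (simp add: joinpaths_def)
        qed
      qed
      have 3: "lift (linepath p x) {0..1} (\<lambda>t. s (linepath p x t))"
        by (rule lift_section[OF r(3,2)]) (use lp in \<open>auto simp: path_image_def[symmetric]\<close>)
      have "g' ((1 + 1) / 2) = s (linepath p x 1)"
        by (rule lift_unique[OF conn 2 3, of 0]) (use half r in \<open>auto simp: linepath_def\<close>)
      moreover have "F x = g' 1" using F[of x g' ?\<gamma>] g\<gamma> g' by (simp add: Q_def)
      ultimately show ?thesis by (simp add: linepath_def)
    qed
    then show "\<exists>r s. r > 0 \<and> ball p r \<subseteq> \<Omega> \<and> sec (ball p r) s \<and> (\<forall>x\<in>ball p r. F x = s x)"
      using r by blast
  qed
qed

end

section \<open>Calculus of smooth maps\<close>

lemma Ck_on_SucD: "Ck_on (Suc k) S f \<Longrightarrow> Ck_on k S f"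
proof (induction k arbitrary: f)
  case 0
  then show ?case
    by (auto intro: continuous_at_imp_continuous_on differentiable_imp_continuous_within)
next
  case (Suc k)
  then show ?case by (metis Ck_on.simps(2))
qed

lemma Ck_on_cong:
  assumes S: "open S" and eq: "\<And>u. u \<in> S \<Longrightarrow> f u = g u" and f: "Ck_on k S f"
  shows "Ck_on k S g"
  using eq f
proof (induction k arbitrary: f g)
  case 0
  then show ?case using continuous_on_cong[of S S f g] by simp
next
  case (Suc k)
  have f: "\<And>u. u \<in> S \<Longrightarrow> (f has_derivative frechet_derivative f (at u)) (at u)"
    using Suc.prems frechet_derivative_works by auto
  have g: "(g has_derivative frechet_derivative f (at u)) (at u)" if u: "u \<in> S" for u
    using has_derivative_transform_within_open[OF f[OF u] S u] Suc.prems(1) by blast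
  have eq': "frechet_derivative f (at u) = frechet_derivative g (at u)" if "u \<in> S" for u
    using frechet_derivative_at[OF g[OF that]] .
  have "Ck_on k S (\<lambda>u. frechet_derivative g (at u) v)" for v
  proof (rule Suc.IH)
    show "frechet_derivative f (at u) v = frechet_derivative g (at u) v" if "u \<in> S" for u
      using eq'[OF that] by (rule fun_cong)
    show "Ck_on k S (\<lambda>u. frechet_derivative f (at u) v)" using Suc.prems(2) by simp
  qed
  then show ?case using g by (auto simp: differentiable_def)
qed

text \<open>On an open set any formula for the derivative may be used in the recursive definition.\<close>

lemma Ck_on_SucI:
  assumes S: "open S" and f: "\<And>u. u \<in> S \<Longrightarrow> (f has_derivative f' u) (at u)"
    and f': "\<And>v. Ck_on k S (\<lambda>u. f' u v)"
  shows "Ck_on (Suc k) S f"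
proof -
  have "Ck_on k S (\<lambda>u. frechet_derivative f (at u) v)" for v
  proof (rule Ck_on_cong[OF S _ f'])
    show "f' u v = frechet_derivative f (at u) v" if "u \<in> S" for u
      using frechet_derivative_at[OF f[OF that]] by (rule fun_cong)
  qed
  then show ?thesis using f by (auto simp: differentiable_def)
qed

lemma Ck_on_Suc_derivative:
  assumes "Ck_on (Suc k) S f" "u \<in> S"
  shows "(f has_derivative frechet_derivative f (at u)) (at u)"
  using assms frechet_derivative_works by auto

lemma Ck_on_const: "open S \<Longrightarrow> Ck_on k S (\<lambda>u. c)"
  by (induction k arbitrary: c) auto

lemma Ck_on_bounded_linear:
  assumes S: "open S" and L: "bounded_linear L" and f: "Ck_on k S f"
  shows "Ck_on k S (\<lambda>u. L (f u))"
  using f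
proof (induction k arbitrary: f)
  case 0
  then show ?case using L by (simp add: bounded_linear.continuous_on)
next
  case (Suc k)
  show ?case
  proof (rule Ck_on_SucI[OF S])
    show "((\<lambda>u. L (f u)) has_derivative (\<lambda>v. L (frechet_derivative f (at u) v))) (at u)" if "u \<in> S" for u
      by (rule bounded_linear.has_derivative[OF L Ck_on_Suc_derivative[OF Suc.prems that]])
    show "Ck_on k S (\<lambda>u. L (frechet_derivative f (at u) v))" for v
      by (rule Suc.IH) (use Suc.prems in simp)
  qed
qed

lemma Ck_on_add:
  assumes S: "open S" and f: "Ck_on k S f" and g: "Ck_on k S g"
  shows "Ck_on k S (\<lambda>u. f u + g u)"
  using f g
proof (induction k arbitrary: f g)
  case 0
  then show ?case by (simp add: continuous_on_add)
next
  case (Suc k)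
  show ?case
  proof (rule Ck_on_SucI[OF S])
    show "((\<lambda>u. f u + g u) has_derivative (\<lambda>v. frechet_derivative f (at u) v + frechet_derivative g (at u) v)) (at u)"
      if "u \<in> S" for u
      by (intro has_derivative_add Ck_on_Suc_derivative[OF Suc.prems(1) that] Ck_on_Suc_derivative[OF Suc.prems(2) that])
    show "Ck_on k S (\<lambda>u. frechet_derivative f (at u) v + frechet_derivative g (at u) v)" for v
      by (rule Suc.IH) (use Suc.prems in simp_all)
  qed
qed

lemma Ck_on_sum:
  assumes S: "open S" and "finite I" and f: "\<And>i. i \<in> I \<Longrightarrow> Ck_on k S (f i)"
  shows "Ck_on k S (\<lambda>u. \<Sum>i\<in>I. f i u)"
  using assms(2) f by (induction I) (auto intro: Ck_on_const Ck_on_add S)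

lemma Ck_on_bilinear:
  assumes S: "open S" and B: "bounded_bilinear B" and f: "Ck_on k S f" and g: "Ck_on k S g"
  shows "Ck_on k S (\<lambda>u. B (f u) (g u))"
  using f g
proof (induction k arbitrary: f g)
  case 0
  then show ?case using bounded_bilinear.continuous_on[OF B] by simp
next
  case (Suc k)
  show ?case
  proof (rule Ck_on_SucI[OF S])
    show "((\<lambda>u. B (f u) (g u)) has_derivative
        (\<lambda>v. B (f u) (frechet_derivative g (at u) v) + B (frechet_derivative f (at u) v) (g u))) (at u)"
      if "u \<in> S" for u
      by (intro bounded_bilinear.FDERIV[OF B] Ck_on_Suc_derivative[OF Suc.prems(1) that] Ck_on_Suc_derivative[OF Suc.prems(2) that])
    show "Ck_on k S (\<lambda>u. B (f u) (frechet_derivative g (at u) v) + B (frechet_derivative f (at u) v) (g u))" for v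
      by (intro Ck_on_add S Suc.IH Ck_on_SucD[OF Suc.prems(1)] Ck_on_SucD[OF Suc.prems(2)])
        (use Suc.prems in simp_all)
  qed
qed

lemma Ck_on_inverse:
  fixes f :: "'a::euclidean_space \<Rightarrow> real"
  assumes S: "open S" and f: "Ck_on k S f" and nz: "\<And>u. u \<in> S \<Longrightarrow> f u \<noteq> 0"
  shows "Ck_on k S (\<lambda>u. inverse (f u))"
  using f
proof (induction k)
  case 0
  then show ?case using nz by (simp add: continuous_on_inverse)
next
  case (Suc k)
  show ?case
  proof (rule Ck_on_SucI[OF S])
    show "((\<lambda>u. inverse (f u)) has_derivative
        (\<lambda>v. (- 1) * (inverse (f u) * (frechet_derivative f (at u) v * inverse (f u))))) (at u)" if "u \<in> S" for u
      using nz[OF that] by (auto intro!: derivative_eq_intros Ck_on_Suc_derivative[OF Suc.prems that])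
    show "Ck_on k S (\<lambda>u. (- 1) * (inverse (f u) * (frechet_derivative f (at u) v * inverse (f u))))" for v
      by (intro Ck_on_bilinear[OF S bounded_bilinear_mult] Ck_on_const S Suc.IH Ck_on_SucD[OF Suc.prems])
        (use Suc.prems in simp)
  qed
qed

text \<open>Expanded in a basis, the chain rule writes the derivative as a sum of products of derivatives of \<open>g\<close> with the compositions
of derivatives of \<open>f\<close> with \<open>g\<close>, to which the induction hypothesis applies.\<close>

lemma Ck_on_compose:
  fixes g :: "'a::euclidean_space \<Rightarrow> 'b::euclidean_space"
  assumes T: "open T" and gT: "g ` T \<subseteq> S" and g: "Ck_on k T g" and f: "smooth_on S f"
  shows "Ck_on k T (\<lambda>y. f (g y))"
  using g f
proof (induction k arbitrary: f)
  case 0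
  then have "continuous_on S f" unfolding smooth_on_def using Ck_on.simps(1) by blast
  then show ?case using 0 gT by (auto intro: continuous_on_compose2)
next
  case (Suc k)
  have fS: "Ck_on (Suc n) S f" for n using Suc.prems(2) by (simp add: smooth_on_def del: Ck_on.simps)
  show ?case
  proof (rule Ck_on_SucI[OF T])
    fix y assume y: "y \<in> T"
    have g: "(g has_derivative frechet_derivative g (at y)) (at y)"
      by (rule Ck_on_Suc_derivative[OF Suc.prems(1) y])
    have f: "(f has_derivative frechet_derivative f (at (g y))) (at (g y))"
      using Ck_on_Suc_derivative[OF fS] gT y by blast
    have "frechet_derivative f (at (g y)) (frechet_derivative g (at y) v) =
        (\<Sum>b\<in>Basis. (frechet_derivative g (at y) v \<bullet> b) *\<^sub>R frechet_derivative f (at (g y)) b)" for v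
    proof -
      have lin: "linear (frechet_derivative f (at (g y)))" using f by (rule has_derivative_linear)
      have "frechet_derivative f (at (g y)) (\<Sum>b\<in>Basis. (frechet_derivative g (at y) v \<bullet> b) *\<^sub>R b) =
        (\<Sum>b\<in>Basis. (frechet_derivative g (at y) v \<bullet> b) *\<^sub>R frechet_derivative f (at (g y)) b)"
        by (simp add: linear_sum[OF lin] linear_scale[OF lin])
      then show ?thesis by (simp add: euclidean_representation)
    qed
    then show "((\<lambda>y. f (g y)) has_derivative
      (\<lambda>v. \<Sum>b\<in>Basis. (frechet_derivative g (at y) v \<bullet> b) *\<^sub>R frechet_derivative f (at (g y)) b)) (at y)"
      using has_derivative_compose[OF g f] by simp
  next
    fix v
    have "smooth_on S (\<lambda>x. frechet_derivative f (at x) b)" for b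
      using fS by (auto simp: smooth_on_def)
    then have 1: "Ck_on k T (\<lambda>y. frechet_derivative f (at (g y)) b)" for b
      by (rule Suc.IH[OF Ck_on_SucD[OF Suc.prems(1)]])
    have 2: "Ck_on k T (\<lambda>y. frechet_derivative g (at y) v)" using Suc.prems by simp
    show "Ck_on k T (\<lambda>y. \<Sum>b\<in>Basis. (frechet_derivative g (at y) v \<bullet> b) *\<^sub>R frechet_derivative f (at (g y)) b)"
      by (intro Ck_on_sum T finite_Basis Ck_on_bilinear[OF T bounded_bilinear_scaleR] 1
          Ck_on_bounded_linear[OF T bounded_linear_inner_left 2])
  qed
qed

lemma smooth_on_derivative:
  assumes "smooth_on S f"
  shows "smooth_on S (\<lambda>u. frechet_derivative f (at u) v)"
  unfolding smooth_on_def
proof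
  fix k
  have "Ck_on (Suc k) S f" using assms unfolding smooth_on_def by blast
  then show "Ck_on k S (\<lambda>u. frechet_derivative f (at u) v)" by simp
qed

lemma smooth_on_has_derivative:
  assumes "smooth_on S f" "u \<in> S"
  shows "(f has_derivative frechet_derivative f (at u)) (at u)"
  by (rule Ck_on_Suc_derivative[OF assms(1)[unfolded smooth_on_def, rule_format, of "Suc 0"] assms(2)])

lemma smooth_on_continuous: "smooth_on S f \<Longrightarrow> continuous_on S f"
  unfolding smooth_on_def using Ck_on.simps(1) by blast

lemma smooth_on_cong: "open S \<Longrightarrow> (\<And>u. u \<in> S \<Longrightarrow> f u = g u) \<Longrightarrow> smooth_on S f \<Longrightarrow> smooth_on S g"
  unfolding smooth_on_def using Ck_on_cong by blast

lemma smooth_on_const: "open S \<Longrightarrow> smooth_on S (\<lambda>u. c)"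
  by (simp add: smooth_on_def Ck_on_const)

lemma smooth_on_bounded_linear: "open S \<Longrightarrow> bounded_linear L \<Longrightarrow> smooth_on S f \<Longrightarrow> smooth_on S (\<lambda>u. L (f u))"
  by (simp add: smooth_on_def Ck_on_bounded_linear)

lemma smooth_on_add: "open S \<Longrightarrow> smooth_on S f \<Longrightarrow> smooth_on S g \<Longrightarrow> smooth_on S (\<lambda>u. f u + g u)"
  by (simp add: smooth_on_def Ck_on_add)

lemma smooth_on_sum:
  "open S \<Longrightarrow> finite I \<Longrightarrow> (\<And>i. i \<in> I \<Longrightarrow> smooth_on S (f i)) \<Longrightarrow> smooth_on S (\<lambda>u. \<Sum>i\<in>I. f i u)"
  by (simp add: smooth_on_def Ck_on_sum)

lemma smooth_on_bilinear:
  "open S \<Longrightarrow> bounded_bilinear B \<Longrightarrow> smooth_on S f \<Longrightarrow> smooth_on S g \<Longrightarrow> smooth_on S (\<lambda>u. B (f u) (g u))"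
  by (simp add: smooth_on_def Ck_on_bilinear)

lemma smooth_on_mult:
  fixes f g :: "'a::euclidean_space \<Rightarrow> 'b::real_normed_algebra"
  shows "open S \<Longrightarrow> smooth_on S f \<Longrightarrow> smooth_on S g \<Longrightarrow> smooth_on S (\<lambda>u. f u * g u)"
  by (rule smooth_on_bilinear[OF _ bounded_bilinear_mult])

lemma smooth_on_divide:
  fixes f g :: "'a::euclidean_space \<Rightarrow> real"
  shows "open S \<Longrightarrow> smooth_on S f \<Longrightarrow> smooth_on S g \<Longrightarrow> (\<And>u. u \<in> S \<Longrightarrow> g u \<noteq> 0) \<Longrightarrow> smooth_on S (\<lambda>u. f u / g u)"
  unfolding divide_inverse
  by (intro smooth_on_mult) (auto simp: smooth_on_def Ck_on_inverse)

lemma bounded_linear_axis: "bounded_linear (axis i :: 'b::real_normed_vector \<Rightarrow> 'b^'n::finite)"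
proof (rule bounded_linear_intro[of _ 1])
  show "norm (axis i x) \<le> norm x * 1" for x :: 'b
    unfolding norm_vec_def L2_set_def axis_def
    by (simp add: if_distrib[where f = norm] if_distrib[where f = "\<lambda>x. x\<^sup>2"] cong: if_cong)
qed (auto simp: axis_def vec_eq_iff)

lemma smooth_on_vec:
  fixes f :: "'a::euclidean_space \<Rightarrow> 'b::real_normed_vector^'n::finite"
  assumes S: "open S" and f: "\<And>i. smooth_on S (\<lambda>u. f u $ i)"
  shows "smooth_on S f"
proof (rule smooth_on_cong[OF S])
  show "smooth_on S (\<lambda>u. \<Sum>i\<in>UNIV. axis i (f u $ i))"
    by (intro smooth_on_sum S smooth_on_bounded_linear[OF S bounded_linear_axis] f) simp
  show "(\<Sum>i\<in>UNIV. axis i (f u $ i)) = f u" for u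
    by (simp add: vec_eq_iff axis_def)
qed

lemma smooth_on_nth: "open S \<Longrightarrow> smooth_on S f \<Longrightarrow> smooth_on S (\<lambda>u. f u $ i)"
  by (rule smooth_on_bounded_linear[OF _ bounded_linear_vec_nth])

lemma partial_eqI: "(f has_derivative f') (at u) \<Longrightarrow> partial i f u = f' (axis i 1)"
  unfolding partial_def using frechet_derivative_at by metis

lemma smooth_on_partial: "smooth_on S f \<Longrightarrow> smooth_on S (partial i f)"
  using smooth_on_derivative[of S f "axis i 1"] by (simp add: partial_def[abs_def])

lemma partial_cong:
  assumes "open S" "u \<in> S" "\<And>p. p \<in> S \<Longrightarrow> f p = g p"
  shows "partial i f u = partial i g u"
proof (cases "f differentiable (at u)")
  case True
  then show ?thesis
    using frechet_derivative_transform_within_open[OF True assms(1,2)] assms(3) by (simp add: partial_def)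
next
  case False
  moreover have "\<not> g differentiable (at u)"
  proof
    assume "g differentiable (at u)"
    then obtain g' where "(g has_derivative g') (at u)" by (auto simp: differentiable_def)
    from has_derivative_transform_within_open[OF this assms(1,2)] assms(3)
    have "(f has_derivative g') (at u)" by metis
    then show False using False by (auto simp: differentiable_def)
  qed
  ultimately show ?thesis
    unfolding partial_def frechet_derivative_def differentiable_def by metis
qed

lemma real_derivative_along_line:
  assumes "(f has_derivative f') (at (a + x *\<^sub>R v))"
  shows "((\<lambda>x. f (a + x *\<^sub>R v)) has_real_derivative f' v) (at x)"
proof -
  have "((\<lambda>x. f (a + x *\<^sub>R v)) has_derivative (\<lambda>h. f' (h *\<^sub>R v))) (at x)"
    by (rule has_derivative_compose[of "\<lambda>x. a + x *\<^sub>R v" "\<lambda>h. h *\<^sub>R v" x UNIV f f'])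
      (use assms in \<open>auto intro!: derivative_eq_intros\<close>)
  moreover have "f' (h *\<^sub>R v) = f' v * h" for h
    using linear_scale[OF has_derivative_linear[OF assms]] by simp
  ultimately show ?thesis by (simp add: has_field_derivative_def)
qed

text \<open>The mean value theorem, applied twice, writes the second difference quotient of \<open>f\<close> with steps \<open>s v\<close> and \<open>s w\<close> as a value of
either mixed derivative at a point close to \<open>u\<close>; if the two differed at \<open>u\<close>, they would have disjoint ranges near \<open>u\<close>.\<close>

lemma symmetric_second_derivative:
  fixes f :: "'a::euclidean_space \<Rightarrow> real"
  assumes S: "open S" and f: "smooth_on S f" and u: "u \<in> S"
  shows "frechet_derivative (\<lambda>p. frechet_derivative f (at p) v) (at u) w =
    frechet_derivative (\<lambda>p. frechet_derivative f (at p) w) (at u) v"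
proof (rule ccontr)
  define D where "D = (\<lambda>v p. frechet_derivative f (at p) v)"
  define DD where "DD = (\<lambda>v w p. frechet_derivative (D v) (at p) w)"
  have smD: "smooth_on S (D v)" for v unfolding D_def by (rule smooth_on_derivative[OF f])
  have smDD: "continuous_on S (DD v w)" for v w unfolding DD_def by (intro smooth_on_continuous smooth_on_derivative smD)
  assume "\<not> ?thesis"
  then have ne: "DD v w u \<noteq> DD w v u" by (simp add: DD_def D_def)
  define e where "e = \<bar>DD v w u - DD w v u\<bar> / 2"
  have e: "e > 0" using ne by (simp add: e_def)
  obtain d0 where d0: "d0 > 0" "ball u d0 \<subseteq> S" using S u openE by blast
  have cont: "\<exists>d>0. \<forall>p. dist p u < d \<longrightarrow> \<bar>DD v w p - DD v w u\<bar> < e" for v w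
    using smDD[of v w] S u e unfolding continuous_on_eq_continuous_at[OF S] continuous_at_eps_delta dist_real_def
    by blast
  obtain d1 where d1: "d1 > 0" "\<And>p. dist p u < d1 \<Longrightarrow> \<bar>DD v w p - DD v w u\<bar> < e" using cont by blast
  obtain d2 where d2: "d2 > 0" "\<And>p. dist p u < d2 \<Longrightarrow> \<bar>DD w v p - DD w v u\<bar> < e" using cont by blast
  define d where "d = min d0 (min d1 d2)"
  have d: "d > 0" using d0 d1 d2 by (simp add: d_def)
  define s where "s = d / (norm v + norm w + 1)"
  have nn: "norm v + norm w + 1 > 0" by (simp add: add_nonneg_pos)
  have s: "s > 0" using d nn by (simp add: s_def)
  have near: "dist (u + x *\<^sub>R v + y *\<^sub>R w) u < d" if "0 \<le> x" "x \<le> s" "0 \<le> y" "y \<le> s" for x y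
  proof -
    have "dist (u + x *\<^sub>R v + y *\<^sub>R w) u = norm (x *\<^sub>R v + y *\<^sub>R w)" by (simp add: dist_norm add.assoc)
    also have "\<dots> \<le> x * norm v + y * norm w" using that norm_triangle_ineq[of "x *\<^sub>R v" "y *\<^sub>R w"] by simp
    also have "\<dots> \<le> s * norm v + s * norm w" using that by (intro add_mono mult_right_mono) auto
    also have "\<dots> < s * (norm v + norm w + 1)" using s by (simp add: algebra_simps)
    also have "\<dots> = d" using nn by (simp add: s_def)
    finally show ?thesis .
  qed
  have main: "\<exists>x y. 0 \<le> x \<and> x \<le> s \<and> 0 \<le> y \<and> y \<le> s \<and>
      f (u + s *\<^sub>R v + s *\<^sub>R w) - f (u + s *\<^sub>R v) - f (u + s *\<^sub>R w) + f u = s * (s * DD v w (u + x *\<^sub>R v + y *\<^sub>R w))"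
    if nr: "\<And>x y. 0 \<le> x \<Longrightarrow> x \<le> s \<Longrightarrow> 0 \<le> y \<Longrightarrow> y \<le> s \<Longrightarrow> u + x *\<^sub>R v + y *\<^sub>R w \<in> S" for v w
  proof -
    have der: "((\<lambda>x. f (u + c *\<^sub>R w + x *\<^sub>R v)) has_real_derivative D v (u + c *\<^sub>R w + x *\<^sub>R v)) (at x)"
      if "0 \<le> x" "x \<le> s" "0 \<le> c" "c \<le> s" for x c
      unfolding D_def using nr[OF that]
      by (intro real_derivative_along_line smooth_on_has_derivative[OF f]) (simp add: add_ac)
    have "\<exists>x>0. x < s \<and> (f (u + s *\<^sub>R w + s *\<^sub>R v) - f (u + 0 *\<^sub>R w + s *\<^sub>R v)) -
       (f (u + s *\<^sub>R w + 0 *\<^sub>R v) - f (u + 0 *\<^sub>R w + 0 *\<^sub>R v))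
       = (s - 0) * (D v (u + s *\<^sub>R w + x *\<^sub>R v) - D v (u + 0 *\<^sub>R w + x *\<^sub>R v))"
      by (rule MVT2[OF s]) (use s in \<open>intro DERIV_diff der; simp\<close>)
    then obtain x where x: "0 < x" "x < s"
      "f (u + s *\<^sub>R v + s *\<^sub>R w) - f (u + s *\<^sub>R v) - f (u + s *\<^sub>R w) + f u
        = s * (D v (u + x *\<^sub>R v + s *\<^sub>R w) - D v (u + x *\<^sub>R v + 0 *\<^sub>R w))"
      by (auto simp: algebra_simps)
    have "\<exists>y>0. y < s \<and> D v (u + x *\<^sub>R v + s *\<^sub>R w) - D v (u + x *\<^sub>R v + 0 *\<^sub>R w)
        = (s - 0) * DD v w (u + x *\<^sub>R v + y *\<^sub>R w)"
      unfolding DD_def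
      by (rule MVT2[OF s]) (use x nr in \<open>intro real_derivative_along_line smooth_on_has_derivative[OF smD]; simp\<close>)
    then obtain y where y: "0 < y" "y < s" "D v (u + x *\<^sub>R v + s *\<^sub>R w) - D v (u + x *\<^sub>R v + 0 *\<^sub>R w)
        = s * DD v w (u + x *\<^sub>R v + y *\<^sub>R w)" by auto
    show ?thesis
      using x y by (intro exI[of _ x] exI[of _ y]) auto
  qed
  have inS: "u + x *\<^sub>R v + y *\<^sub>R w \<in> S" if "0 \<le> x" "x \<le> s" "0 \<le> y" "y \<le> s" for x y
    using near[OF that] d0 by (auto simp: d_def dist_commute)
  obtain x y where 1: "0 \<le> x" "x \<le> s" "0 \<le> y" "y \<le> s"
    "f (u + s *\<^sub>R v + s *\<^sub>R w) - f (u + s *\<^sub>R v) - f (u + s *\<^sub>R w) + f u = s * (s * DD v w (u + x *\<^sub>R v + y *\<^sub>R w))"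
    using main[OF inS] by blast
  have inS': "u + x *\<^sub>R w + y *\<^sub>R v \<in> S" if "0 \<le> x" "x \<le> s" "0 \<le> y" "y \<le> s" for x y
    using inS[OF that(3,4,1,2)] by (simp add: add_ac)
  obtain y' x' where 2: "0 \<le> x'" "x' \<le> s" "0 \<le> y'" "y' \<le> s"
    "f (u + s *\<^sub>R w + s *\<^sub>R v) - f (u + s *\<^sub>R w) - f (u + s *\<^sub>R v) + f u = s * (s * DD w v (u + y' *\<^sub>R w + x' *\<^sub>R v))"
    using main[OF inS'] by blast
  have "s * (s * DD v w (u + x *\<^sub>R v + y *\<^sub>R w)) = s * (s * DD w v (u + y' *\<^sub>R w + x' *\<^sub>R v))"
    unfolding 1(5)[symmetric] 2(5)[symmetric] by (simp add: algebra_simps)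
  then have "DD v w (u + x *\<^sub>R v + y *\<^sub>R w) = DD w v (u + x' *\<^sub>R v + y' *\<^sub>R w)"
    using s by (simp add: add_ac)
  moreover have "\<bar>DD v w (u + x *\<^sub>R v + y *\<^sub>R w) - DD v w u\<bar> < e"
    using near[OF 1(1-4)] by (intro d1) (simp add: d_def)
  moreover have "\<bar>DD w v (u + x' *\<^sub>R v + y' *\<^sub>R w) - DD w v u\<bar> < e"
    using near[OF 2(1-4)] by (intro d2) (simp add: d_def)
  ultimately show False unfolding e_def by (auto simp: field_simps abs_if split: if_splits)
qed

section \<open>Frames of flat matrix-valued forms\<close>

text \<open>By uniqueness and local existence, parallel sections form a locally constant sheaf.\<close>

lemma parallel_exists_simply_connected:
  fixes \<omega> :: "'e::euclidean_space \<Rightarrow> 'e \<Rightarrow>\<^sub>L ('a::banach \<Rightarrow>\<^sub>L 'a)"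
  assumes \<Omega>: "open \<Omega>" "simply_connected \<Omega>" "a \<in> \<Omega>"
    and der: "\<And>u. u \<in> \<Omega> \<Longrightarrow> (\<omega> has_derivative blinfun_apply (\<omega>' u)) (at u)"
    and cont: "continuous_on \<Omega> \<omega>'"
    and flat: "\<And>u v w. u \<in> \<Omega> \<Longrightarrow> \<omega>' u v w + (\<omega> u w o\<^sub>L \<omega> u v) = \<omega>' u w v + (\<omega> u v o\<^sub>L \<omega> u w)"
  obtains F where "F a = m" "parallel_on \<omega> \<Omega> F"
proof -
  have contw: "continuous_on \<Omega> \<omega>"
    using der by (meson continuous_at_imp_continuous_on has_derivative_continuous)
  interpret locally_constant_sheaf \<Omega> "parallel_on \<omega>"
  proof
    show "open \<Omega>" by fact
    show "parallel_on \<omega> V s" if "parallel_on \<omega> U s" "V \<subseteq> U" for U V s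
      using that by (rule parallel_on_subset)
    show "s y = s' y" if "parallel_on \<omega> (ball p r) s" "parallel_on \<omega> (ball p r) s'" "ball p r \<subseteq> \<Omega>"
      "x \<in> ball p r" "s x = s' x" "y \<in> ball p r" for p r s s' x y
      by (rule parallel_unique[OF open_ball _ continuous_on_subset[OF contw that(3)] that(1,2,4,5,6)]) simp
    fix p assume p: "p \<in> \<Omega>"
    obtain R where R: "R > 0" "ball p R \<subseteq> \<Omega>" "\<And>u. u \<in> ball p R \<Longrightarrow> norm (\<omega> u) * R \<le> 1/2"
      using small_ball[OF \<Omega>(1) p contw] by blast
    have "\<exists>s. parallel_on \<omega> (ball p (R / 4)) s \<and> s x = m" if x: "x \<in> ball p (R / 4)" for x m
    proof -
      have sub: "ball x (R / 2) \<subseteq> ball p R"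
        using x R(1) by (auto simp: ball_subset_ball_iff dist_commute)
      have sub': "ball p (R / 4) \<subseteq> ball x (R / 2)"
        using x R(1) by (auto simp: ball_subset_ball_iff dist_commute)
      obtain s where s: "s x = m" "parallel_on \<omega> (ball x (R / 2)) s"
      proof (rule parallel_exists_ball[of x "R / 2" \<omega> \<omega>' m])
        have sub\<Omega>: "ball x (R / 2) \<subseteq> \<Omega>" using sub R(2) by (rule subset_trans)
        show "continuous_on (ball x (R / 2)) \<omega>'" using cont sub\<Omega> by (rule continuous_on_subset)
        fix u v w assume u: "u \<in> ball x (R / 2)"
        have "norm (\<omega> u) * (R / 2) \<le> norm (\<omega> u) * R" using R(1) by (intro mult_left_mono) auto
        also have "\<dots> \<le> 1/2" using sub u by (intro R(3)) blast
        finally show "norm (\<omega> u) * (R / 2) \<le> 1/2" .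
        show "(\<omega> has_derivative blinfun_apply (\<omega>' u)) (at u)" using sub\<Omega> u by (intro der) blast
        show "\<omega>' u v w + (\<omega> u w o\<^sub>L \<omega> u v) = \<omega>' u w v + (\<omega> u v o\<^sub>L \<omega> u w)"
          using sub\<Omega> u by (intro flat) blast
      qed (use R(1) in auto)
      show ?thesis using parallel_on_subset[OF s(2) sub'] s(1) by blast
    qed
    then show "\<exists>r>0. ball p r \<subseteq> \<Omega> \<and> (\<forall>x\<in>ball p r. \<forall>m. \<exists>s. parallel_on \<omega> (ball p r) s \<and> s x = m)"
      using R by (intro exI[of _ "R / 4"]) auto
  qed
  obtain F where F: "F a = m" "\<And>p. p \<in> \<Omega> \<Longrightarrow>
      \<exists>r s. r > 0 \<and> ball p r \<subseteq> \<Omega> \<and> parallel_on \<omega> (ball p r) s \<and> (\<forall>x\<in>ball p r. F x = s x)"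
    using global_section[OF \<Omega>(2,3)] by blast
  have "parallel_on \<omega> \<Omega> F"
    unfolding parallel_on_def
  proof
    fix p assume "p \<in> \<Omega>"
    then obtain r s where r: "r > 0" "parallel_on \<omega> (ball p r) s" "\<And>x. x \<in> ball p r \<Longrightarrow> F x = s x"
      using F(2) by blast
    have "(s has_derivative (\<lambda>v. \<omega> p v (s p))) (at p)" using r by (simp add: parallel_on_def)
    then have "(F has_derivative (\<lambda>v. \<omega> p v (s p))) (at p)"
      by (rule has_derivative_transform_within_open[OF _ open_ball[of p r]]) (use r in auto)
    then show "(F has_derivative (\<lambda>v. \<omega> p v (F p))) (at p)" using r by simp
  qed
  then show thesis using F(1) that by blast
qed

lemma bounded_bilinear_matrix_mult:
  "bounded_bilinear ((**) :: complex^'m::finite^'l::finite \<Rightarrow> complex^'k::finite^'m \<Rightarrow> complex^'k^'l)"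
  unfolding bilinear_conv_bounded_bilinear[symmetric] bilinear_def linear_iff
  by (simp add: matrix_matrix_mult_def vec_eq_iff sum.distrib algebra_simps scaleR_sum_right)

interpretation matrix_mult: bounded_bilinear "(**) :: complex^'m::finite^'l::finite \<Rightarrow> complex^'k::finite^'m \<Rightarrow> complex^'k^'l"
  by (rule bounded_bilinear_matrix_mult)

lemma smooth_on_blinfun_derivative:
  fixes f :: "'a::euclidean_space \<Rightarrow> 'b::real_normed_vector"
  assumes "smooth_on S f"
  obtains f' where "\<And>u. u \<in> S \<Longrightarrow> (f has_derivative blinfun_apply (f' u)) (at u)" "continuous_on S f'"
proof
  define f' where "f' = (\<lambda>u. Blinfun (frechet_derivative f (at u)))"
  have f': "blinfun_apply (f' u) = frechet_derivative f (at u)" if "u \<in> S" for u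
    unfolding f'_def
    by (rule bounded_linear_Blinfun_apply) (rule has_derivative_bounded_linear[OF smooth_on_has_derivative[OF assms that]])
  then show "(f has_derivative blinfun_apply (f' u)) (at u)" if "u \<in> S" for u
    using smooth_on_has_derivative[OF assms that] that by simp
  show "continuous_on S f'"
  proof (rule continuous_on_blinfun_componentwise)
    fix b :: 'a
    have "continuous_on S (\<lambda>u. frechet_derivative f (at u) b)"
      by (intro smooth_on_continuous smooth_on_derivative assms)
    then show "continuous_on S (\<lambda>u. blinfun_apply (f' u) b)"
      by (rule continuous_on_eq) (simp add: f')
  qed
qed

text \<open>The equation \<open>dF = F \<theta>\<close> without an initial condition; \<open>F\<close> need not be square. It says that \<open>F\<close> is parallel for right
multiplication by \<open>\<theta>\<close>.\<close>

definition solves_on ::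
  "(real^'n::finite) set \<Rightarrow> (real^'n \<Rightarrow> real^'n \<Rightarrow> complex^'m::finite^'m) \<Rightarrow> (real^'n \<Rightarrow> complex^'m^'l::finite) \<Rightarrow> bool" where
  "solves_on \<Omega> \<theta> F \<longleftrightarrow> (\<forall>u\<in>\<Omega>. (F has_derivative (\<lambda>v. F u ** \<theta> u v)) (at u))"

text \<open>Writing the connection in terms of the coefficients of the form makes it visibly smooth as a map into a space of
bounded linear maps.\<close>

definition right_mult_connection ::
  "(real^'n::finite \<Rightarrow> real^'n \<Rightarrow> complex^'m::finite^'m) \<Rightarrow> real^'n \<Rightarrow>
    (real^'n) \<Rightarrow>\<^sub>L ((complex^'m^'l::finite) \<Rightarrow>\<^sub>L (complex^'m^'l))" where
  "right_mult_connection \<theta> u =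
    (\<Sum>i\<in>UNIV. blinfun_scaleR_left (matrix_mult.prod_left (\<theta> u (axis i 1))) o\<^sub>L blinfun_inner_right (axis i 1))"

lemma right_mult_connection_apply:
  assumes "linear (\<theta> u)"
  shows "right_mult_connection \<theta> u v S = S ** \<theta> u v"
proof -
  have "\<theta> u v = \<theta> u (\<Sum>i\<in>UNIV. (v $ i) *\<^sub>R axis i 1)"
    by (simp add: basis_expansion scalar_mult_eq_scaleR[symmetric])
  also have "\<dots> = (\<Sum>i\<in>UNIV. (v $ i) *\<^sub>R \<theta> u (axis i 1))"
    by (simp add: linear_sum[OF assms] linear_scale[OF assms])
  finally show ?thesis
    by (simp add: right_mult_connection_def blinfun.sum_left matrix_mult.sum_right matrix_mult.scaleR_right
        inner_axis' blinfun.scaleR_left)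
qed

lemma smooth_on_right_mult_connection:
  fixes \<theta> :: "real^'n::finite \<Rightarrow> real^'n \<Rightarrow> complex^'m::finite^'m"
  assumes "open \<Omega>" "\<And>v. smooth_on \<Omega> (\<lambda>u. \<theta> u v)"
  shows "smooth_on \<Omega> (right_mult_connection \<theta> :: (real^'n) \<Rightarrow> (real^'n) \<Rightarrow>\<^sub>L ((complex^'m^'l::finite) \<Rightarrow>\<^sub>L (complex^'m^'l)))"
proof -
  have "bounded_linear (\<lambda>M::complex^'m^'m. blinfun_scaleR_left (matrix_mult.prod_left M :: (complex^'m^'l) \<Rightarrow>\<^sub>L (complex^'m^'l))
      o\<^sub>L blinfun_inner_right (axis i 1))" for i
    by (intro bounded_linear_intros bounded_linear_compose[OF bounded_bilinear.bounded_linear_left[OF bounded_bilinear_blinfun_compose]]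
        bounded_linear_compose[OF bounded_linear_blinfun_scaleR_left] matrix_mult.bounded_linear_prod_left)
  from smooth_on_bounded_linear[OF assms(1) this assms(2)]
  show ?thesis
    unfolding right_mult_connection_def[abs_def] by (intro smooth_on_sum assms) auto
qed

lemma solves_on_iff_parallel_on:
  assumes "\<And>u. u \<in> \<Omega> \<Longrightarrow> linear (\<theta> u)"
  shows "solves_on \<Omega> \<theta> F \<longleftrightarrow> parallel_on (right_mult_connection \<theta>) \<Omega> F"
  unfolding solves_on_def parallel_on_def using assms by (simp add: right_mult_connection_apply)

lemma matrix_inv_right: "invertible A \<Longrightarrow> A ** matrix_inv A = mat 1"
  and matrix_inv_left: "invertible A \<Longrightarrow> matrix_inv A ** A = mat 1"
  unfolding invertible_def matrix_inv_def by (metis (mono_tags, lifting) someI_ex)+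

locale matrix_form =
  fixes \<Omega> :: "(real^'n::finite) set" and \<theta> :: "real^'n \<Rightarrow> real^'n \<Rightarrow> complex^'m::finite^'m"
  assumes open_domain: "open \<Omega>" and connected_domain: "connected \<Omega>"
    and form_linear: "\<And>u. u \<in> \<Omega> \<Longrightarrow> linear (\<theta> u)"
    and form_smooth: "\<And>v. smooth_on \<Omega> (\<lambda>u. \<theta> u v)"
begin

lemma solution_unique:
  fixes F G :: "real^'n \<Rightarrow> complex^'m^'l::finite"
  assumes "solves_on \<Omega> \<theta> F" "solves_on \<Omega> \<theta> G" "x \<in> \<Omega>" "F x = G x" "u \<in> \<Omega>"
  shows "F u = G u"
  using assms parallel_unique[OF open_domain connected_domain
      smooth_on_continuous[OF smooth_on_right_mult_connection[of \<Omega> \<theta>, OF open_domain form_smooth]]]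
  by (simp add: solves_on_iff_parallel_on[OF form_linear])

lemma solution_exists:
  fixes m :: "complex^'m^'l::finite"
  assumes sc: "simply_connected \<Omega>" and a: "a \<in> \<Omega>" and flat: "flat_form_on \<Omega> \<theta>"
  obtains F where "F a = m" "solves_on \<Omega> \<theta> F"
proof -
  let ?\<omega> = "right_mult_connection \<theta> :: real^'n \<Rightarrow> (real^'n) \<Rightarrow>\<^sub>L ((complex^'m^'l) \<Rightarrow>\<^sub>L (complex^'m^'l))"
  have sm: "smooth_on \<Omega> ?\<omega>"
    by (rule smooth_on_right_mult_connection[of \<Omega> \<theta>, OF open_domain form_smooth])
  obtain \<omega>' where der: "\<And>u. u \<in> \<Omega> \<Longrightarrow> (?\<omega> has_derivative blinfun_apply (\<omega>' u)) (at u)"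
    and cont: "continuous_on \<Omega> \<omega>'"
    by (rule smooth_on_blinfun_derivative[OF sm]) (rule that)
  have \<omega>': "\<omega>' u v w S = S ** frechet_derivative (\<lambda>p. \<theta> p w) (at u) v" if u: "u \<in> \<Omega>" for u v w S
  proof -
    have "((\<lambda>p. ?\<omega> p w S) has_derivative (\<lambda>v. \<omega>' u v w S)) (at u)"
      by (intro bounded_linear.has_derivative[OF _ der[OF u]] bounded_linear_intros)
    moreover have "((\<lambda>p. S ** \<theta> p w) has_derivative (\<lambda>v. S ** frechet_derivative (\<lambda>p. \<theta> p w) (at u) v)) (at u)"
      by (intro bounded_linear.has_derivative[OF matrix_mult.bounded_linear_right] smooth_on_has_derivative[OF form_smooth u])
    then have "((\<lambda>p. ?\<omega> p w S) has_derivative (\<lambda>v. S ** frechet_derivative (\<lambda>p. \<theta> p w) (at u) v)) (at u)"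
      by (rule has_derivative_transform_within_open[OF _ open_domain u])
        (simp add: right_mult_connection_apply form_linear)
    ultimately show ?thesis by (metis has_derivative_unique)
  qed
  have fl: "\<omega>' u v w + (?\<omega> u w o\<^sub>L ?\<omega> u v) = \<omega>' u w v + (?\<omega> u v o\<^sub>L ?\<omega> u w)" if u: "u \<in> \<Omega>" for u v w
  proof (rule blinfun_eqI)
    fix S
    have "frechet_derivative (\<lambda>p. \<theta> p w) (at u) v + \<theta> u v ** \<theta> u w
        = frechet_derivative (\<lambda>p. \<theta> p v) (at u) w + \<theta> u w ** \<theta> u v"
      using flat u by (simp add: flat_form_on_def ext_deriv_def wedge_self_def algebra_simps)
    from arg_cong[OF this, of "\<lambda>M. S ** M"]
    show "(\<omega>' u v w + (?\<omega> u w o\<^sub>L ?\<omega> u v)) S = (\<omega>' u w v + (?\<omega> u v o\<^sub>L ?\<omega> u w)) S"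
      by (simp add: blinfun.add_left \<omega>' u right_mult_connection_apply form_linear matrix_mult.add_right matrix_mul_assoc)
  qed
  obtain F where "F a = m" "parallel_on ?\<omega> \<Omega> F"
    by (rule parallel_exists_simply_connected[OF open_domain sc a der cont fl, of m]) (assumption | rule that)+
  then show thesis using that by (simp add: solves_on_iff_parallel_on[OF form_linear])
qed

lemma solution_smooth:
  fixes F :: "real^'n \<Rightarrow> complex^'m^'l::finite"
  assumes F: "solves_on \<Omega> \<theta> F"
  shows "smooth_on \<Omega> F"
  unfolding smooth_on_def
proof
  fix k show "Ck_on k \<Omega> F"
  proof (induction k)
    case 0
    then show ?case using F unfolding solves_on_def
      by (auto intro!: continuous_at_imp_continuous_on has_derivative_continuous)
  next
    case (Suc k)
    show ?case
    proof (rule Ck_on_SucI[OF open_domain])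
      show "(F has_derivative (\<lambda>v. F u ** \<theta> u v)) (at u)" if "u \<in> \<Omega>" for u
        using F that by (simp add: solves_on_def)
      show "Ck_on k \<Omega> (\<lambda>u. F u ** \<theta> u v)" for v
        using form_smooth[of v] unfolding smooth_on_def
        by (intro Ck_on_bilinear[OF open_domain bounded_bilinear_matrix_mult] Suc) blast
    qed
  qed
qed

lemma left_mult_solution:
  fixes F :: "real^'n \<Rightarrow> complex^'m^'l::finite"
  assumes "solves_on \<Omega> \<theta> F"
  shows "solves_on \<Omega> \<theta> (\<lambda>u. C ** F u)"
  using assms unfolding solves_on_def
  by (auto intro!: derivative_eq_intros bounded_linear.has_derivative[OF matrix_mult.bounded_linear_right]
      simp: matrix_mul_assoc[symmetric])

text \<open>A linear dependence \<open>c\<close> between the rows of \<open>F u\<close> would persist on all of \<open>\<Omega>\<close>, because left multiples of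
solutions are solutions; but the rows of \<open>F a\<close> are independent.\<close>

lemma solution_invertible:
  fixes F :: "real^'n \<Rightarrow> complex^'m^'m"
  assumes F: "solves_on \<Omega> \<theta> F" and a: "a \<in> \<Omega>" "F a = mat 1" and u: "u \<in> \<Omega>"
  shows "invertible (F u)"
proof (rule ccontr)
  assume "\<not> invertible (F u)"
  then have "\<not> (\<exists>B. F u ** B = mat 1)"
    by (simp add: invertible_right_inverse)
  then obtain c where c: "\<exists>i. c i \<noteq> 0" "(\<Sum>i\<in>UNIV. c i *s row i (F u)) = 0"
    unfolding matrix_right_invertible_independent_rows by blast
  define C :: "complex^'m^'m" where "C = (\<chi> i j. c j)"
  have "C ** F u = 0"
    using c(2) by (simp add: C_def matrix_matrix_mult_def vec_eq_iff row_def sum_component)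
  moreover have "C ** F a = C" using a by simp
  ultimately have "C = C ** mat 0"
    using solution_unique[OF left_mult_solution[OF F, of C] left_mult_solution[OF F, of 0] u _ a(1)] a(2) by simp
  then show False using c(1) by (auto simp: C_def vec_eq_iff matrix_matrix_mult_def mat_def)
qed

lemma frame_solution_iff:
  assumes 0: "0 \<in> \<Omega>"
  shows "frame_solution_on \<Omega> \<theta> F \<longleftrightarrow> solves_on \<Omega> \<theta> F \<and> F 0 = mat 1"
proof safe
  assume F: "frame_solution_on \<Omega> \<theta> F"
  then show "F 0 = mat 1" by (simp add: frame_solution_on_def)
  show "solves_on \<Omega> \<theta> F"
    unfolding solves_on_def
  proof
    fix u assume u: "u \<in> \<Omega>"
    then have *: "F differentiable (at u)" "invertible (F u)"
      "\<And>v. matrix_inv (F u) ** frechet_derivative F (at u) v = \<theta> u v"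
      using F by (auto simp: frame_solution_on_def)
    have "F u ** \<theta> u v = frechet_derivative F (at u) v" for v
    proof -
      have "F u ** \<theta> u v = (F u ** matrix_inv (F u)) ** frechet_derivative F (at u) v"
        by (simp add: *(3)[symmetric] matrix_mul_assoc)
      then show ?thesis by (simp add: matrix_inv_right[OF *(2)])
    qed
    then show "(F has_derivative (\<lambda>v. F u ** \<theta> u v)) (at u)"
      using *(1)[unfolded frechet_derivative_works] by simp
  qed
next
  assume F: "solves_on \<Omega> \<theta> F" "F 0 = mat 1"
  have "matrix_inv (F u) ** frechet_derivative F (at u) v = \<theta> u v" if u: "u \<in> \<Omega>" for u v
  proof -
    have "frechet_derivative F (at u) = (\<lambda>v. F u ** \<theta> u v)"
      using frechet_derivative_at[of F "\<lambda>v. F u ** \<theta> u v" u] F(1) u unfolding solves_on_def by simp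
    then show ?thesis
      using matrix_inv_left[OF solution_invertible[OF F(1) 0 F(2) u]] by (simp add: matrix_mul_assoc)
  qed
  then show "frame_solution_on \<Omega> \<theta> F"
    using F solution_invertible[OF F(1) 0 F(2)] unfolding frame_solution_on_def solves_on_def
    by (auto simp: differentiable_def)
qed

lemma is_frameI:
  assumes "0 \<in> \<Omega>" "solves_on \<Omega> \<theta> F" "F 0 = mat 1"
  shows "is_frame_on \<Omega> \<theta> F"
  unfolding is_frame_on_def frame_solution_iff[OF assms(1)]
proof (intro conjI allI impI ballI)
  fix G u assume G: "solves_on \<Omega> \<theta> G \<and> G 0 = mat 1" and u: "u \<in> \<Omega>"
  show "G u = F u"
    by (rule solution_unique[OF conjunct1[OF G] assms(2,1) _ u]) (use G assms(3) in simp)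
qed (use assms solution_smooth[OF assms(2)] in auto)

end

section \<open>Flatness of the form of a flat Egoroff metric\<close>

lemma has_derivative_partial_sum:
  fixes f :: "real^'n::finite \<Rightarrow> 'b::real_normed_vector"
  assumes "(f has_derivative f') (at u)"
  shows "f' v = (\<Sum>i\<in>UNIV. (v $ i) *\<^sub>R partial i f u)"
proof -
  have lin: "linear f'" using assms by (rule has_derivative_linear)
  have "f' v = f' (\<Sum>i\<in>UNIV. (v $ i) *\<^sub>R axis i 1)"
    by (simp add: basis_expansion scalar_mult_eq_scaleR[symmetric])
  then show ?thesis
    by (simp add: linear_sum[OF lin] linear_scale[OF lin] partial_eqI[OF assms])
qed

lemma partial_mult:
  fixes f g :: "real^'n::finite \<Rightarrow> real"
  assumes "smooth_on S f" "smooth_on S g" "u \<in> S"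
  shows "partial i (\<lambda>p. f p * g p) u = f u * partial i g u + partial i f u * g u"
  using partial_eqI[OF has_derivative_mult[OF smooth_on_has_derivative[OF assms(1,3)] smooth_on_has_derivative[OF assms(2,3)]]]
  by (simp add: partial_def)

lemma partial_divide:
  fixes f g :: "real^'n::finite \<Rightarrow> real"
  assumes "smooth_on S f" "smooth_on S g" "u \<in> S" "g u \<noteq> 0"
  shows "partial i (\<lambda>p. f p / g p) u = (partial i f u * g u - f u * partial i g u) / (g u * g u)"
  using partial_eqI[OF has_derivative_divide'[OF smooth_on_has_derivative[OF assms(1,3)] smooth_on_has_derivative[OF assms(2,3)] assms(4)]]
  by (simp add: partial_def)

lemma partial_const: "partial i (\<lambda>p. c) u = 0"
  by (simp add: partial_def)

lemma matrix_inv_eqI: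
  fixes A :: "'a::semiring_1^'n::finite^'n"
  assumes "A ** B = mat 1" "B ** A = mat 1"
  shows "matrix_inv A = B"
proof -
  have "invertible A" using assms by (auto simp: invertible_def)
  then have "matrix_inv A = matrix_inv A ** (A ** B)" by (simp add: assms)
  then show ?thesis
    by (simp add: matrix_mul_assoc matrix_inv_left[OF \<open>invertible A\<close>])
qed

lemma delta_nth: "delta v $ l $ k = (if l = k then of_real (v $ l) else 0)"
  by (simp add: delta_def)

lemma delta_mult_nth: "(delta v *v x) $ l = of_real (v $ l) * x $ l"
  by (simp add: matrix_vector_mult_def delta_def if_distrib[where f = "\<lambda>x. x * _"] cong: if_cong)

lemma sum_option: "(\<Sum>a\<in>UNIV. f a) = f None + (\<Sum>i\<in>UNIV. f (Some i))" for f :: "'k::finite option \<Rightarrow> 'b::comm_monoid_add"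
  by (simp add: UNIV_option_conv sum.reindex)

locale egoroff =
  fixes \<Omega> :: "(real^'n::finite) set" and \<phi> :: "real^'n \<Rightarrow> real" and h :: "real^'n \<Rightarrow> real^'n"
  assumes open_\<Omega>: "open \<Omega>" and egoroff_metric: "flat_egoroff_metric_on \<Omega> \<phi> h"
begin

definition \<beta> :: "'n \<Rightarrow> 'n \<Rightarrow> real^'n \<Rightarrow> real" where "\<beta> l k u = rotation_coeff h u $ l $ k"

abbreviation H :: "'n \<Rightarrow> real^'n \<Rightarrow> real" where "H i \<equiv> (\<lambda>p. h p $ i)"

lemma smooth_\<phi>: "smooth_on \<Omega> \<phi>"
  using egoroff_metric by (simp add: flat_egoroff_metric_on_def)

lemma smooth_h: "smooth_on \<Omega> h"
  using egoroff_metric by (simp add: flat_egoroff_metric_on_def)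

lemma smooth_H: "smooth_on \<Omega> (H i)"
  by (rule smooth_on_nth[OF open_\<Omega> smooth_h])

lemma H_nonzero: "u \<in> \<Omega> \<Longrightarrow> h u $ i \<noteq> 0"
  using egoroff_metric by (simp add: flat_egoroff_metric_on_def)

lemma partial_\<phi>: "u \<in> \<Omega> \<Longrightarrow> partial i \<phi> u = (h u $ i)\<^sup>2"
  using egoroff_metric by (simp add: flat_egoroff_metric_on_def)

lemma \<beta>_eq: "\<beta> l k u = (if l = k then 0 else partial k (H l) u / h u $ k)"
  by (simp add: \<beta>_def rotation_coeff_def)

lemma smooth_\<beta>: "smooth_on \<Omega> (\<beta> l k)"
  unfolding \<beta>_eq[abs_def]
  by (cases "l = k") (auto intro!: smooth_on_const smooth_on_divide smooth_on_partial smooth_H open_\<Omega> H_nonzero)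

lemma partial_H_sq: "u \<in> \<Omega> \<Longrightarrow> partial j (\<lambda>p. (h p $ i)\<^sup>2) u = 2 * h u $ i * partial j (H i) u"
  unfolding power2_eq_square by (simp add: partial_mult[OF smooth_H smooth_H])

text \<open>Twice each side is a mixed second derivative of the potential.\<close>

lemma partial_H_sym:
  assumes u: "u \<in> \<Omega>"
  shows "h u $ i * partial j (H i) u = h u $ j * partial i (H j) u"
proof -
  have 1: "partial j (partial i \<phi>) u = 2 * (h u $ i * partial j (H i) u)" for i j
    using partial_cong[OF open_\<Omega> u, of "partial i \<phi>" "\<lambda>p. (h p $ i)\<^sup>2" j] partial_\<phi> partial_H_sq[OF u]
    by simp
  have "partial j (partial i \<phi>) u = partial i (partial j \<phi>) u"
    using symmetric_second_derivative[OF open_\<Omega> smooth_\<phi> u, of "axis i 1" "axis j 1"]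
    by (simp add: partial_def[abs_def])
  then show ?thesis unfolding 1 by simp
qed

lemma \<beta>_sym: "u \<in> \<Omega> \<Longrightarrow> \<beta> l k u = \<beta> k l u"
  using partial_H_sym[of u l k] H_nonzero[of u] by (simp add: \<beta>_eq field_simps)

lemma partial_H:
  "u \<in> \<Omega> \<Longrightarrow> l \<noteq> k \<Longrightarrow> partial k (H l) u = \<beta> l k u * h u $ k"
  using H_nonzero by (simp add: \<beta>_eq)

text \<open>The entries of \<open>[\<delta>, \<beta>]\<close> on the tangent vector \<open>v\<close>.\<close>

definition W :: "real^'n \<Rightarrow> 'n \<Rightarrow> 'n \<Rightarrow> real^'n \<Rightarrow> real" where
  "W v l k u = (v $ l - v $ k) * \<beta> l k u"

lemma smooth_W: "smooth_on \<Omega> (W v l k)"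
  unfolding W_def by (intro smooth_on_mult smooth_on_const smooth_\<beta> open_\<Omega>)

lemma W_antisym: "u \<in> \<Omega> \<Longrightarrow> W v k l u = - W v l k u"
  by (simp add: W_def \<beta>_sym[of u k l] algebra_simps)

lemma matrix_inv_diag_metric:
  assumes u: "u \<in> \<Omega>"
  shows "matrix_inv (diag_metric h u) = (\<chi> i j. if i = j then 1 / (h u $ i)\<^sup>2 else 0)"
  using H_nonzero[OF u]
  by (intro matrix_inv_eqI)
    (simp_all add: vec_eq_iff matrix_matrix_mult_def diag_metric_def mat_def if_distrib[where f = "\<lambda>x. x * _"]
      if_distrib[where f = "\<lambda>x. _ * x"] cong: if_cong)

text \<open>The Levi-Civita connection in the coordinate frame is obtained from \<open>[\<delta>, \<beta>]\<close> by the gauge transformation with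
\<open>diag(h)\<close>.\<close>

lemma christoffel_gauge:
  assumes u: "u \<in> \<Omega>"
  shows "christoffel (diag_metric h) l i k u =
    W (axis i 1) l k u * (h u $ k / h u $ l) + (if l = k then partial i (H k) u / h u $ k else 0)"
proof -
  have g: "partial i (\<lambda>p. diag_metric h p $ k $ l) u = (if k = l then 2 * h u $ k * partial i (H k) u else 0)" for i k l
    using partial_H_sq[OF u] by (simp add: diag_metric_def partial_const)
  have "christoffel (diag_metric h) l i k u = (1 / (2 * (h u $ l)\<^sup>2)) *
     (partial i (\<lambda>p. diag_metric h p $ k $ l) u + partial k (\<lambda>p. diag_metric h p $ i $ l) u
       - partial l (\<lambda>p. diag_metric h p $ i $ k) u)"
    by (simp add: christoffel_def matrix_inv_diag_metric[OF u] if_distrib[where f = "\<lambda>x. x * _"] cong: if_cong)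
  also have "\<dots> = W (axis i 1) l k u * (h u $ k / h u $ l) + (if l = k then partial i (H k) u / h u $ k else 0)"
    unfolding g using H_nonzero[OF u] partial_H_sym[OF u, of l k]
    by (auto simp: W_def \<beta>_eq axis_def field_simps power2_eq_square)
  finally show ?thesis .
qed

text \<open>Off the diagonal, the left-hand side is the curvature of the metric divided by \<open>h\<^sub>k / h\<^sub>l\<close>, as curvature is conjugated by a gauge
transformation. On the diagonal it vanishes because \<open>W\<close> is skew-symmetric.\<close>

lemma structure_equation_axis:
  assumes u: "u \<in> \<Omega>"
  shows "partial i (W (axis j 1) l k) u - partial j (W (axis i 1) l k) u
    + (\<Sum>m\<in>UNIV. W (axis i 1) l m u * W (axis j 1) m k u - W (axis j 1) l m u * W (axis i 1) m k u) = 0"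
proof (cases "l = k")
  case True
  have "W v k k = (\<lambda>u. 0)" for v by (simp add: W_def fun_eq_iff)
  moreover have "W v k m u * W w m k u - W w k m u * W v m k u = 0" for m v w
    using W_antisym[OF u, of v m k] W_antisym[OF u, of w m k] by simp
  ultimately show ?thesis by (simp add: True partial_const)
next
  case False
  let ?\<Gamma> = "christoffel (diag_metric h)"
  define r where "r = h u $ k / h u $ l"
  have r0: "r \<noteq> 0" using H_nonzero[OF u] by (simp add: r_def)
  \<comment> \<open>The diagonal part of the gauge transformation; it contributes to the derivative and to the quadratic part of the curvature, and the contributions cancel.\<close>
  define c where "c = (\<lambda>i k. partial i (H k) u / h u $ k)"
  have d\<Gamma>: "partial i (?\<Gamma> l j k) u = partial i (W (axis j 1) l k) u * r + W (axis j 1) l k u * (c i k - c i l) * r" for i j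
  proof -
    have "partial i (?\<Gamma> l j k) u = partial i (\<lambda>p. W (axis j 1) l k p * (h p $ k / h p $ l)) u"
      by (rule partial_cong[OF open_\<Omega> u]) (use False in \<open>simp add: christoffel_gauge\<close>)
    also have "\<dots> = W (axis j 1) l k u * partial i (\<lambda>p. h p $ k / h p $ l) u + partial i (W (axis j 1) l k) u * r"
      unfolding r_def
      by (rule partial_mult[OF smooth_W smooth_on_divide[OF open_\<Omega> smooth_H smooth_H H_nonzero] u])
    also have "partial i (\<lambda>p. h p $ k / h p $ l) u = (c i k - c i l) * r"
      unfolding partial_divide[OF smooth_H smooth_H u H_nonzero[OF u]]
      using H_nonzero[OF u] by (simp add: c_def r_def field_simps)
    finally show ?thesis by (simp add: algebra_simps)
  qed
  have quad: "(\<Sum>m\<in>UNIV. ?\<Gamma> l i m u * ?\<Gamma> m j k u) =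
      r * (\<Sum>m\<in>UNIV. W (axis i 1) l m u * W (axis j 1) m k u)
      + c i l * W (axis j 1) l k u * r + W (axis i 1) l k u * r * c j k" for i j
  proof -
    have "?\<Gamma> l i m u * ?\<Gamma> m j k u = r * (W (axis i 1) l m u * W (axis j 1) m k u)
      + (if l = m then c i l * W (axis j 1) l k u * r else 0) + (if m = k then W (axis i 1) l k u * r * c j k else 0)" for m
      using False H_nonzero[OF u]
      by (auto simp: christoffel_gauge[OF u] c_def r_def field_simps W_def)
    then show ?thesis by (simp add: sum.distrib sum_distrib_left)
  qed
  have "0 = riemann_curvature (diag_metric h) l k i j u"
    using egoroff_metric u by (simp add: flat_egoroff_metric_on_def flat_metric_on_def)
  also have "\<dots> = r * (partial i (W (axis j 1) l k) u - partial j (W (axis i 1) l k) u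
    + (\<Sum>m\<in>UNIV. W (axis i 1) l m u * W (axis j 1) m k u - W (axis j 1) l m u * W (axis i 1) m k u))"
    unfolding riemann_curvature_def sum_subtractf d\<Gamma> quad by (simp add: algebra_simps)
  finally show ?thesis using r0 by simp
qed

definition D :: "(real^'n \<Rightarrow> real) \<Rightarrow> real^'n \<Rightarrow> real^'n \<Rightarrow> real" where
  "D f u v = frechet_derivative f (at u) v"

lemma D_W: "u \<in> \<Omega> \<Longrightarrow> D (W w l k) u v = (w $ l - w $ k) * D (\<beta> l k) u v"
  using frechet_derivative_at[OF has_derivative_mult_right[OF smooth_on_has_derivative[OF smooth_\<beta>]]]
  by (simp add: D_def W_def[abs_def] fun_eq_iff)

lemma D_linear: "smooth_on \<Omega> f \<Longrightarrow> u \<in> \<Omega> \<Longrightarrow> linear (D f u)"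
  unfolding D_def[abs_def] by (rule has_derivative_linear[OF smooth_on_has_derivative])

text \<open>The left-hand side is bilinear in \<open>v\<close> and \<open>w\<close>, so that it suffices to know the equation on the coordinate vectors.\<close>

lemma structure_equation:
  assumes u: "u \<in> \<Omega>"
  shows "(w $ l - w $ k) * D (\<beta> l k) u v - (v $ l - v $ k) * D (\<beta> l k) u w
    + (\<Sum>m\<in>UNIV. W v l m u * W w m k u - W w l m u * W v m k u) = 0"
proof -
  let ?K = "\<lambda>v w. (w $ l - w $ k) * D (\<beta> l k) u v - (v $ l - v $ k) * D (\<beta> l k) u w
    + (\<Sum>m\<in>UNIV. W v l m u * W w m k u - W w l m u * W v m k u)"
  note lin = D_linear[OF smooth_\<beta> u]
  have Wadd: "W (x + y) l k u = W x l k u + W y l k u" for x y l k by (simp add: W_def algebra_simps)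
  have Wsc: "W (c *\<^sub>R x) l k u = c * W x l k u" for c x l k by (simp add: W_def algebra_simps)
  have lw: "linear (?K v)" for v
    by (rule linearI) (simp_all add: Wadd Wsc linear_add[OF lin] linear_scale[OF lin] algebra_simps
        sum.distrib sum_subtractf sum_distrib_left)
  have lv: "linear (\<lambda>v. ?K v w)" for w
    by (rule linearI) (simp_all add: Wadd Wsc linear_add[OF lin] linear_scale[OF lin] algebra_simps
        sum.distrib sum_subtractf sum_distrib_left)
  have ax: "?K (axis i 1) (axis j 1) = 0" for i j
    using structure_equation_axis[OF u, of i j l k]
    unfolding partial_def D_def[symmetric] D_W[OF u] by simp
  have ax': "?K (axis i 1) w = 0" for i w
  proof -
    have "?K (axis i 1) = (\<lambda>w. 0)"
      by (rule linear_eq_stdbasis[OF lw linear_zero]) (use ax in \<open>auto simp: Basis_vec_def\<close>)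
    then show ?thesis by (rule fun_cong)
  qed
  have "(\<lambda>v. ?K v w) = (\<lambda>v. 0)"
    by (rule linear_eq_stdbasis[OF lv linear_zero]) (use ax' in \<open>auto simp: Basis_vec_def\<close>)
  then show ?thesis by (rule fun_cong)
qed

text \<open>As \<open>\<beta>\<close> vanishes on the diagonal, the derivative of \<open>h\<^sub>l\<close> in its own direction is a separate term. It drops out of the
flatness equation, where it comes with the symmetric factor \<open>v\<^sub>l w\<^sub>l\<close>.\<close>

lemma D_H:
  assumes u: "u \<in> \<Omega>"
  shows "D (H l) u v = v $ l * partial l (H l) u + (\<Sum>m\<in>UNIV. \<beta> l m u * h u $ m * v $ m)"
proof -
  have "D (H l) u v = (\<Sum>m\<in>UNIV. v $ m * partial m (H l) u)"
    using has_derivative_partial_sum[OF smooth_on_has_derivative[OF smooth_H u]] by (simp add: D_def)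
  also have "\<dots> = (\<Sum>m\<in>UNIV. (if l = m then v $ l * partial l (H l) u else 0) + \<beta> l m u * h u $ m * v $ m)"
    using partial_H[OF u] by (intro sum.cong) (auto simp: \<beta>_eq)
  finally show ?thesis by (simp add: sum.distrib)
qed

lemma w_form_nth:
  "w_form (rotation_coeff h) lam u v $ l $ k =
    (if l = k then \<i> * lam * of_real (v $ l) else 0) + of_real (W v l k u)"
proof -
  have 1: "(delta v ** complex_mat (rotation_coeff h u)) $ l $ k = of_real (v $ l * \<beta> l k u)"
    by (simp add: matrix_matrix_mult_def delta_def complex_mat_def \<beta>_def if_distrib[where f = "\<lambda>x. x * _"] cong: if_cong)
  have 2: "(complex_mat (rotation_coeff h u) ** delta v) $ l $ k = of_real (\<beta> l k u * v $ k)"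
    by (simp add: matrix_matrix_mult_def delta_def complex_mat_def \<beta>_def if_distrib[where f = "\<lambda>x. _ * x"] cong: if_cong)
  show ?thesis
    unfolding w_form_def by (simp add: 1 2 delta_nth W_def algebra_simps)
qed

lemma theta_form_nth:
  "theta_form h lam u v $ Some l $ Some k = (if l = k then \<i> * lam * of_real (v $ l) else 0) + of_real (W v l k u)"
  "theta_form h lam u v $ Some l $ None = of_real (v $ l * h u $ l)"
  "theta_form h lam u v $ None $ b = 0"
  by (simp_all add: theta_form_def block_mat_def w_form_nth delta_mult_nth complex_vec_def split: option.split)

lemma W_linear: "linear (\<lambda>v. W v l k u)"
  by (rule linearI) (simp_all add: W_def algebra_simps)

lemma theta_form_linear: "linear (theta_form h lam u)"
proof (rule linearI)
  have "theta_form h lam u (x + y) $ a $ b = theta_form h lam u x $ a $ b + theta_form h lam u y $ a $ b" for x y a b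
    by (cases a; cases b) (simp_all add: theta_form_nth linear_add[OF W_linear] algebra_simps)
  then show "theta_form h lam u (x + y) = theta_form h lam u x + theta_form h lam u y" for x y
    by (simp add: vec_eq_iff)
  have "theta_form h lam u (c *\<^sub>R x) $ a $ b = c *\<^sub>R (theta_form h lam u x $ a $ b)" for c x a b
    by (cases a; cases b) (simp_all add: theta_form_nth linear_scale[OF W_linear] scaleR_conv_of_real[where 'a = complex] algebra_simps)
  then show "theta_form h lam u (c *\<^sub>R x) = c *\<^sub>R theta_form h lam u x" for c x
    by (simp add: vec_eq_iff)
qed

lemma w_form_linear: "linear (w_form (rotation_coeff h) lam u)"
  by (rule linearI) (simp_all add: vec_eq_iff w_form_nth linear_add[OF W_linear] linear_scale[OF W_linear]
      scaleR_conv_of_real[where 'a = complex] algebra_simps)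

lemma smooth_on_of_real: "smooth_on \<Omega> f \<Longrightarrow> smooth_on \<Omega> (\<lambda>u. complex_of_real (f u))"
  by (rule smooth_on_bounded_linear[OF open_\<Omega> bounded_linear_of_real])

lemma theta_form_smooth: "smooth_on \<Omega> (\<lambda>u. theta_form h lam u v)"
proof (intro smooth_on_vec open_\<Omega>)
  show "smooth_on \<Omega> (\<lambda>u. theta_form h lam u v $ a $ b)" for a b
    by (cases a; cases b)
      (auto simp: theta_form_nth intro!: smooth_on_add smooth_on_const smooth_on_of_real smooth_on_mult smooth_W smooth_H open_\<Omega>)
qed

lemma w_form_smooth: "smooth_on \<Omega> (\<lambda>u. w_form (rotation_coeff h) lam u v)"
  by (intro smooth_on_vec open_\<Omega>)
    (auto simp: w_form_nth intro!: smooth_on_add smooth_on_const smooth_on_of_real smooth_W open_\<Omega>)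

lemma frechet_derivative_theta_form:
  assumes u: "u \<in> \<Omega>"
  shows "frechet_derivative (\<lambda>p. theta_form h lam p w) (at u) v $ Some l $ Some k = of_real (D (W w l k) u v)"
    "frechet_derivative (\<lambda>p. theta_form h lam p w) (at u) v $ Some l $ None = of_real (w $ l * D (H l) u v)"
    "frechet_derivative (\<lambda>p. theta_form h lam p w) (at u) v $ None $ b = 0"
proof -
  have *: "((\<lambda>p. theta_form h lam p w $ a $ b) has_derivative
      (\<lambda>v. frechet_derivative (\<lambda>p. theta_form h lam p w) (at u) v $ a $ b)) (at u)" for a b
    by (intro bounded_linear.has_derivative[OF bounded_linear_vec_nth] smooth_on_has_derivative[OF theta_form_smooth u])
  have DW: "(W w l k has_derivative D (W w l k) u) (at u)"
    unfolding D_def[abs_def] by (rule smooth_on_has_derivative[OF smooth_W u])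
  have DH: "(H l has_derivative D (H l) u) (at u)"
    unfolding D_def[abs_def] by (rule smooth_on_has_derivative[OF smooth_H u])
  have "((\<lambda>p. theta_form h lam p w $ Some l $ Some k) has_derivative (\<lambda>v. of_real (D (W w l k) u v))) (at u)"
    unfolding theta_form_nth
    by (rule has_derivative_eq_rhs[OF has_derivative_add[OF has_derivative_const has_derivative_of_real[OF DW]]]) simp
  from has_derivative_unique[OF * this]
  show "frechet_derivative (\<lambda>p. theta_form h lam p w) (at u) v $ Some l $ Some k = of_real (D (W w l k) u v)"
    by (rule fun_cong)
  have "((\<lambda>p. theta_form h lam p w $ Some l $ None) has_derivative (\<lambda>v. of_real (w $ l * D (H l) u v))) (at u)"
    unfolding theta_form_nth by (intro has_derivative_of_real has_derivative_mult_right DH)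
  from has_derivative_unique[OF * this]
  show "frechet_derivative (\<lambda>p. theta_form h lam p w) (at u) v $ Some l $ None = of_real (w $ l * D (H l) u v)"
    by (rule fun_cong)
  have "((\<lambda>p. theta_form h lam p w $ None $ b) has_derivative (\<lambda>v. 0)) (at u)"
    unfolding theta_form_nth by (rule has_derivative_const)
  from has_derivative_unique[OF * this]
  show "frechet_derivative (\<lambda>p. theta_form h lam p w) (at u) v $ None $ b = 0"
    by (rule fun_cong)
qed

text \<open>Among square blocks the quadratic terms in \<open>\<lambda>\<close> cancel because diagonal matrices commute, the linear terms because
\<open>W v\<close> is a commutator with the diagonal matrix of \<open>v\<close>, and the others form the structure equation. The last column is
\<open>D_H\<close>.\<close>

lemma theta_form_flat: "flat_form_on \<Omega> (theta_form h lam)"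
  unfolding flat_form_on_def
proof (intro ballI allI)
  fix u v w assume u: "u \<in> \<Omega>"
  let ?\<theta> = "theta_form h lam u"
  let ?R = "ext_deriv (theta_form h lam) u v w + wedge_self (theta_form h lam) u v w"
  have prod: "(?\<theta> v ** ?\<theta> w) $ Some l $ b = (\<Sum>m\<in>UNIV. ?\<theta> v $ Some l $ Some m * ?\<theta> w $ Some m $ b)" for v w l b
    by (simp add: matrix_matrix_mult_def sum_option theta_form_nth)
  have prod1: "(?\<theta> v ** ?\<theta> w) $ Some l $ Some k = (if l = k then - lam\<^sup>2 * of_real (v $ l * w $ l) else 0)
    + \<i> * lam * of_real (v $ l * W w l k u + W v l k u * w $ k)
    + of_real (\<Sum>m\<in>UNIV. W v l m u * W w m k u)" for v w l k
  proof -
    have "?\<theta> v $ Some l $ Some m * ?\<theta> w $ Some m $ Some k =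
      (if l = m then (if l = k then - lam\<^sup>2 * of_real (v $ l * w $ l) else 0) + \<i> * lam * of_real (v $ l * W w l k u) else 0)
      + (if m = k then \<i> * lam * of_real (W v l k u * w $ k) else 0) + of_real (W v l m u * W w m k u)" for m
      by (auto simp: theta_form_nth algebra_simps power2_eq_square)
    then show ?thesis
      unfolding prod by (simp add: sum.distrib algebra_simps)
  qed
  have prod2: "(?\<theta> v ** ?\<theta> w) $ Some l $ None = \<i> * lam * of_real (v $ l * w $ l * h u $ l)
     + of_real (\<Sum>m\<in>UNIV. W v l m u * (w $ m * h u $ m))" for v w l
  proof -
    have "?\<theta> v $ Some l $ Some m * ?\<theta> w $ Some m $ None =
      (if l = m then \<i> * lam * of_real (v $ l * w $ l * h u $ l) else 0) + of_real (W v l m u * (w $ m * h u $ m))" for m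
      by (auto simp: theta_form_nth algebra_simps)
    then show ?thesis
      unfolding prod by (simp add: sum.distrib)
  qed
  have "?R $ Some l $ Some k = 0" for l k
  proof -
    have "?R $ Some l $ Some k = of_real ((w $ l - w $ k) * D (\<beta> l k) u v - (v $ l - v $ k) * D (\<beta> l k) u w
        + (\<Sum>m\<in>UNIV. W v l m u * W w m k u - W w l m u * W v m k u))
        + \<i> * lam * of_real ((v $ l * W w l k u + W v l k u * w $ k) - (w $ l * W v l k u + W w l k u * v $ k))"
      by (simp add: ext_deriv_def wedge_self_def frechet_derivative_theta_form[OF u] prod1 D_W[OF u] sum_subtractf algebra_simps)
    moreover have "(v $ l * W w l k u + W v l k u * w $ k) - (w $ l * W v l k u + W w l k u * v $ k) = 0"
      by (simp add: W_def algebra_simps)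
    ultimately show ?thesis by (simp only: structure_equation[OF u]) simp
  qed
  moreover have "?R $ Some l $ None = 0" for l
  proof -
    have "w $ l * D (H l) u v - v $ l * D (H l) u w
        + ((\<Sum>m\<in>UNIV. W v l m u * (w $ m * h u $ m)) - (\<Sum>m\<in>UNIV. W w l m u * (v $ m * h u $ m))) = 0"
      unfolding D_H[OF u] by (simp add: W_def sum_distrib_left sum_subtractf[symmetric] sum.distrib[symmetric] algebra_simps)
    moreover have "?R $ Some l $ None = of_real (w $ l * D (H l) u v - v $ l * D (H l) u w
        + ((\<Sum>m\<in>UNIV. W v l m u * (w $ m * h u $ m)) - (\<Sum>m\<in>UNIV. W w l m u * (v $ m * h u $ m))))"
      by (simp add: ext_deriv_def wedge_self_def frechet_derivative_theta_form[OF u] prod2 algebra_simps)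
    ultimately show ?thesis by simp
  qed
  moreover have "?R $ None $ b = 0" for b
    by (simp add: ext_deriv_def wedge_self_def frechet_derivative_theta_form[OF u] matrix_matrix_mult_def theta_form_nth)
  ultimately have "?R $ a $ b = 0" for a b
    by (cases a; cases b) auto
  then show "?R = 0" by (simp add: vec_eq_iff)
qed

end

section \<open>Holomorphic dependence on the parameter\<close>

definition complex_scale :: "complex \<Rightarrow> complex^'m::finite^'l::finite \<Rightarrow> complex^'m^'l" where
  "complex_scale c S = (\<chi> i j. c * S $ i $ j)"

lemma complex_scale_mult_left: "complex_scale c (S ** T) = complex_scale c S ** T"
  and complex_scale_mult_right: "complex_scale c (S ** T) = S ** complex_scale c T"
  by (simp_all add: complex_scale_def matrix_matrix_mult_def vec_eq_iff sum_distrib_left mult_ac)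

lemma norm_complex_scale: "norm (complex_scale c S) = norm c * norm S"
  by (simp add: complex_scale_def norm_vec_def norm_mult L2_set_right_distrib)

lemma bounded_linear_complex_scale: "bounded_linear (complex_scale c)"
proof (rule bounded_linear_intro[of _ "norm c"])
  show "norm (complex_scale c S) \<le> norm S * norm c" for S :: "complex^'a^'b"
    by (simp add: norm_complex_scale)
qed (simp_all add: complex_scale_def vec_eq_iff algebra_simps)

lemma complex_scale_simps:
  "complex_scale c (S + T) = complex_scale c S + complex_scale c T"
  "complex_scale c (S - T) = complex_scale c S - complex_scale c T"
  "complex_scale (c + d) S = complex_scale c S + complex_scale d S"
  "complex_scale (c - d) S = complex_scale c S - complex_scale d S"
  "c \<noteq> 0 \<Longrightarrow> complex_scale (inverse c) (complex_scale c S) = S"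
  "complex_scale c 0 = 0"
  by (simp_all add: complex_scale_def vec_eq_iff algebra_simps)

context matrix_form
begin

text \<open>The factor \<open>1/4\<close> leaves room for the sum of two such terms below the threshold \<open>1/2\<close> of the Gronwall estimate.\<close>

lemma right_mult_locally_small:
  assumes p: "p \<in> \<Omega>"
  obtains R where "R > 0" "ball p R \<subseteq> \<Omega>"
    "\<And>u z (S :: complex^'m^'l::finite). u \<in> ball p R \<Longrightarrow> norm z \<le> R \<Longrightarrow> norm (S ** \<theta> u z) \<le> norm S / 4"
proof -
  let ?\<omega> = "right_mult_connection \<theta> :: real^'n \<Rightarrow> (real^'n) \<Rightarrow>\<^sub>L ((complex^'m^'l) \<Rightarrow>\<^sub>L (complex^'m^'l))"
  have "continuous_on \<Omega> ?\<omega>"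
    by (rule smooth_on_continuous[OF smooth_on_right_mult_connection[of \<Omega> \<theta>, OF open_domain form_smooth]])
  from small_ball[OF open_domain p this]
  obtain R where R: "R > 0" "ball p R \<subseteq> \<Omega>" "\<And>u. u \<in> ball p R \<Longrightarrow> norm (?\<omega> u) * R \<le> 1/2"
    by blast
  have "norm (S ** \<theta> u z) \<le> norm S / 4" if u: "u \<in> ball p (R / 2)" and z: "norm z \<le> R / 2"
    for u z and S :: "complex^'m^'l"
  proof -
    have uR: "u \<in> ball p R" using u R(1) by auto
    then have "u \<in> \<Omega>" using R(2) by blast
    then have "S ** \<theta> u z = ?\<omega> u z S" by (simp add: right_mult_connection_apply form_linear)
    also have "norm \<dots> \<le> norm (?\<omega> u z) * norm S" by (rule norm_blinfun)
    also have "\<dots> \<le> (norm (?\<omega> u) * norm z) * norm S" by (intro mult_right_mono norm_blinfun) auto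
    also have "\<dots> \<le> (norm (?\<omega> u) * (R / 2)) * norm S" by (intro mult_right_mono mult_left_mono z) auto
    also have "\<dots> \<le> 1/4 * norm S" using R(3)[OF uR] by (intro mult_right_mono) (auto simp: mult.commute)
    finally show ?thesis by simp
  qed
  then show thesis
    using that[of "R / 2"] R(1,2) subset_ball[of "R / 2" R p] by auto
qed

lemma solution_along_segment:
  fixes F :: "real^'n \<Rightarrow> complex^'m^'l::finite"
  assumes "solves_on \<Omega> \<theta> F" "\<And>t. t \<in> {0..1} \<Longrightarrow> x + t *\<^sub>R z \<in> \<Omega>" "t \<in> {0..1}"
  shows "((\<lambda>t. F (x + t *\<^sub>R z)) has_vector_derivative F (x + t *\<^sub>R z) ** \<theta> (x + t *\<^sub>R z) z) (at t within {0..1})"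
  using parallel_along_segment[of "right_mult_connection \<theta>" \<Omega> F x z t] assms
  by (simp add: solves_on_iff_parallel_on form_linear right_mult_connection_apply)

end

text \<open>The difference quotient \<open>Q \<mu>\<close> at \<open>lam\<close> solves \<open>dQ = Q \<theta>(lam + \<mu>) + F(lam) B\<close>. Along a short segment, Gronwall's estimate first
bounds \<open>Q\<close> uniformly in \<open>\<mu>\<close>, and then bounds the change of \<open>Q \<mu> - Q \<nu>\<close> by a multiple of \<open>\<mu> - \<nu>\<close>. So the Cauchy condition for
\<open>\<mu> \<rightarrow> 0\<close>, called \<open>Z\<close> in the proof, spreads over the connected set \<open>\<Omega>\<close> from the point where all \<open>F(lam)\<close> coincide.\<close>

lemma affine_family_holomorphic:
  fixes \<theta> :: "complex \<Rightarrow> real^'n::finite \<Rightarrow> real^'n \<Rightarrow> complex^'m::finite^'m"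
    and F :: "complex \<Rightarrow> real^'n \<Rightarrow> complex^'m^'l::finite"
  assumes \<theta>: "\<And>lam. matrix_form \<Omega> (\<theta> lam)" and B: "matrix_form \<Omega> B"
    and aff: "\<And>lam \<mu> u v. u \<in> \<Omega> \<Longrightarrow> \<theta> (lam + \<mu>) u v = \<theta> lam u v + complex_scale \<mu> (B u v)"
    and F: "\<And>lam. solves_on \<Omega> (\<theta> lam) (F lam)" and a: "a \<in> \<Omega>" "\<And>lam. F lam a = M"
    and u: "u \<in> \<Omega>"
  shows "(\<lambda>lam. F lam u $ i $ j) holomorphic_on UNIV"
proof -
  interpret B: matrix_form \<Omega> B by fact
  have "\<exists>D. ((\<lambda>lam. F lam u $ i $ j) has_field_derivative D) (at lam)" for lam
  proof -
    interpret \<theta>: matrix_form \<Omega> "\<theta> lam" by (rule \<theta>)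
    define Q where "Q = (\<lambda>\<mu> x. complex_scale (inverse \<mu>) (F (lam + \<mu>) x - F lam x))"
    define Z where "Z = (\<lambda>x. \<forall>e>0. \<exists>d>0. \<forall>\<mu> \<nu>. \<mu> \<noteq> 0 \<longrightarrow> norm \<mu> < d \<longrightarrow> \<nu> \<noteq> 0 \<longrightarrow> norm \<nu> < d \<longrightarrow>
      norm (Q \<mu> x - Q \<nu> x) < e)"
    have step: "\<exists>T. openin (top_of_set \<Omega>) T \<and> p \<in> T \<and> (\<forall>x\<in>T. \<forall>y\<in>T. Z x \<longrightarrow> Z y)" if p: "p \<in> \<Omega>" for p
    proof -
      obtain R1 where R1: "R1 > 0" "ball p R1 \<subseteq> \<Omega>"
        "\<And>u z (S :: complex^'m^'l). u \<in> ball p R1 \<Longrightarrow> norm z \<le> R1 \<Longrightarrow> norm (S ** \<theta> lam u z) \<le> norm S / 4"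
        using \<theta>.right_mult_locally_small[OF p] by metis
      obtain R2 where R2: "R2 > 0" "ball p R2 \<subseteq> \<Omega>"
        "\<And>u z (S :: complex^'m^'l). u \<in> ball p R2 \<Longrightarrow> norm z \<le> R2 \<Longrightarrow> norm (S ** B u z) \<le> norm S / 4"
        using B.right_mult_locally_small[OF p] by metis
      define R where "R = min R1 R2"
      have R: "R > 0" "ball p R \<subseteq> \<Omega>" using R1 R2 by (auto simp: R_def)
      have ZZ: "Z y" if x: "x \<in> ball p (R / 2)" and y: "y \<in> ball p (R / 2)" and Zx: "Z x" for x y
      proof -
        define z where "z = y - x"
        have zR: "norm z \<le> R"
          using x y dist_triangle_half_r[of p y R x] by (simp add: z_def dist_norm norm_minus_commute)
        have seg: "x + t *\<^sub>R z \<in> ball p R" if "t \<in> {0..1}" for t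
        proof -
          have "x + t *\<^sub>R z = (1 - t) *\<^sub>R x + t *\<^sub>R y" by (simp add: z_def algebra_simps)
          moreover have "(1 - t) *\<^sub>R x + t *\<^sub>R y \<in> ball p (R / 2)"
            using convex_ball[of p "R / 2"] x y that by (auto simp: convex_alt)
          ultimately show ?thesis using R(1) by auto
        qed
        have seg\<Omega>: "x + t *\<^sub>R z \<in> \<Omega>" if "t \<in> {0..1}" for t using seg[OF that] R(2) by blast
        let ?c = "\<lambda>t. x + t *\<^sub>R z"
        have b\<theta>: "norm (S ** \<theta> lam (?c t) z) \<le> norm S / 4" if "t \<in> {0..1}" for t and S :: "complex^'m^'l"
          using R1(3)[of "?c t" z S] seg[OF that] zR by (auto simp: R_def)
        have bB: "norm (S ** B (?c t) z) \<le> norm S / 4" if "t \<in> {0..1}" for t and S :: "complex^'m^'l"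
          using R2(3)[of "?c t" z S] seg[OF that] zR by (auto simp: R_def)
        have b\<theta>\<mu>: "norm (S ** \<theta> (lam + \<mu>) (?c t) z) \<le> norm S / 2" if "t \<in> {0..1}" "norm \<mu> < 1" for t \<mu> and S :: "complex^'m^'l"
        proof -
          have "norm (S ** \<theta> (lam + \<mu>) (?c t) z) \<le> norm (S ** \<theta> lam (?c t) z) + norm \<mu> * norm (S ** B (?c t) z)"
            unfolding aff[OF seg\<Omega>[OF that(1)]] matrix_mult.add_right complex_scale_mult_right[symmetric]
            by (rule order_trans[OF norm_triangle_ineq]) (simp add: norm_complex_scale)
          also have "norm \<mu> * norm (S ** B (?c t) z) \<le> 1 * (norm S / 4)"
            using that bB[OF that(1)] by (intro mult_mono) auto
          finally show ?thesis using b\<theta>[OF that(1), of S] by simp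
        qed
        have F_bound: "norm (F lam (?c t)) \<le> 2 * norm (F lam x)" if t: "t \<in> {0..1}" for t
        proof -
          have "norm (F lam (?c t)) \<le> 2 * (norm (F lam (?c 0)) + 0)"
          proof (rule gronwall_unit_interval[OF \<theta>.solution_along_segment[OF F seg\<Omega>] _ t])
            show "norm (F lam (?c t) ** \<theta> lam (?c t) z) \<le> norm (F lam (?c t)) / 2 + 0" if "t \<in> {0..1}" for t
              using b\<theta>[OF that, of "F lam (?c t)"] norm_ge_zero[of "F lam (?c t)"] by linarith
          qed
          then show ?thesis by simp
        qed
        have Q': "((\<lambda>t. Q \<mu> (?c t)) has_vector_derivative Q \<mu> (?c t) ** \<theta> (lam + \<mu>) (?c t) z + F lam (?c t) ** B (?c t) z)
            (at t within {0..1})" if t: "t \<in> {0..1}" and \<mu>: "\<mu> \<noteq> 0" for t \<mu>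
        proof -
          interpret \<theta>\<mu>: matrix_form \<Omega> "\<theta> (lam + \<mu>)" by (rule \<theta>)
          have "((\<lambda>t. Q \<mu> (?c t)) has_vector_derivative complex_scale (inverse \<mu>)
              (F (lam + \<mu>) (?c t) ** \<theta> (lam + \<mu>) (?c t) z - F lam (?c t) ** \<theta> lam (?c t) z)) (at t within {0..1})"
            unfolding Q_def
            by (intro bounded_linear.has_vector_derivative[OF bounded_linear_complex_scale] has_vector_derivative_diff
                \<theta>\<mu>.solution_along_segment[OF F seg\<Omega> t] \<theta>.solution_along_segment[OF F seg\<Omega> t])
          moreover have "F (lam + \<mu>) (?c t) ** \<theta> (lam + \<mu>) (?c t) z - F lam (?c t) ** \<theta> lam (?c t) z
              = (F (lam + \<mu>) (?c t) - F lam (?c t)) ** \<theta> (lam + \<mu>) (?c t) z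
                + complex_scale \<mu> (F lam (?c t) ** B (?c t) z)"
            unfolding aff[OF seg\<Omega>[OF t]]
            by (simp add: matrix_mult.add_right matrix_mult.diff_left complex_scale_mult_right)
          ultimately show ?thesis
            using \<mu> by (simp add: complex_scale_simps complex_scale_mult_left Q_def)
        qed
        have Q_bound: "norm (Q \<mu> (?c t)) \<le> 2 * (norm (Q \<mu> x) + norm (F lam x))"
          if t: "t \<in> {0..1}" and \<mu>: "\<mu> \<noteq> 0" "norm \<mu> < 1" for t \<mu>
        proof -
          have "norm (Q \<mu> (?c t)) \<le> 2 * (norm (Q \<mu> (?c 0)) + norm (F lam x))"
          proof (rule gronwall_unit_interval[OF Q'[OF _ \<mu>(1)] _ t])
            fix t :: real assume t: "t \<in> {0..1}"
            show "norm (Q \<mu> (?c t) ** \<theta> (lam + \<mu>) (?c t) z + F lam (?c t) ** B (?c t) z)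
                \<le> norm (Q \<mu> (?c t)) / 2 + norm (F lam x)"
              using norm_triangle_ineq[of "Q \<mu> (?c t) ** \<theta> (lam + \<mu>) (?c t) z" "F lam (?c t) ** B (?c t) z"]
                b\<theta>\<mu>[OF t \<mu>(2), of "Q \<mu> (?c t)"] bB[OF t, of "F lam (?c t)"] F_bound[OF t] norm_ge_zero[of "F lam x"]
              by linarith
          qed auto
          then show ?thesis by simp
        qed
        have Q_diff: "norm (Q \<mu> y - Q \<nu> y) \<le> 2 * (norm (Q \<mu> x - Q \<nu> x) + norm (\<mu> - \<nu>) * (norm (Q \<nu> x) + norm (F lam x)))"
          if \<mu>: "\<mu> \<noteq> 0" "norm \<mu> < 1" and \<nu>: "\<nu> \<noteq> 0" "norm \<nu> < 1" for \<mu> \<nu>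
        proof -
          let ?C = "norm (\<mu> - \<nu>) * (norm (Q \<nu> x) + norm (F lam x))"
          have "norm (Q \<mu> (?c 1) - Q \<nu> (?c 1)) \<le> 2 * (norm (Q \<mu> (?c 0) - Q \<nu> (?c 0)) + ?C)"
          proof (rule gronwall_unit_interval[OF has_vector_derivative_diff[OF Q'[OF _ \<mu>(1)] Q'[OF _ \<nu>(1)]]])
            fix t :: real assume t: "t \<in> {0..1}"
            have eq: "Q \<mu> (?c t) ** \<theta> (lam + \<mu>) (?c t) z + F lam (?c t) ** B (?c t) z
              - (Q \<nu> (?c t) ** \<theta> (lam + \<nu>) (?c t) z + F lam (?c t) ** B (?c t) z)
              = (Q \<mu> (?c t) - Q \<nu> (?c t)) ** \<theta> (lam + \<mu>) (?c t) z + complex_scale (\<mu> - \<nu>) (Q \<nu> (?c t) ** B (?c t) z)"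
              unfolding aff[OF seg\<Omega>[OF t]]
              by (simp add: matrix_mult.add_right matrix_mult.diff_left complex_scale_mult_right[symmetric] complex_scale_simps)
            have "norm (complex_scale (\<mu> - \<nu>) (Q \<nu> (?c t) ** B (?c t) z)) \<le> ?C"
              unfolding norm_complex_scale
            proof (rule mult_left_mono)
              show "norm (Q \<nu> (?c t) ** B (?c t) z) \<le> norm (Q \<nu> x) + norm (F lam x)"
                using bB[OF t, of "Q \<nu> (?c t)"] Q_bound[OF t \<nu>] norm_ge_zero[of "Q \<nu> x"] norm_ge_zero[of "F lam x"]
                unfolding distrib_left by argo
            qed simp
            moreover have "norm ((Q \<mu> (?c t) - Q \<nu> (?c t)) ** \<theta> (lam + \<mu>) (?c t) z) \<le> norm (Q \<mu> (?c t) - Q \<nu> (?c t)) / 2"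
              by (rule b\<theta>\<mu>[OF t \<mu>(2)])
            ultimately show "norm (Q \<mu> (?c t) ** \<theta> (lam + \<mu>) (?c t) z + F lam (?c t) ** B (?c t) z
              - (Q \<nu> (?c t) ** \<theta> (lam + \<nu>) (?c t) z + F lam (?c t) ** B (?c t) z)) \<le> norm (Q \<mu> (?c t) - Q \<nu> (?c t)) / 2 + ?C"
              unfolding eq by (rule order_trans[OF norm_triangle_ineq add_mono, rotated])
          qed auto
          then show ?thesis by (simp add: z_def)
        qed
        obtain d1 where d1: "d1 > 0" "\<And>\<mu> \<nu>. \<mu> \<noteq> 0 \<Longrightarrow> norm \<mu> < d1 \<Longrightarrow> \<nu> \<noteq> 0 \<Longrightarrow> norm \<nu> < d1 \<Longrightarrow> norm (Q \<mu> x - Q \<nu> x) < 1"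
          using Zx[unfolded Z_def, THEN spec, THEN mp, OF zero_less_one] by blast
        \<comment> \<open>One fixed quotient bounds all others with small parameter, by the Cauchy condition at \<open>x\<close> with tolerance \<open>1\<close>.\<close>
        define \<nu>0 where "\<nu>0 = complex_of_real (d1 / 2)"
        define C where "C = norm (Q \<nu>0 x) + 1 + norm (F lam x)"
        have C0: "C > 0" by (simp add: C_def add_nonneg_pos add_pos_nonneg)
        have C: "norm (Q \<nu> x) + norm (F lam x) \<le> C" if "\<nu> \<noteq> 0" "norm \<nu> < d1" for \<nu>
        proof -
          have "norm (Q \<nu> x - Q \<nu>0 x) < 1" using d1(1) that by (intro d1(2)) (auto simp: \<nu>0_def)
          then show ?thesis using norm_triangle_sub[of "Q \<nu> x" "Q \<nu>0 x"] by (simp add: C_def)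
        qed
        show "Z y"
          unfolding Z_def
        proof (intro allI impI)
          fix e :: real assume e: "e > 0"
          then have e4: "e / 4 > 0" by simp
          obtain d2 where d2: "d2 > 0" "\<And>\<mu> \<nu>. \<mu> \<noteq> 0 \<Longrightarrow> norm \<mu> < d2 \<Longrightarrow> \<nu> \<noteq> 0 \<Longrightarrow> norm \<nu> < d2 \<Longrightarrow> norm (Q \<mu> x - Q \<nu> x) < e / 4"
            using Zx[unfolded Z_def, THEN spec, THEN mp, OF e4] by blast
          define d where "d = Min {1, d1, d2, e / (8 * C)}"
          have d: "d > 0" "d \<le> 1" "d \<le> d1" "d \<le> d2" "d \<le> e / (8 * C)"
            using d1 d2 e C0 by (auto simp: d_def)
          have "norm (Q \<mu> y - Q \<nu> y) < e" if \<mu>: "\<mu> \<noteq> 0" "norm \<mu> < d" "\<nu> \<noteq> 0" "norm \<nu> < d" for \<mu> \<nu>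
          proof -
            have "norm (\<mu> - \<nu>) \<le> 2 * d" using that norm_triangle_ineq4[of \<mu> \<nu>] by linarith
            then have "norm (\<mu> - \<nu>) * (norm (Q \<nu> x) + norm (F lam x)) \<le> 2 * d * C"
              using that d C[of \<nu>] C0 by (intro mult_mono) auto
            also have "\<dots> \<le> e / 4" using d(5) C0 by (simp add: field_simps)
            finally have 1: "norm (\<mu> - \<nu>) * (norm (Q \<nu> x) + norm (F lam x)) \<le> e / 4" .
            have 2: "norm (Q \<mu> x - Q \<nu> x) < e / 4" using that d by (intro d2(2)) auto
            have "norm (Q \<mu> y - Q \<nu> y) \<le> 2 * (norm (Q \<mu> x - Q \<nu> x) + norm (\<mu> - \<nu>) * (norm (Q \<nu> x) + norm (F lam x)))"
              using that d by (intro Q_diff) auto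
            also have "\<dots> < 2 * (e / 4 + e / 4)" using 1 2 by (intro mult_strict_left_mono add_less_le_mono) auto
            finally show ?thesis by simp
          qed
          then show "\<exists>d>0. \<forall>\<mu> \<nu>. \<mu> \<noteq> 0 \<longrightarrow> norm \<mu> < d \<longrightarrow> \<nu> \<noteq> 0 \<longrightarrow> norm \<nu> < d \<longrightarrow> norm (Q \<mu> y - Q \<nu> y) < e"
            using d(1) by blast
        qed
      qed
      have op: "openin (top_of_set \<Omega>) (ball p (R / 2))"
        using R subset_ball[of "R / 2" R p] \<theta>.open_domain by (intro openin_open_eq[THEN iffD2]) auto
      have "p \<in> ball p (R / 2)" using R(1) by simp
      then show ?thesis using op ZZ by blast
    qed
    have "Z a"
      using a by (auto simp: Z_def Q_def complex_scale_simps intro!: exI[of _ 1])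
    then have Zu: "Z u"
      using connected_induction_simple[OF \<theta>.connected_domain a(1) u _ step] by blast
    have "cauchy_filter (filtermap (\<lambda>\<mu>. Q \<mu> u) (at 0))"
      unfolding cauchy_filter_metric_filtermap
    proof (intro allI impI)
      fix e :: real assume e: "e > 0"
      obtain d where d: "d > 0" "\<And>\<mu> \<nu>. \<mu> \<noteq> 0 \<Longrightarrow> norm \<mu> < d \<Longrightarrow> \<nu> \<noteq> 0 \<Longrightarrow> norm \<nu> < d \<Longrightarrow> norm (Q \<mu> u - Q \<nu> u) < e"
        using Zu[unfolded Z_def, THEN spec, THEN mp, OF e] by blast
      have "\<forall>\<^sub>F \<mu> in at 0. \<mu> \<noteq> 0 \<and> norm (\<mu>::complex) < d"
        using d(1) unfolding eventually_at by (auto intro!: exI[of _ d])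
      then show "\<exists>P. eventually P (at 0) \<and> (\<forall>\<mu> \<nu>. P \<mu> \<and> P \<nu> \<longrightarrow> dist (Q \<mu> u) (Q \<nu> u) < e)"
        using d(2) by (intro exI[of _ "\<lambda>\<mu>. \<mu> \<noteq> 0 \<and> norm \<mu> < d"]) (auto simp: dist_norm)
    qed
    from cauchy_filter_complete_converges[OF this complete_UNIV]
    obtain L where "filtermap (\<lambda>\<mu>. Q \<mu> u) (at 0) \<le> nhds L"
      by (auto simp: filtermap_bot_iff)
    then have "((\<lambda>\<mu>. Q \<mu> u) \<longlongrightarrow> L) (at 0)" by (simp add: filterlim_def)
    then have "((\<lambda>\<mu>. Q \<mu> u $ i $ j) \<longlongrightarrow> L $ i $ j) (at 0)"
      by (intro tendsto_intros)
    then have "((\<lambda>lam. F lam u $ i $ j) has_field_derivative L $ i $ j) (at lam)"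
      unfolding DERIV_def by (simp add: Q_def complex_scale_def divide_inverse mult.commute)
    then show ?thesis by blast
  qed
  then show ?thesis
    by (auto simp: holomorphic_on_def field_differentiable_def intro: has_field_derivative_at_within)
qed

section \<open>Geometry of the immersions\<close>

lemma flat_metric_on_cong:
  assumes \<Omega>: "open \<Omega>" and eq: "\<And>u. u \<in> \<Omega> \<Longrightarrow> g u = g' u" and g: "flat_metric_on \<Omega> g"
  shows "flat_metric_on \<Omega> g'"
proof -
  have "smooth_on \<Omega> g'"
    using smooth_on_cong[OF \<Omega> eq] g by (simp add: flat_metric_on_def riemannian_metric_on_def)
  then have "riemannian_metric_on \<Omega> g'"
    using g eq by (simp add: flat_metric_on_def riemannian_metric_on_def)
  moreover have chr: "christoffel g k i j u = christoffel g' k i j u" if u: "u \<in> \<Omega>" for k i j u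
  proof -
    have "partial a (\<lambda>p. g p $ b $ c) u = partial a (\<lambda>p. g' p $ b $ c) u" for a b c
      by (rule partial_cong[OF \<Omega> u]) (simp add: eq)
    then show ?thesis by (simp add: christoffel_def eq[OF u])
  qed
  have "riemann_curvature g' l k i j u = riemann_curvature g l k i j u" if u: "u \<in> \<Omega>" for l k i j u
  proof -
    have "partial a (christoffel g b c d) u = partial a (christoffel g' b c d) u" for a b c d
      by (rule partial_cong[OF \<Omega> u]) (rule chr)
    then show ?thesis by (simp add: riemann_curvature_def chr[OF u])
  qed
  ultimately show ?thesis using g by (simp add: flat_metric_on_def)
qed

lemma normal_part_eqI:
  assumes T: "subspace T" and N: "z - N \<in> T" "\<And>t. t \<in> T \<Longrightarrow> orthogonal N t"
  shows "normal_part T z = N"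
  unfolding normal_part_def
proof (rule the_equality)
  show "z - N \<in> T \<and> (\<forall>t\<in>T. orthogonal N t)" using N by blast
  fix N' assume N': "z - N' \<in> T \<and> (\<forall>t\<in>T. orthogonal N' t)"
  have "(z - N') - (z - N) \<in> T" using subspace_diff[OF T] N N' by blast
  then have d: "N - N' \<in> T" by (simp add: algebra_simps)
  have "orthogonal (N - N') (N - N')"
    using N(2)[OF d] N' d by (simp add: orthogonal_def inner_diff_left)
  then show "N' = N" by (simp add: orthogonal_self)
qed

lemma Ck_on_subset: "Ck_on k S f \<Longrightarrow> T \<subseteq> S \<Longrightarrow> Ck_on k T f"
proof (induction k arbitrary: f)
  case 0
  then show ?case using continuous_on_subset by auto
next
  case (Suc k)
  have "Ck_on k T (\<lambda>u. frechet_derivative f (at u) v)" for v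
    by (rule Suc.IH) (use Suc.prems in auto)
  then show ?case using Suc.prems by auto
qed

lemma smooth_on_subset: "smooth_on S f \<Longrightarrow> T \<subseteq> S \<Longrightarrow> smooth_on T f"
  unfolding smooth_on_def using Ck_on_subset by blast

text \<open>The inverse function theorem gives local inverses \<open>g\<close> whose derivative at \<open>y\<close> is \<open>K (g y)\<close>. Since \<open>K\<close> is smooth, this equation raises the order of
smoothness of \<open>g\<close> step by step.\<close>

lemma local_diffeo_onI:
  fixes x :: "real^'n::finite \<Rightarrow> real^'n"
  assumes \<Omega>: "open \<Omega>" and x: "smooth_on \<Omega> x"
    and K: "\<And>w. smooth_on \<Omega> (\<lambda>u. K u w)" "\<And>u. u \<in> \<Omega> \<Longrightarrow> linear (K u)"
    and Kx: "\<And>u v. u \<in> \<Omega> \<Longrightarrow> K u (frechet_derivative x (at u) v) = v"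
  shows "local_diffeo_on \<Omega> x"
  unfolding local_diffeo_on_def
proof
  fix u assume u: "u \<in> \<Omega>"
  obtain x' where x': "\<And>u. u \<in> \<Omega> \<Longrightarrow> (x has_derivative blinfun_apply (x' u)) (at u)" "continuous_on \<Omega> x'"
    by (rule smooth_on_blinfun_derivative[OF x]) (rule that)
  have fx: "frechet_derivative x (at u) = blinfun_apply (x' u)" if "u \<in> \<Omega>" for u
    using frechet_derivative_at[OF x'(1)[OF that]] by simp
  have KB: "blinfun_apply (Blinfun (K u)) = K u"
    by (rule bounded_linear_Blinfun_apply) (use K(2)[OF u] in \<open>simp add: linear_conv_bounded_linear\<close>)
  have inv: "Blinfun (K u) o\<^sub>L x' u = id_blinfun"
    by (rule blinfun_eqI) (use Kx[OF u] in \<open>simp add: KB fx[OF u]\<close>)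
  obtain U V g g' where UV: "open U" "U \<subseteq> \<Omega>" "u \<in> U" "open V" "x u \<in> V" "homeomorphism U V x g"
    and g': "\<And>y. y \<in> V \<Longrightarrow> (g has_derivative g' y) (at y)"
      "\<And>y. y \<in> V \<Longrightarrow> g' y = inv (blinfun_apply (x' (g y)))"
      "\<And>y. y \<in> V \<Longrightarrow> bij (blinfun_apply (x' (g y)))"
    by (rule inverse_function_theorem[OF \<Omega> x'(1) x'(2) u inv]) (assumption | rule that)+
  have gV: "g y \<in> \<Omega>" if "y \<in> V" for y
    using UV(2,6) that unfolding homeomorphism_def by blast
  have gd: "(g has_derivative K (g y)) (at y)" if y: "y \<in> V" for y
  proof -
    have "g' y w = K (g y) w" for w
    proof -
      obtain v where v: "w = x' (g y) v" using g'(3)[OF y] by (metis bij_pointE)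
      have "inv (blinfun_apply (x' (g y))) w = v"
        unfolding v using g'(3)[OF y] by (simp add: bij_is_inj)
      moreover have "K (g y) w = v"
        using Kx[OF gV[OF y], of v] by (simp add: v fx[OF gV[OF y]])
      ultimately show ?thesis using g'(2)[OF y] by simp
    qed
    then have "g' y = K (g y)" by blast
    then show ?thesis using g'(1)[OF y] by simp
  qed
  have "Ck_on k V g" for k
  proof (induction k)
    case 0
    have "continuous_on V g" using UV(6) by (simp add: homeomorphism_def)
    then show ?case by simp
  next
    case (Suc k)
    show ?case
    proof (rule Ck_on_SucI[OF UV(4) gd])
      show "Ck_on k V (\<lambda>y. K (g y) w)" for w
        by (rule Ck_on_compose[OF UV(4) _ Suc K(1)]) (use gV in blast)
    qed
  qed
  then have "smooth_on V g" by (simp add: smooth_on_def)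
  then show "\<exists>U V y. open U \<and> u \<in> U \<and> U \<subseteq> \<Omega> \<and> open V \<and> homeomorphism U V x y \<and> smooth_on U x \<and> smooth_on V y"
    using UV smooth_on_subset[OF x UV(2)] by blast
qed

definition adjoint_mat :: "complex^'n::finite^'m::finite \<Rightarrow> complex^'m^'n" where
  "adjoint_mat A = (\<chi> i j. cnj (A $ j $ i))"

lemma adjoint_mat_mult: "adjoint_mat (A ** B) = adjoint_mat B ** adjoint_mat A"
  by (simp add: adjoint_mat_def matrix_matrix_mult_def vec_eq_iff cnj_sum mult.commute)

lemma bounded_linear_adjoint_mat: "bounded_linear adjoint_mat"
  unfolding linear_conv_bounded_linear[symmetric]
  by (rule linearI) (simp_all add: adjoint_mat_def vec_eq_iff)

lemma hermitian_mult: "hermitian x (A *v y) = hermitian (adjoint_mat A *v x) y"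
proof -
  have "hermitian x (A *v y) = (\<Sum>i\<in>UNIV. \<Sum>j\<in>UNIV. cnj (x $ i) * (A $ i $ j * y $ j))"
    by (simp add: hermitian_def matrix_vector_mult_def sum_distrib_left)
  also have "\<dots> = (\<Sum>j\<in>UNIV. \<Sum>i\<in>UNIV. cnj (x $ i) * (A $ i $ j * y $ j))"
    by (rule sum.swap)
  also have "\<dots> = hermitian (adjoint_mat A *v x) y"
    by (simp add: hermitian_def matrix_vector_mult_def adjoint_mat_def sum_distrib_left sum_distrib_right cnj_sum mult_ac)
  finally show ?thesis .
qed

lemma bounded_bilinear_matrix_vector_mult:
  "bounded_bilinear ((*v) :: complex^'n::finite^'m::finite \<Rightarrow> complex^'n \<Rightarrow> complex^'m)"
  unfolding bilinear_conv_bounded_bilinear[symmetric] bilinear_def linear_iff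
  by (simp add: matrix_vector_mult_def vec_eq_iff sum.distrib algebra_simps scaleR_sum_right)

locale egoroff_frame = egoroff \<Omega> \<phi> h
  for \<Omega> :: "(real^'n::finite) set" and \<phi> h +
  fixes F :: "complex \<Rightarrow> real^'n \<Rightarrow> complex^('n option)^('n option)"
  assumes connected_\<Omega>: "connected \<Omega>" and zero_in: "0 \<in> \<Omega>"
    and F: "\<And>lam. solves_on \<Omega> (theta_form h lam) (F lam)" and F_zero: "\<And>lam. F lam 0 = mat 1"
begin

sublocale theta: matrix_form \<Omega> "theta_form h lam" for lam
  by (rule matrix_form.intro) (auto intro: open_\<Omega> connected_\<Omega> theta_form_linear theta_form_smooth)

sublocale w: matrix_form \<Omega> "w_form (rotation_coeff h) lam" for lam
  by (rule matrix_form.intro) (auto intro: open_\<Omega> connected_\<Omega> w_form_linear w_form_smooth)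

definition E :: "real^'n \<Rightarrow> complex \<Rightarrow> complex^'n^'n" where
  "E u lam = (\<chi> i j. F lam u $ Some i $ Some j)"

definition X :: "real^'n \<Rightarrow> complex \<Rightarrow> complex^'n" where
  "X u lam = (\<chi> i. F lam u $ Some i $ None)"

text \<open>The constant matrix \<open>P\<close> that has a single \<open>1\<close> in the bottom right corner solves the equation, because the bottom row of the
form vanishes. So does \<open>P ** F\<close>, whose bottom row is that of \<open>F\<close>.\<close>

lemma bottom_row:
  assumes u: "u \<in> \<Omega>"
  shows "F lam u $ None $ b = (if b = None then 1 else 0)"
proof -
  define P :: "complex^('n option)^('n option)" where "P = (\<chi> a b. if a = None \<and> b = None then 1 else 0)"
  have PM: "(P ** M) $ None $ b = M $ None $ b" "(P ** M) $ Some i $ b = 0" for M :: "complex^('n option)^('n option)" and b i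
    by (simp_all add: P_def matrix_matrix_mult_def sum_option)
  have "P ** theta_form h lam u v = 0" for u v
  proof -
    have "(P ** theta_form h lam u v) $ a $ b = 0" for a b
      by (cases a) (simp_all add: PM theta_form_nth)
    then show ?thesis by (simp add: vec_eq_iff)
  qed
  then have "solves_on \<Omega> (theta_form h lam) (\<lambda>u. P)" by (simp add: solves_on_def)
  from theta.solution_unique[OF theta.left_mult_solution[OF F] this zero_in _ u, of P]
  have "P ** F lam u = P" by (simp add: F_zero)
  then show ?thesis using PM(1)[of "F lam u" b] by (simp add: P_def)
qed

lemma F_block: "u \<in> \<Omega> \<Longrightarrow> F lam u = block_mat (E u lam) (X u lam) 0 1"
  by (auto simp: vec_eq_iff block_mat_def E_def X_def bottom_row split: option.split)

lemma E_solves: "solves_on \<Omega> (w_form (rotation_coeff h) lam) (\<lambda>u. E u lam)"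
  unfolding solves_on_def
proof
  fix u assume u: "u \<in> \<Omega>"
  let ?L = "\<lambda>M::complex^('n option)^('n option). (\<chi> i j. M $ Some i $ Some j) :: complex^'n^'n"
  have "linear ?L" by (rule linearI) (simp_all add: vec_eq_iff)
  then have "bounded_linear ?L" by (simp add: linear_conv_bounded_linear)
  from bounded_linear.has_derivative[OF this, of "F lam"] F[of lam] u
  have "((\<lambda>u. E u lam) has_derivative (\<lambda>v. ?L (F lam u ** theta_form h lam u v))) (at u)"
    unfolding E_def solves_on_def by blast
  moreover have "?L (F lam u ** theta_form h lam u v) = E u lam ** w_form (rotation_coeff h) lam u v" for v
    by (simp add: vec_eq_iff matrix_matrix_mult_def sum_option theta_form_nth w_form_nth E_def)
  ultimately show "((\<lambda>u. E u lam) has_derivative (\<lambda>v. E u lam ** w_form (rotation_coeff h) lam u v)) (at u)"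
    by simp
qed

lemma E_zero: "E 0 lam = mat 1"
  by (simp add: E_def F_zero mat_def vec_eq_iff)

lemma F_is_frame: "is_frame_on \<Omega> (theta_form h lam) (\<lambda>u. block_mat (E u lam) (X u lam) 0 1)"
proof (rule theta.is_frameI[OF zero_in])
  show "solves_on \<Omega> (theta_form h lam) (\<lambda>u. block_mat (E u lam) (X u lam) 0 1)"
    unfolding solves_on_def
  proof
    fix u assume u: "u \<in> \<Omega>"
    have "(F lam has_derivative (\<lambda>v. F lam u ** theta_form h lam u v)) (at u)"
      using F u by (simp add: solves_on_def)
    from has_derivative_transform_within_open[OF this open_\<Omega> u F_block]
    show "((\<lambda>u. block_mat (E u lam) (X u lam) 0 1) has_derivative
        (\<lambda>v. block_mat (E u lam) (X u lam) 0 1 ** theta_form h lam u v)) (at u)"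
      unfolding F_block[OF u] .
  qed
  show "block_mat (E 0 lam) (X 0 lam) 0 1 = mat 1"
    using F_block[OF zero_in, of lam] by (simp add: F_zero)
qed

lemma E_is_frame: "is_frame_on \<Omega> (w_form (rotation_coeff h) lam) (\<lambda>u. E u lam)"
  by (rule w.is_frameI[OF zero_in E_solves E_zero])

lemma F_holomorphic: "u \<in> \<Omega> \<Longrightarrow> (\<lambda>lam. F lam u $ a $ b) holomorphic_on UNIV"
proof (rule affine_family_holomorphic[where F = F and \<theta> = "theta_form h" and \<Omega> = \<Omega>])
  let ?B = "\<lambda>u v. block_mat (\<chi> i j. \<i> * delta v $ i $ j) 0 0 0 :: complex^('n option)^('n option)"
  have B: "?B u v $ a $ b = (case (a, b) of (Some i, Some j) \<Rightarrow> if i = j then \<i> * of_real (v $ i) else 0 | _ \<Rightarrow> 0)" for u v a b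
    by (auto simp: block_mat_def delta_nth split: option.split)
  show "matrix_form \<Omega> ?B"
  proof (rule matrix_form.intro)
    show "linear (?B u)" for u :: "real^'n"
      by (rule linearI) (auto simp: vec_eq_iff B algebra_simps scaleR_conv_of_real[where 'a = complex] split: option.split)
    show "smooth_on \<Omega> (\<lambda>u. ?B u v)" for v by (rule smooth_on_const[OF open_\<Omega>])
  qed (rule open_\<Omega> connected_\<Omega>)+
  show "theta_form h (lam + \<mu>) u v = theta_form h lam u v + complex_scale \<mu> (?B u v)" for lam \<mu> u v
  proof -
    have "theta_form h (lam + \<mu>) u v $ a $ b = theta_form h lam u v $ a $ b + \<mu> * ?B u v $ a $ b" for a b
      unfolding B by (cases a; cases b) (auto simp: theta_form_nth algebra_simps)
    then show ?thesis by (simp add: vec_eq_iff complex_scale_def)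
  qed
  show "F lam 0 = mat 1" for lam by (rule F_zero)
qed (auto intro: theta.matrix_form_axioms F zero_in)

definition delta_h :: "real^'n \<Rightarrow> real^'n \<Rightarrow> complex^'n" where
  "delta_h u v = delta v *v complex_vec (h u)"

lemma delta_h_nth: "delta_h u v $ l = of_real (v $ l * h u $ l)"
  by (simp add: delta_h_def delta_mult_nth complex_vec_def)

lemma X_derivative:
  assumes u: "u \<in> \<Omega>"
  shows "((\<lambda>u. X u lam) has_derivative (\<lambda>v. E u lam *v delta_h u v)) (at u)"
proof -
  let ?L = "\<lambda>M::complex^('n option)^('n option). (\<chi> i. M $ Some i $ None) :: complex^'n"
  have "linear ?L" by (rule linearI) (simp_all add: vec_eq_iff)
  then have "bounded_linear ?L" by (simp add: linear_conv_bounded_linear)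
  from bounded_linear.has_derivative[OF this, of "F lam"] F[of lam] u
  have "((\<lambda>u. X u lam) has_derivative (\<lambda>v. ?L (F lam u ** theta_form h lam u v))) (at u)"
    unfolding X_def solves_on_def by blast
  moreover have "?L (F lam u ** theta_form h lam u v) = E u lam *v delta_h u v" for v
    by (simp add: vec_eq_iff matrix_matrix_mult_def matrix_vector_mult_def sum_option theta_form_nth E_def delta_h_nth)
  ultimately show ?thesis by simp
qed

lemma frechet_X: "u \<in> \<Omega> \<Longrightarrow> frechet_derivative (\<lambda>u. X u lam) (at u) = (\<lambda>v. E u lam *v delta_h u v)"
  using frechet_derivative_at[OF X_derivative] by simp

lemma X_smooth: "smooth_on \<Omega> (\<lambda>u. X u lam)"
  unfolding X_def
  by (intro smooth_on_vec open_\<Omega>) (simp add: smooth_on_nth open_\<Omega> theta.solution_smooth[OF F])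

lemma adjoint_w_form:
  assumes u: "u \<in> \<Omega>"
  shows "adjoint_mat (w_form (rotation_coeff h) (of_real lam) u v) = - w_form (rotation_coeff h) (of_real lam) u v"
proof -
  have "adjoint_mat (w_form (rotation_coeff h) (of_real lam) u v) $ i $ j
      = - w_form (rotation_coeff h) (of_real lam) u v $ i $ j" for i j
    unfolding adjoint_mat_def by (simp add: w_form_nth W_antisym[OF u, of v j i])
  then show ?thesis by (simp add: vec_eq_iff)
qed

text \<open>The derivative of \<open>E E\<^sup>*\<close> is \<open>E (w + w\<^sup>*) E\<^sup>*\<close>, which vanishes because \<open>w\<close> is skew-Hermitian for real \<open>lam\<close>.\<close>

lemma E_unitary:
  fixes lam :: real
  assumes u: "u \<in> \<Omega>"
  shows "adjoint_mat (E u (of_real lam)) ** E u (of_real lam) = mat 1"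
proof -
  let ?E = "\<lambda>u. E u (of_real lam)" and ?w = "w_form (rotation_coeff h) (of_real lam)"
  have "((\<lambda>u. ?E u ** adjoint_mat (?E u)) has_derivative (\<lambda>v. 0)) (at u)" if u: "u \<in> \<Omega>" for u
  proof -
    have d: "(?E has_derivative (\<lambda>v. ?E u ** ?w u v)) (at u)"
      using E_solves u by (simp add: solves_on_def)
    have "((\<lambda>u. ?E u ** adjoint_mat (?E u)) has_derivative
      (\<lambda>v. ?E u ** adjoint_mat (?E u ** ?w u v) + (?E u ** ?w u v) ** adjoint_mat (?E u))) (at u)"
      by (intro matrix_mult.FDERIV d bounded_linear.has_derivative[OF bounded_linear_adjoint_mat])
    moreover have "?E u ** adjoint_mat (?E u ** ?w u v) + (?E u ** ?w u v) ** adjoint_mat (?E u) = 0" for v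
      by (simp add: adjoint_mat_mult adjoint_w_form[OF u] matrix_mult.minus_left matrix_mult.minus_right matrix_mul_assoc)
    ultimately show ?thesis by simp
  qed
  from has_derivative_zero_unique_connected[OF open_\<Omega> connected_\<Omega> this u zero_in]
  have "?E u ** adjoint_mat (?E u) = ?E 0 ** adjoint_mat (?E 0)" .
  also have "adjoint_mat (?E 0) = mat 1"
    unfolding E_zero by (simp add: adjoint_mat_def mat_def vec_eq_iff)
  also have "?E 0 ** mat 1 = mat 1" by (simp add: E_zero)
  finally show ?thesis using matrix_left_right_inverse by blast
qed

lemma hermitian_E:
  fixes lam :: real
  assumes u: "u \<in> \<Omega>"
  shows "hermitian (E u (of_real lam) *v x) (E u (of_real lam) *v y) = hermitian x y"
  unfolding hermitian_mult by (simp add: matrix_vector_mul_assoc E_unitary[OF u])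

lemma hermitian_dX:
  fixes lam :: real
  assumes u: "u \<in> \<Omega>"
  shows "hermitian (E u (of_real lam) *v delta_h u v) (E u (of_real lam) *v delta_h u w) =
    of_real (\<Sum>i\<in>UNIV. partial i \<phi> u * (v $ i * w $ i))"
  unfolding hermitian_E[OF u]
  by (simp add: hermitian_def delta_h_nth partial_\<phi>[OF u] power2_eq_square mult_ac)

lemma first_ff_X:
  fixes lam :: real
  assumes u: "u \<in> \<Omega>"
  shows "first_ff (\<lambda>u. X u (of_real lam)) u v w = (\<Sum>i\<in>UNIV. partial i \<phi> u * (v $ i * w $ i))"
  by (simp add: first_ff_def frechet_X[OF u] inner_eq_Re_hermitian hermitian_dX[OF u])

lemma sum_partial_\<phi>_eq_0:
  assumes u: "u \<in> \<Omega>" and "(\<Sum>i\<in>UNIV. partial i \<phi> u * (v $ i * v $ i)) = 0"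
  shows "v = 0"
proof -
  have "\<forall>i\<in>UNIV. partial i \<phi> u * (v $ i * v $ i) = 0"
    using assms(2) by (subst (asm) sum_nonneg_eq_0_iff) (auto simp: partial_\<phi>[OF u])
  then show ?thesis using H_nonzero[OF u] by (simp add: vec_eq_iff partial_\<phi>[OF u])
qed

lemma X_lagrangian:
  fixes lam :: real
  shows "lagrangian_immersion_on \<Omega> (\<lambda>u. X u (of_real lam))"
proof -
  have "inj (frechet_derivative (\<lambda>u. X u (of_real lam)) (at u))" if u: "u \<in> \<Omega>" for u
  proof -
    have lin: "linear (frechet_derivative (\<lambda>u. X u (of_real lam)) (at u))"
      unfolding frechet_X[OF u] by (rule has_derivative_linear[OF X_derivative[OF u]])
    have "v = 0" if "frechet_derivative (\<lambda>u. X u (of_real lam)) (at u) v = 0" for v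
      using first_ff_X[OF u, of lam v v] that sum_partial_\<phi>_eq_0[OF u, of v] by (simp add: first_ff_def)
    then show ?thesis using linear_injective_0[OF lin] by blast
  qed
  then show ?thesis
    using X_smooth by (simp add: lagrangian_immersion_on_def immersion_on_def omega_def frechet_X hermitian_dX)
qed

lemma X_flat_metric:
  fixes lam :: real
  shows "flat_metric_on \<Omega> (induced_metric (\<lambda>u. X u (of_real lam)))"
proof (rule flat_metric_on_cong[OF open_\<Omega>])
  show "flat_metric_on \<Omega> (diag_metric h)"
    using egoroff_metric by (simp add: flat_egoroff_metric_on_def)
  show "diag_metric h u = induced_metric (\<lambda>u. X u (of_real lam)) u" if u: "u \<in> \<Omega>" for u
    by (simp add: vec_eq_iff diag_metric_def induced_metric_def first_ff_X[OF u] partial_\<phi>[OF u] axis_def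
        if_distrib[where f = "\<lambda>x. _ * x"] if_distrib[where f = "\<lambda>x. x * _"] cong: if_cong)
qed

text \<open>The product rule for \<open>dX = E \<delta> h\<close>, sorted into the terms without \<open>lam\<close> and the one with \<open>lam\<close>.\<close>

lemma second_derivative_X:
  assumes u: "u \<in> \<Omega>"
  shows "frechet_derivative (\<lambda>q. frechet_derivative (\<lambda>u. X u lam) (at q) w) (at u) v =
    E u lam *v (\<chi> l. of_real (w $ l * D (H l) u v + (\<Sum>m\<in>UNIV. W v l m u * (w $ m * h u $ m)))
      + \<i> * lam * of_real (v $ l * w $ l * h u $ l))"
proof -
  have dE: "((\<lambda>u. E u lam) has_derivative (\<lambda>v. E u lam ** w_form (rotation_coeff h) lam u v)) (at u)"
    using E_solves u by (simp add: solves_on_def)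
  have dp: "((\<lambda>q. delta_h q w) has_derivative (\<lambda>v. \<chi> l. of_real (w $ l * D (H l) u v))) (at u)"
  proof -
    let ?L = "\<lambda>y::real^'n. (\<chi> l. of_real (w $ l * y $ l)) :: complex^'n"
    have "linear ?L" by (rule linearI) (simp_all add: vec_eq_iff algebra_simps scaleR_conv_of_real[where 'a = complex])
    then have "bounded_linear ?L" by (simp add: linear_conv_bounded_linear)
    from bounded_linear.has_derivative[OF this smooth_on_has_derivative[OF smooth_h u]]
    have "((\<lambda>q. ?L (h q)) has_derivative (\<lambda>v. ?L (frechet_derivative h (at u) v))) (at u)" .
    moreover have "frechet_derivative h (at u) v $ l = D (H l) u v" for v l
      using fun_cong[OF frechet_derivative_at[OF bounded_linear.has_derivative[OF bounded_linear_vec_nth[of l]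
            smooth_on_has_derivative[OF smooth_h u]]], of v]
      by (simp add: D_def)
    moreover have "?L (h q) = delta_h q w" for q by (simp add: vec_eq_iff delta_h_nth)
    ultimately show ?thesis by simp
  qed
  have "((\<lambda>q. E q lam *v delta_h q w) has_derivative
      (\<lambda>v. E u lam *v (\<chi> l. of_real (w $ l * D (H l) u v)) + (E u lam ** w_form (rotation_coeff h) lam u v) *v delta_h u w)) (at u)"
    by (rule bounded_bilinear.FDERIV[OF bounded_bilinear_matrix_vector_mult dE dp])
  then have "((\<lambda>q. frechet_derivative (\<lambda>u. X u lam) (at q) w) has_derivative
      (\<lambda>v. E u lam *v (\<chi> l. of_real (w $ l * D (H l) u v)) + (E u lam ** w_form (rotation_coeff h) lam u v) *v delta_h u w)) (at u)"
    by (rule has_derivative_transform_within_open[OF _ open_\<Omega> u]) (simp add: frechet_X)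
  from fun_cong[OF frechet_derivative_at[OF this], of v]
  have "frechet_derivative (\<lambda>q. frechet_derivative (\<lambda>u. X u lam) (at q) w) (at u) v =
      E u lam *v ((\<chi> l. of_real (w $ l * D (H l) u v)) + w_form (rotation_coeff h) lam u v *v delta_h u w)"
    by (simp add: matrix_vector_mul_assoc matrix_vector_right_distrib)
  also have "(\<chi> l. of_real (w $ l * D (H l) u v)) + w_form (rotation_coeff h) lam u v *v delta_h u w =
     (\<chi> l. of_real (w $ l * D (H l) u v + (\<Sum>m\<in>UNIV. W v l m u * (w $ m * h u $ m)))
      + \<i> * lam * of_real (v $ l * w $ l * h u $ l))"
  proof -
    have "w_form (rotation_coeff h) lam u v $ l $ m * delta_h u w $ m =
      (if l = m then \<i> * lam * of_real (v $ l * w $ l * h u $ l) else 0) + of_real (W v l m u * (w $ m * h u $ m))" for l m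
      by (simp add: w_form_nth delta_h_nth algebra_simps)
    then show ?thesis by (simp add: vec_eq_iff matrix_vector_mult_def sum.distrib)
  qed
  finally show ?thesis .
qed

text \<open>With \<open>E\<close> unitary, \<open>E\<close> maps real vectors to tangent vectors and imaginary vectors to normal vectors, so the normal part of the
second derivative is the image of its imaginary part \<open>n\<close>.\<close>

lemma second_ff_X:
  fixes lam :: real
  assumes u: "u \<in> \<Omega>"
  shows "second_ff (\<lambda>u. X u (of_real lam)) u v w =
    lam *\<^sub>R (\<Sum>i\<in>UNIV. (v $ i * w $ i) *\<^sub>R J_mult (partial i (\<lambda>u. X u (of_real lam)) u))"
  unfolding second_ff_def
proof (rule normal_part_eqI)
  let ?X = "\<lambda>u. X u (of_real lam)" and ?E = "E u (of_real lam)"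
  let ?T = "range (frechet_derivative ?X (at u))"
  let ?N = "lam *\<^sub>R (\<Sum>i\<in>UNIV. (v $ i * w $ i) *\<^sub>R J_mult (partial i ?X u))"
  define n :: "complex^'n" where "n = (\<chi> l. \<i> * of_real (lam * (v $ l * w $ l * h u $ l)))"
  define r :: "real^'n" where "r = (\<chi> l. w $ l * D (H l) u v + (\<Sum>m\<in>UNIV. W v l m u * (w $ m * h u $ m)))"
  have lin: "linear (frechet_derivative ?X (at u))"
    unfolding frechet_X[OF u] by (rule has_derivative_linear[OF X_derivative[OF u]])
  show "subspace ?T" by (rule linear_subspace_image[OF lin subspace_UNIV])
  have N: "?N = ?E *v n"
  proof -
    have "partial i ?X u $ k = ?E $ k $ i * of_real (h u $ i)" for i k
      by (simp add: partial_def frechet_X[OF u] matrix_vector_mult_def delta_h_nth axis_def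
        if_distrib[where f = "\<lambda>x. _ * x"] if_distrib[where f = "\<lambda>x. x * _"] if_distrib[where f = of_real] cong: if_cong)
    then show ?thesis
      by (simp add: vec_eq_iff J_mult_def n_def matrix_vector_mult_def scaleR_sum_right scaleR_conv_of_real[where 'a = complex] mult_ac)
  qed
  have "?E *v (\<chi> l. of_real (r $ l) + \<i> * of_real lam * of_real (v $ l * w $ l * h u $ l)) - ?E *v n
      = ?E *v delta_h u (\<chi> l. r $ l / h u $ l)"
    unfolding matrix_vector_mult_diff_distrib[symmetric]
    using H_nonzero[OF u] by (intro arg_cong[where f = "\<lambda>y. ?E *v y"]) (simp add: vec_eq_iff n_def delta_h_nth mult_ac)
  then show "frechet_derivative (\<lambda>q. frechet_derivative ?X (at q) w) (at u) v - ?N \<in> ?T"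
    unfolding second_derivative_X[OF u] N frechet_X[OF u] r_def by auto
  fix t assume "t \<in> ?T"
  then obtain a where t: "t = ?E *v delta_h u a" unfolding frechet_X[OF u] by blast
  have "?N \<bullet> t = Re (hermitian n (delta_h u a))"
    unfolding N t inner_eq_Re_hermitian hermitian_E[OF u] ..
  also have "\<dots> = 0" by (simp add: hermitian_def n_def delta_h_nth)
  finally show "orthogonal ?N t" by (simp add: orthogonal_def)
qed

text \<open>The entrywise conjugate of \<open>F 0\<close> solves the same equation, since the form is real for \<open>\<lambda> = 0\<close>.\<close>

lemma F_zero_real:
  assumes u: "u \<in> \<Omega>"
  shows "F 0 u $ a $ b \<in> \<real>"
proof -
  let ?C = "\<lambda>M::complex^('n option)^('n option). (\<chi> a b. cnj (M $ a $ b)) :: complex^('n option)^('n option)"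
  have "linear ?C" by (rule linearI) (simp_all add: vec_eq_iff)
  then have C: "bounded_linear ?C" by (simp add: linear_conv_bounded_linear)
  have th: "cnj (theta_form h 0 u v $ a $ b) = theta_form h 0 u v $ a $ b" for u v a b
    by (cases a; cases b) (simp_all add: theta_form_nth)
  have "solves_on \<Omega> (theta_form h 0) (\<lambda>u. ?C (F 0 u))"
    unfolding solves_on_def
  proof
    fix u assume "u \<in> \<Omega>"
    then have "((\<lambda>u. ?C (F 0 u)) has_derivative (\<lambda>v. ?C (F 0 u ** theta_form h 0 u v))) (at u)"
      using F[of 0] by (intro bounded_linear.has_derivative[OF C]) (simp add: solves_on_def)
    moreover have "?C (F 0 u ** theta_form h 0 u v) = ?C (F 0 u) ** theta_form h 0 u v" for v
      by (simp add: vec_eq_iff matrix_matrix_mult_def cnj_sum th)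
    ultimately show "((\<lambda>u. ?C (F 0 u)) has_derivative (\<lambda>v. ?C (F 0 u) ** theta_form h 0 u v)) (at u)"
      by simp
  qed
  moreover have "?C (F 0 0) = F 0 0" by (simp add: F_zero mat_def vec_eq_iff)
  ultimately have "?C (F 0 u) = F 0 u"
    using theta.solution_unique[OF _ F zero_in _ u] by blast
  then have "cnj (F 0 u $ a $ b) = F 0 u $ a $ b" by (simp add: vec_eq_iff)
  then show ?thesis by (simp add: Reals_cnj_iff)
qed

lemma X_zero_real: "u \<in> \<Omega> \<Longrightarrow> X u 0 $ i \<in> \<real>"
  by (simp add: X_def F_zero_real)

text \<open>As \<open>X u 0\<close> is real, the inner products of the partial derivatives of its real part are those of the first fundamental
form. So the partial derivatives are orthogonal with norms \<open>|h\<^sub>i|\<close>, which gives both the net and an explicit inverse \<open>K\<close> of the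
Jacobian.\<close>

lemma egoroff_net_X: "egoroff_net_on \<Omega> (\<lambda>u. \<chi> i. Re (X u 0 $ i))"
proof -
  let ?x = "\<lambda>u. (\<chi> i. Re (X u 0 $ i)) :: real^'n"
  let ?R = "\<lambda>z::complex^'n. (\<chi> i. Re (z $ i)) :: real^'n"
  have "linear ?R" by (rule linearI) (simp_all add: vec_eq_iff)
  then have R: "bounded_linear ?R" by (simp add: linear_conv_bounded_linear)
  have x_smooth: "smooth_on \<Omega> ?x" by (rule smooth_on_bounded_linear[OF open_\<Omega> R X_smooth])
  have fx: "frechet_derivative ?x (at u) = (\<lambda>v. ?R (E u 0 *v delta_h u v))" if u: "u \<in> \<Omega>" for u
    using frechet_derivative_at[OF bounded_linear.has_derivative[OF R X_derivative[OF u]]] by simp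
  have lin: "linear (frechet_derivative ?x (at u))" if "u \<in> \<Omega>" for u
    by (rule has_derivative_linear[OF smooth_on_has_derivative[OF x_smooth that]])
  have inner: "frechet_derivative ?x (at u) v \<bullet> frechet_derivative ?x (at u) w = (\<Sum>i\<in>UNIV. partial i \<phi> u * (v $ i * w $ i))"
    if u: "u \<in> \<Omega>" for u v w
  proof -
    have re: "E u 0 $ i $ j \<in> \<real>" for i j using F_zero_real[OF u] by (simp add: E_def)
    have "(E u 0 *v delta_h u v) $ i \<in> \<real>" for v i
      by (auto simp: matrix_vector_mult_def delta_h_nth intro!: sum_in_Reals Reals_mult re)
    then have "?R (E u 0 *v delta_h u v) \<bullet> ?R (E u 0 *v delta_h u w) = (E u 0 *v delta_h u v) \<bullet> (E u 0 *v delta_h u w)"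
      by (simp add: inner_vec_def inner_complex_def complex_is_Real_iff)
    then show ?thesis
      using hermitian_dX[OF u, of 0 v w] by (simp add: fx[OF u] inner_eq_Re_hermitian)
  qed
  have inner_partial: "partial i ?x u \<bullet> frechet_derivative ?x (at u) v = (h u $ i)\<^sup>2 * v $ i" if "u \<in> \<Omega>" for u v i
    unfolding partial_def[of i ?x] inner[OF that]
    by (simp add: axis_def partial_\<phi>[OF that] if_distrib[where f = "\<lambda>x. _ * x"] if_distrib[where f = "\<lambda>x. x * _"] cong: if_cong)
  have "local_diffeo_on \<Omega> ?x"
  proof (rule local_diffeo_onI[OF open_\<Omega> x_smooth])
    let ?K = "\<lambda>u w. (\<chi> i. (partial i ?x u \<bullet> w) / (h u $ i * h u $ i)) :: real^'n"
    show "smooth_on \<Omega> (\<lambda>u. ?K u w)" for w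
    proof (rule smooth_on_vec[OF open_\<Omega>])
      have "smooth_on \<Omega> (\<lambda>u. partial i ?x u \<bullet> w)" for i
        by (rule smooth_on_bounded_linear[OF open_\<Omega> bounded_linear_inner_left smooth_on_partial[OF x_smooth]])
      then show "smooth_on \<Omega> (\<lambda>u. ?K u w $ i)" for i
        using H_nonzero by (auto intro!: smooth_on_divide smooth_on_mult smooth_H open_\<Omega>)
    qed
    show "linear (?K u)" for u
      by (rule linearI) (simp_all add: vec_eq_iff inner_add_right add_divide_distrib)
    show "?K u (frechet_derivative ?x (at u) v) = v" if "u \<in> \<Omega>" for u v
      using H_nonzero[OF that] by (simp add: vec_eq_iff inner_partial[OF that] power2_eq_square)
  qed
  moreover have "partial i ?x u \<bullet> partial j ?x u = (if i = j then (h u $ i)\<^sup>2 else 0)" if "u \<in> \<Omega>" for u i j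
    using inner_partial[OF that, of i "axis j 1"] by (simp add: partial_def axis_def)
  moreover have "smooth_on \<Omega> \<phi> \<and> (\<forall>u\<in>\<Omega>. \<forall>i. partial i \<phi> u = (norm (partial i ?x u))\<^sup>2)"
    using calculation(2) by (simp add: smooth_\<phi> partial_\<phi> power2_norm_eq_inner)
  ultimately show ?thesis
    unfolding egoroff_net_on_def orthogonal_def by auto
qed

end

theorem theorem2p2:
  fixes \<Omega> :: "(real^'n::finite) set"
    and \<phi> :: "real^'n \<Rightarrow> real"
    and h :: "real^'n \<Rightarrow> real^'n"
  assumes "open \<Omega>" and "connected \<Omega>" and "simply_connected \<Omega>" and "0 \<in> \<Omega>"
    and "flat_egoroff_metric_on \<Omega> \<phi> h"
  shows "(\<forall>lam. flat_form_on \<Omega> (theta_form h lam)) \<and>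
    (\<exists>(E :: real^'n \<Rightarrow> complex \<Rightarrow> complex^'n^'n) (X :: real^'n \<Rightarrow> complex \<Rightarrow> complex^'n).
      (\<forall>lam. is_frame_on \<Omega> (theta_form h lam) (\<lambda>u. block_mat (E u lam) (X u lam) 0 1)) \<and>
      (\<forall>u\<in>\<Omega>. \<forall>i j. (\<lambda>lam. block_mat (E u lam) (X u lam) 0 1 $ i $ j) holomorphic_on UNIV) \<and>
      (\<forall>lam. is_frame_on \<Omega> (w_form (rotation_coeff h) lam) (\<lambda>u. E u lam)) \<and>
      (\<forall>lam::real. let Xl = (\<lambda>u. X u (complex_of_real lam)) in
        lagrangian_immersion_on \<Omega> Xl \<and>
        flat_metric_on \<Omega> (induced_metric Xl) \<and>
        (\<forall>u\<in>\<Omega>. \<forall>v w. first_ff Xl u v w = (\<Sum>i\<in>UNIV. partial i \<phi> u * (v $ i * w $ i))) \<and>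
        (\<forall>u\<in>\<Omega>. \<forall>v w. second_ff Xl u v w =
           lam *\<^sub>R (\<Sum>i\<in>UNIV. (v $ i * w $ i) *\<^sub>R J_mult (partial i Xl u)))) \<and>
      (\<forall>u\<in>\<Omega>. \<forall>i. X u 0 $ i \<in> \<real>) \<and>
      egoroff_net_on \<Omega> (\<lambda>u. \<chi> i. Re (X u 0 $ i)))"
proof -
  interpret egoroff \<Omega> \<phi> h using assms by unfold_locales
  have "\<exists>F. F 0 = mat 1 \<and> solves_on \<Omega> (theta_form h lam) F" for lam
  proof -
    interpret matrix_form \<Omega> "theta_form h lam"
      by (rule matrix_form.intro) (auto intro: assms theta_form_linear theta_form_smooth)
    show ?thesis
      by (rule solution_exists[OF assms(3,4) theta_form_flat, of "mat 1"]) blast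
  qed
  then obtain F where F: "\<And>lam. F lam 0 = mat 1" "\<And>lam. solves_on \<Omega> (theta_form h lam) (F lam)"
    by metis
  interpret egoroff_frame \<Omega> \<phi> h F
    by standard (use assms F in auto)
  have hol: "(\<lambda>lam. block_mat (E u lam) (X u lam) 0 1 $ i $ j) holomorphic_on UNIV" if "u \<in> \<Omega>" for u i j
    using F_holomorphic[OF that, of i j] by (simp add: F_block[OF that])
  show ?thesis
    unfolding Let_def
    using theta_form_flat F_is_frame hol E_is_frame X_lagrangian X_flat_metric first_ff_X second_ff_X
      X_zero_real egoroff_net_X
    by (intro conjI exI[of _ E] exI[of _ X] allI ballI) auto
qed

end
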